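(* Let $X$ be a separable Banach space, $(T,\Sigma,\mu)$ a complete $\sigma$-finite measure space, and $f:T\times X\to\overline{\mathbb{R}}$ a convex normal integrand, $f_t:=f(t,\cdot)$. Let $\hat I_f:L^\infty(T,X)\to\overline{\mathbb{R}}$, $\hat I_f(x(\cdot)):=\int_T f(t,x(t))\,d\mu(t)$. If $\hat I_f$ is bounded above on some neighborhood, with respect to $(L^\infty(T,X),\|\cdot\|_\infty)$, of some constant function $x_0(\cdot)\equiv x_0\in X$, then for all $x\in X$ and $\varepsilon\ge0$ $$\partial_\varepsilon I_f(x)=\bigcup_{\substack{\varepsilon=\varepsilon_1+\varepsilon_2\\ \varepsilon_1,\varepsilon_2\ge0\\ \ell\in\mathcal{I}(\varepsilon_1)}}\left(\left\{\int_T x^*\,d\mu:\ x^*\in L^1_{w^*}(T,X^* ),\ x^*(t)\in\partial_{\ell(t)}f_t(x)\text{ a.e.}\right\}+N^{\varepsilon_2}_{\operatorname{dom}I_f}(x)\right).$$ If, in addition, $X$ is reflexive, then $$\partial_\varepsilon I_f(x)=\bigcup_{\substack{\varepsilon=\varepsilon_1+\varepsilon_2\\ \varepsilon_1,\varepsilon_2\ge0\\ \ell\in\mathcal{I}(\varepsilon_1)}}\left(\int_T\partial_{\ell(t)}f_t(x)\,d\mu(t)+N^{\varepsilon_2}_{\operatorname{dom}I_f}(x)\right).$$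
   Context: $X^*$ is the topological dual of $X$. Conventions: $0\cdot(\pm\infty)=0$, $\infty+(-\infty)=(-\infty)+\infty=\infty$. Upper integral: for $h:T\to\overline{\mathbb{R}}$, $\int_T h\,d\mu:=\inf\{\int_T g\,d\mu: g\in L^1(T,\mathbb{R}),\ h\le g\ \mu\text{-a.e.}\}$, equal to $+\infty$ if there is no such $g$. The integral function is $I_f(x):=\int_T f(t,x)\,d\mu(t)$, $x\in X$, and $\operatorname{dom}I_f=\{x:I_f(x)<+\infty\}$. $f$ is a convex normal integrand if it is $\Sigma\otimes\mathcal{B}(X)$-measurable and $f(t,\cdot)$ is lower semicontinuous, convex and proper for a.e. $t$. $L^\infty(T,X)$ is the space of (classes of) strongly measurable essentially bounded functions $T\to X$, with the essential supremum norm. For $h:X\to\overline{\mathbb{R}}$ and $\varepsilon\ge0$: if $h(x)\in\mathbb{R}$, $\partial_\varepsilon h(x):=\{x^*\in X^*:\langle x^*,y-x\rangle\le h(y)-h(x)+\varepsilon\ \forall y\in X\}$; if $h(x)\notin\mathbb{R}$, $\partial_\varepsilon h(x):=\emptyset$. For $A\subset X$, $N_A^\varepsilon(x):=\partial_\varepsilon\delta_A(x)$, where $\delta_A$ is the indicator function ($0$ on $A$, $+\infty$ off $A$). For $\eta\ge0$, $\mathcal{I}(\eta):=\{\ell\in L^1(T,\mathbb{R}_+):\int_T\ell\,d\mu\le\eta\}$. $L^1_{w^*}(T,X^* )$ is the space of functions $m:T\to X^*$ such that $t\mapsto\langle m(t),x\rangle$ is integrable for every $x\in X$ and $\int_T\sup_{b\in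 B}\langle m(t),b\rangle\,d\mu(t)<\infty$ for every bounded balanced $B\subset X$; its integral $\int_T m\,d\mu\in X^*$ is the Gelfand integral $x\mapsto\int_T\langle m(t),x\rangle\,d\mu(t)$. For a multifunction $G:T\rightrightarrows X^*$, $\int_TG(t)\,d\mu(t)$ is the set of all Bochner integrals $\int_T m\,d\mu$ of Bochner integrable (strongly measurable) $m:T\to X^*$ with $m(t)\in G(t)$ a.e.
   Formalization: Both formulas are stated only for x with I_f(x) ≠ −∞; otherwise they can fail: for f ≡ −1 on T = ℝ with Lebesgue measure and X = ℝ, I_f ≡ −∞, so the left side is empty while the right side contains 0. *)

theory Defs
  imports "HOL-Probability.Essential_Supremum"
begin

type_synonym 'a dual = "'a \<Rightarrow>\<^sub>L real"

text \<open>
  Extended-real arithmetic is that of \<^typ>\<open>ereal\<close>, where \<open>0 * \<plusminus>\<infinity> = 0\<close> and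
  \<open>\<infinity> + (-\<infinity>) = (-\<infinity>) + \<infinity> = \<infinity>\<close>.
\<close>

section \<open>Extended-real-valued functions\<close>

definition convex_fun :: "('a::real_vector \<Rightarrow> ereal) \<Rightarrow> bool" where
  "convex_fun h \<longleftrightarrow>
     (\<forall>x y. \<forall>u\<ge>0. \<forall>v\<ge>0. u + v = 1 \<longrightarrow>
        h (u *\<^sub>R x + v *\<^sub>R y) \<le> ereal u * h x + ereal v * h y)"

definition lsc_fun :: "('a::topological_space \<Rightarrow> ereal) \<Rightarrow> bool" where
  "lsc_fun h \<longleftrightarrow> (\<forall>x. h x \<le> Liminf (at x) h)"

definition proper_fun :: "('a \<Rightarrow> ereal) \<Rightarrow> bool" where
  "proper_fun h \<longleftrightarrow> (\<forall>x. h x \<noteq> -\<infinity>) \<and> (\<exists>x. h x \<noteq> \<infinity>)"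

definition eff_dom :: "('a \<Rightarrow> ereal) \<Rightarrow> 'a set" where
  "eff_dom h = {x. h x < \<infinity>}"

definition indicator_fun :: "'a set \<Rightarrow> 'a \<Rightarrow> ereal" where
  "indicator_fun A x = (if x \<in> A then 0 else \<infinity>)"

definition eps_subdiff :: "real \<Rightarrow> ('a::real_normed_vector \<Rightarrow> ereal) \<Rightarrow> 'a \<Rightarrow> 'a dual set" where
  "eps_subdiff \<epsilon> h x =
     (if \<bar>h x\<bar> \<noteq> \<infinity>
      then {\<xi>. \<forall>y. ereal (blinfun_apply \<xi> (y - x)) \<le> h y - h x + ereal \<epsilon>}
      else {})"

definition eps_normal :: "real \<Rightarrow> 'a::real_normed_vector set \<Rightarrow> 'a \<Rightarrow> 'a dual set" where
  "eps_normal \<epsilon> A x = eps_subdiff \<epsilon> (indicator_fun A) x"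

section \<open>Integrands and integral functionals\<close>

definition convex_normal_integrand ::
    "'t measure \<Rightarrow> ('t \<Rightarrow> 'a::real_normed_vector \<Rightarrow> ereal) \<Rightarrow> bool" where
  "convex_normal_integrand M f \<longleftrightarrow>
     (\<lambda>(t, x). f t x) \<in> borel_measurable (M \<Otimes>\<^sub>M borel) \<and>
     (AE t in M. lsc_fun (f t) \<and> convex_fun (f t) \<and> proper_fun (f t))"

definition upper_integral :: "'t measure \<Rightarrow> ('t \<Rightarrow> ereal) \<Rightarrow> ereal" where
  "upper_integral M h =
     (INF g \<in> {g. integrable M g \<and> (AE t in M. h t \<le> ereal (g t))}. ereal (\<integral>t. g t \<partial>M))"

text \<open>
  Pitfall: even for a convex normal integrand this function can take the value \<open>-\<infinity>\<close>, for
  instance if \<open>f\<close> is constantly \<open>-1\<close> over an infinite measure. At such a point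
  its \<open>\<epsilon>\<close>-subdifferential is empty, whereas the subdifferentials of \<open>f t\<close> may still have
  integrable selections.
\<close>

definition integral_fun :: "'t measure \<Rightarrow> ('t \<Rightarrow> 'a \<Rightarrow> ereal) \<Rightarrow> 'a \<Rightarrow> ereal" where
  "integral_fun M f x = upper_integral M (\<lambda>t. f t x)"

definition integral_functional :: "'t measure \<Rightarrow> ('t \<Rightarrow> 'a \<Rightarrow> ereal) \<Rightarrow> ('t \<Rightarrow> 'a) \<Rightarrow> ereal" where
  "integral_functional M f u = upper_integral M (\<lambda>t. f t (u t))"

section \<open>Spaces of vector-valued functions\<close>

text \<open>
  Function spaces are represented by sets of functions rather than of a.e.-classes; all the
  notions below are invariant under a.e. equality over a complete measure.
\<close>

definition strongly_measurable :: "'t measure \<Rightarrow> ('t \<Rightarrow> 'b::real_normed_vector) \<Rightarrow> bool" where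
  "strongly_measurable M u \<longleftrightarrow>
     (\<exists>s. (\<forall>i. simple_function M (s i)) \<and> (AE t in M. (\<lambda>i. s i t) \<longlonglongrightarrow> u t))"

text \<open>The outer \<open>max 0\<close> only matters for the zero measure, where \<^const>\<open>esssup\<close> is \<open>-\<infinity>\<close>.\<close>

definition Linf_norm :: "'t measure \<Rightarrow> ('t \<Rightarrow> 'b::real_normed_vector) \<Rightarrow> ereal" where
  "Linf_norm M u = max 0 (esssup M (\<lambda>t. ereal (norm (u t))))"

definition Linf :: "'t measure \<Rightarrow> ('t \<Rightarrow> 'b::real_normed_vector) set" where
  "Linf M = {u. strongly_measurable M u \<and> Linf_norm M u < \<infinity>}"

definition L1_budget :: "'t measure \<Rightarrow> real \<Rightarrow> ('t \<Rightarrow> real) set" where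
  "L1_budget M \<eta> =
     {l. integrable M l \<and> (\<forall>t\<in>space M. 0 \<le> l t) \<and> (\<integral>t. l t \<partial>M) \<le> \<eta>}"

definition balanced_set :: "'a::real_vector set \<Rightarrow> bool" where
  "balanced_set B \<longleftrightarrow> (\<forall>b\<in>B. \<forall>c. \<bar>c\<bar> \<le> 1 \<longrightarrow> c *\<^sub>R b \<in> B)"

definition L1_wstar :: "'t measure \<Rightarrow> ('t \<Rightarrow> 'a::real_normed_vector dual) set" where
  "L1_wstar M =
     {m. (\<forall>x. integrable M (\<lambda>t. blinfun_apply (m t) x)) \<and>
         (\<forall>B. bounded B \<and> balanced_set B \<longrightarrow>
            upper_integral M (\<lambda>t. SUP b\<in>B. ereal (blinfun_apply (m t) b)) < \<infinity>)}"

definition gelfand_integral :: "'t measure \<Rightarrow> ('t \<Rightarrow> 'a::real_normed_vector dual) \<Rightarrow> 'a dual" where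
  "gelfand_integral M m = Blinfun (\<lambda>x. \<integral>t. blinfun_apply (m t) x \<partial>M)"

text \<open>
  \<^const>\<open>has_bochner_integral\<close> is confined to second-countable target types, whereas a dual
  space need not be separable. The following drops that restriction, with strong measurability
  in place of Borel measurability.
\<close>

definition has_strong_bochner_integral ::
    "'t measure \<Rightarrow> ('t \<Rightarrow> 'b::real_normed_vector) \<Rightarrow> 'b \<Rightarrow> bool" where
  "has_strong_bochner_integral M m \<xi> \<longleftrightarrow>
     strongly_measurable M m \<and>
     (\<exists>s. (\<forall>i. Bochner_Integration.simple_bochner_integrable M (s i)) \<and>
          (\<lambda>i. \<integral>\<^sup>+ t. ennreal (norm (m t - s i t)) \<partial>M) \<longlonglongrightarrow> 0 \<and>
          (\<lambda>i. Bochner_Integration.simple_bochner_integral M (s i)) \<longlonglongrightarrow> \<xi>)"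

definition set_bochner_integral ::
    "'t measure \<Rightarrow> ('t \<Rightarrow> 'b::real_normed_vector set) \<Rightarrow> 'b set" where
  "set_bochner_integral M G =
     {\<xi>. \<exists>m. has_strong_bochner_integral M m \<xi> \<and> (AE t in M. m t \<in> G t)}"

text \<open>Surjectivity of the canonical embedding into the bidual.\<close>

definition reflexive_space :: "'a::real_normed_vector itself \<Rightarrow> bool" where
  "reflexive_space _ \<longleftrightarrow>
     (\<forall>\<phi> :: 'a dual dual. \<exists>x :: 'a. \<forall>\<xi>. blinfun_apply \<phi> \<xi> = blinfun_apply \<xi> x)"

section \<open>Agreement with the library notions\<close>

lemma strongly_measurable_iff_borel:
  fixes u :: "'t \<Rightarrow> 'b::{real_normed_vector, second_countable_topology}"
  assumes "complete_measure M"
  shows "strongly_measurable M u \<longleftrightarrow> u \<in> borel_measurable M"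
proof
  assume "u \<in> borel_measurable M"
  from borel_measurable_implies_sequence_metric[OF this, of 0]
  show "strongly_measurable M u"
    unfolding strongly_measurable_def by (blast intro: AE_I2)
next
  interpret complete_measure M by fact
  assume "strongly_measurable M u"
  then obtain s where s: "\<And>i. simple_function M (s i)"
    and ae: "AE t in M. (\<lambda>i. s i t) \<longlonglongrightarrow> u t"
    unfolding strongly_measurable_def by blast
  from ae obtain N where N: "N \<in> null_sets M"
    and conv: "\<And>t. t \<in> space M - N \<Longrightarrow> (\<lambda>i. s i t) \<longlonglongrightarrow> u t"
    by (auto elim!: AE_E3)
  have Ns[measurable]: "N \<in> sets M" using N by auto
  have [measurable]: "\<And>i. s i \<in> borel_measurable M"
    using s by (rule borel_measurable_simple_function)
  define v where "v = (\<lambda>t. if t \<in> N then 0 else u t)"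
  have v: "v \<in> borel_measurable M"
  proof (rule borel_measurable_LIMSEQ_metric)
    show "(\<lambda>t. if t \<in> N then 0 else s i t) \<in> borel_measurable M" for i
      by measurable
    show "(\<lambda>i. if t \<in> N then 0 else s i t) \<longlonglongrightarrow> v t" if "t \<in> space M" for t
      using conv that by (auto simp: v_def)
  qed
  show "u \<in> borel_measurable M"
  proof (rule measurableI)
    fix A :: "'b set" assume A: "A \<in> sets borel"
    have "u -` A \<inter> space M = ((v -` A \<inter> space M) - N) \<union> (u -` A \<inter> space M \<inter> N)"
      by (auto simp: v_def)
    moreover have "(v -` A \<inter> space M) - N \<in> sets M"
      using measurable_sets[OF v A] Ns by auto
    moreover have "u -` A \<inter> space M \<inter> N \<in> sets M"
      by (rule complete[OF _ N]) auto
    ultimately show "u -` A \<inter> space M \<in> sets M" by (metis sets.Un)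
  qed simp
qed

lemma has_strong_bochner_integral_iff:
  fixes m :: "'t \<Rightarrow> 'b::{real_normed_vector, second_countable_topology}"
  assumes "complete_measure M"
  shows "has_strong_bochner_integral M m \<xi> \<longleftrightarrow> has_bochner_integral M m \<xi>"
  unfolding has_strong_bochner_integral_def has_bochner_integral.simps
    strongly_measurable_iff_borel[OF assms]
  by auto

lemma gelfand_integral_apply:
  fixes m :: "'t \<Rightarrow> 'a::real_normed_vector dual"
  assumes "m \<in> L1_wstar M"
  shows "blinfun_apply (gelfand_integral M m) x = (\<integral>t. blinfun_apply (m t) x \<partial>M)"
proof -
  have int: "integrable M (\<lambda>t. blinfun_apply (m t) y)" for y
    using assms by (auto simp: L1_wstar_def)
  have "bounded (cball 0 1 :: 'a set)" "balanced_set (cball 0 1 :: 'a set)"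
    by (auto simp: balanced_set_def intro!: mult_le_one)
  then have "upper_integral M (\<lambda>t. SUP b\<in>cball 0 1. ereal (blinfun_apply (m t) b)) < \<infinity>"
    using assms unfolding L1_wstar_def by blast
  then obtain g where g: "integrable M g"
    and le: "AE t in M. (SUP b\<in>cball 0 1. ereal (blinfun_apply (m t) b)) \<le> ereal (g t)"
    unfolding upper_integral_def INF_less_iff by blast
  have "bounded_linear (\<lambda>y. \<integral>t. blinfun_apply (m t) y \<partial>M)"
  proof (rule bounded_linear_intro[where K = "\<integral>t. g t \<partial>M"])
    show "(\<integral>t. blinfun_apply (m t) (y + z) \<partial>M) =
        (\<integral>t. blinfun_apply (m t) y \<partial>M) + (\<integral>t. blinfun_apply (m t) z \<partial>M)" for y z
      using int by (simp add: blinfun.add_right)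
    show "(\<integral>t. blinfun_apply (m t) (r *\<^sub>R y) \<partial>M) = r *\<^sub>R (\<integral>t. blinfun_apply (m t) y \<partial>M)" for r y
      by (simp add: blinfun.scaleR_right)
    fix y :: 'a
    have "AE t in M. norm (blinfun_apply (m t) y) \<le> norm y * g t"
      using le
    proof eventually_elim
      case (elim t)
      have ball: "blinfun_apply (m t) b \<le> g t" if "norm b \<le> 1" for b
        using elim that by (auto simp: SUP_le_iff)
      show ?case
      proof (cases "y = 0")
        case False
        let ?b = "inverse (norm y) *\<^sub>R y"
        have "blinfun_apply (m t) ?b \<le> g t" "blinfun_apply (m t) (- ?b) \<le> g t"
          using False by (intro ball; simp)+
        then show ?thesis
          using False by (simp add: blinfun.scaleR_right blinfun.minus_right field_simps abs_le_iff)
      qed simp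
    qed
    then have "norm (\<integral>t. blinfun_apply (m t) y \<partial>M) \<le> (\<integral>t. norm y * g t \<partial>M)"
      using g int by (intro order_trans[OF integral_norm_bound integral_mono_AE]) auto
    then show "norm (\<integral>t. blinfun_apply (m t) y \<partial>M) \<le> norm y * (\<integral>t. g t \<partial>M)"
      by simp
  qed
  then show ?thesis
    by (simp add: gelfand_integral_def bounded_linear_Blinfun_apply)
qed

end

theory Submission
  imports Defs "HOL-Library.Function_Algebras"
begin

text \<open>
  Let \<open>\<xi> \<in> \<partial>\<^sub>\<epsilon> I\<^sub>f(x)\<close>. Boundedness near \<open>x0\<close> makes the majorant in Hahn-Banach finite, so
  \<open>\<xi>\<close> extends from the constants to a linear functional \<open>p\<close> on simple functions with
  \<open>p(v) \<le> \<integral> f(t, x + v(t)) - f(t, x) + \<epsilon>\<close>. Off a decreasing sequence of sets \<open>F j\<close> with null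
  intersection, \<open>p\<close> is given by a density \<open>m\<close>. Testing \<open>p\<close> with near-optimal simple functions
  off \<open>F j\<close> and constants on \<open>F j\<close>, and letting \<open>j \<rightarrow> \<infinity>\<close>, shows that
  \<open>l(t) = sup\<^sub>y \<langle>m(t), y\<rangle> - f(t, x + y) + f(t, x)\<close> satisfies
  \<open>\<integral> l + \<langle>\<xi> - \<integral> m, w\<rangle> \<le> \<epsilon>\<close> whenever \<open>I\<^sub>f(x + w) < \<infinity>\<close>. No measurable selection theorem
  is needed: \<open>f(t, \<cdot>)\<close> is finite on a ball around \<open>x0\<close>, so the supremum may be taken over a
  countable dense set.
\<close>

section \<open>Hahn-Banach\<close>

text \<open>The obstacle is that a functional on bounded functions need not have a density, so
  \<open>\<xi>\<close> need not be an integral of subgradients. The normal set of the domain absorbs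
  exactly what is missing. The difference between \<open>p\<close> and its density part vanishes on
  functions supported off \<open>F j\<close>. On \<open>F j\<close> only constants \<open>w\<close>
  with integrable \<open>f(t, x + w)\<close> are tested: the integral over \<open>F j\<close> tends
  to 0, while the singular value \<open>\<xi> w - \<integral> m w\<close> stays in the estimate. The
  budget splits accordingly: \<open>e = \<integral> l\<close> is spent by the density part, and
  \<open>\<epsilon> - e\<close> bounds the singular part on the domain. Splitting off the density is
  a Yosida-Hewitt decomposition made by hand: the variation of \<open>p\<close> is finitely
  additive, and its part that is not absolutely continuous is confined to sets of vanishing measure.
  Simple functions suffice as test functions because a supremum over a dense sequence is the limit
  of maxima over finitely many points, and maximisers among finitely many points take finitely many
  values. Hahn-Banach is then purely algebraic; the bound on \<open>p\<close> is recovered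
  afterwards from the ball around \<open>x0\<close>.\<close>

instantiation "fun" :: (type, real_vector) real_vector
begin

text \<open>With the pointwise addition of functions this makes the functions from \<open>T\<close>
  to \<open>X\<close> a vector space as a type, in which the simple functions form a subspace to
  which Hahn-Banach applies.\<close>

definition scaleR_fun :: "real \<Rightarrow> ('a \<Rightarrow> 'b) \<Rightarrow> 'a \<Rightarrow> 'b" where
  "scaleR_fun r f = (\<lambda>x. r *\<^sub>R f x)"

instance
  by standard (auto simp: scaleR_fun_def fun_eq_iff scaleR_add_right scaleR_add_left)

end

lemma scaleR_fun_apply [simp]: "(r *\<^sub>R f) x = r *\<^sub>R f x"
  by (simp add: scaleR_fun_def)

text \<open>A pair \<open>(v, b)\<close> records that the majorant at \<open>v\<close> is at most
  \<open>b\<close>. No infimum has to be formed, so an integral functional can enter through its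
  integrable majorants alone. The last clause keeps the majorant above \<open>-\<infinity>\<close>:
  a pair over \<open>- v\<close> bounds all pairs over \<open>v\<close> from below.\<close>

definition dominated_cone :: "('v::real_vector \<times> real) set \<Rightarrow> bool" where
  "dominated_cone A \<longleftrightarrow>
     (\<forall>p\<in>A. \<forall>q\<in>A. p + q \<in> A) \<and> (\<forall>p\<in>A. \<forall>a>0. a *\<^sub>R p \<in> A) \<and> (\<forall>b. (0, b) \<in> A \<longrightarrow> 0 \<le> b)"

lemma dominated_coneD:
  assumes "dominated_cone A"
  shows "\<And>u v b c. (u, b) \<in> A \<Longrightarrow> (v, c) \<in> A \<Longrightarrow> (u + v, b + c) \<in> A"
    and "\<And>u b a. (u, b) \<in> A \<Longrightarrow> 0 < a \<Longrightarrow> (a *\<^sub>R u, a * b) \<in> A"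
    and "\<And>b. (0, b) \<in> A \<Longrightarrow> 0 \<le> b"
proof -
  show "(u + v, b + c) \<in> A" if "(u, b) \<in> A" "(v, c) \<in> A" for u v b c
    using assms that unfolding dominated_cone_def by (metis add_Pair)
  show "(a *\<^sub>R u, a * b) \<in> A" if "(u, b) \<in> A" "0 < a" for u b a
    using assms that unfolding dominated_cone_def by (metis real_scaleR_def scaleR_Pair)
  show "0 \<le> b" if "(0, b) \<in> A" for b
    using assms that unfolding dominated_cone_def by blast
qed

text \<open>The cones are epigraphs of sublinear functionals, so a maximal cone is the epigraph of a
  minimal sublinear functional, which is linear.\<close>

lemma dominated_cone_linear:
  fixes A0 :: "('v::real_vector \<times> real) set"
  assumes V: "subspace V" and dom: "fst ` A0 = V" and A0: "dominated_cone A0"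
  obtains L where "\<And>u v. u \<in> V \<Longrightarrow> v \<in> V \<Longrightarrow> L (u + v) = L u + L v"
    and "\<And>a v. v \<in> V \<Longrightarrow> L (a *\<^sub>R v) = a * L v"
    and "\<And>v b. (v, b) \<in> A0 \<Longrightarrow> L v \<le> (b::real)"
proof -
  define \<C> where "\<C> = {A. dominated_cone A \<and> A0 \<subseteq> A \<and> fst ` A = V}"
  have "\<exists>A\<in>\<C>. \<forall>B\<in>\<C>. A \<subseteq> B \<longrightarrow> B = A"
  proof (rule subset_Zorn_nonempty)
    show "\<C> \<noteq> {}" using assms by (auto simp: \<C>_def)
    fix \<D> assume ne: "\<D> \<noteq> {}" and ch: "subset.chain \<C> \<D>"
    have sub: "A \<in> \<C>" if "A \<in> \<D>" for A
      using ch that by (auto simp: subset.chain_def)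
    have "dominated_cone (\<Union>\<D>)"
      unfolding dominated_cone_def
    proof (intro conjI ballI allI impI)
      fix p q assume "p \<in> \<Union>\<D>" "q \<in> \<Union>\<D>"
      then obtain A B where "p \<in> A" "A \<in> \<D>" "q \<in> B" "B \<in> \<D>" by auto
      moreover have "A \<subseteq> B \<or> B \<subseteq> A"
        using ch calculation by (auto simp: subset.chain_def)
      ultimately obtain C where "p \<in> C" "q \<in> C" "C \<in> \<D>" by blast
      then show "p + q \<in> \<Union>\<D>"
        using sub[of C] by (auto simp: \<C>_def dominated_cone_def)
    next
      fix p and a :: real assume "p \<in> \<Union>\<D>" "0 < a"
      then show "a *\<^sub>R p \<in> \<Union>\<D>"
        using sub by (fastforce simp: \<C>_def dominated_cone_def)
    next
      fix b assume "(0, b) \<in> \<Union>\<D>"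
      then show "0 \<le> b" using sub by (fastforce simp: \<C>_def dominated_cone_def)
    qed
    moreover have "A0 \<subseteq> \<Union>\<D>" using ne sub by (auto simp: \<C>_def)
    moreover have "fst ` \<Union>\<D> = V"
    proof
      show "fst ` \<Union>\<D> \<subseteq> V"
      proof
        fix v assume "v \<in> fst ` \<Union>\<D>"
        then obtain A where "A \<in> \<D>" "v \<in> fst ` A" by blast
        then show "v \<in> V" using sub[of A] by (simp add: \<C>_def)
      qed
      show "V \<subseteq> fst ` \<Union>\<D>" using dom \<open>A0 \<subseteq> \<Union>\<D>\<close> by blast
    qed
    ultimately show "\<Union>\<D> \<in> \<C>" by (simp add: \<C>_def)
  qed
  then obtain A where A: "A \<in> \<C>" and max: "\<And>B. B \<in> \<C> \<Longrightarrow> A \<subseteq> B \<Longrightarrow> B = A" by blast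
  have cone: "dominated_cone A" and A0A: "A0 \<subseteq> A" and domA: "fst ` A = V"
    using A by (auto simp: \<C>_def)
  note add = dominated_coneD(1)[OF cone] and scale = dominated_coneD(2)[OF cone]
    and pos = dominated_coneD(3)[OF cone]
  define L where "L = (\<lambda>v. Inf {b. (v, b) \<in> A})"
  have ex: "\<exists>b. (v, b) \<in> A" if "v \<in> V" for v
  proof -
    have "v \<in> fst ` A" using that domA by simp
    then show ?thesis by force
  qed
  have inV: "v \<in> V" if "(v, b) \<in> A" for v b
  proof -
    have "fst (v, b) \<in> fst ` A" using that by (rule imageI)
    then show ?thesis using domA by simp
  qed
  have neg: "- v \<in> V" if "v \<in> V" for v using subspace_neg[OF V that] .
  have bdd: "bdd_below {b. (v, b) \<in> A}" for v
  proof (cases "v \<in> V")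
    case True
    then obtain b' where "(- v, b') \<in> A" using ex neg by blast
    then have "- b' \<le> b" if "(v, b) \<in> A" for b
      using add[OF that, of "- v" b'] pos by fastforce
    then show ?thesis by (auto intro!: bdd_belowI)
  next
    case False
    then have "{b. (v, b) \<in> A} = {}" using inV by auto
    then show ?thesis by (metis bdd_below_empty)
  qed
  have L_le: "L v \<le> b" if "(v, b) \<in> A" for v b
    unfolding L_def using that bdd by (intro cInf_lower) auto
  have L_ge: "c \<le> L v" if "v \<in> V" "\<And>b. (v, b) \<in> A \<Longrightarrow> c \<le> b" for v c
    unfolding L_def using that ex by (intro cInf_greatest) auto
  have sub: "L (u + v) \<le> L u + L v" if uv: "u \<in> V" "v \<in> V" for u v
  proof -
    have "L (u + v) - L v \<le> L u"
    proof (rule L_ge[OF uv(1)])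
      fix b assume b: "(u, b) \<in> A"
      have "L (u + v) - b \<le> L v"
        using L_le[OF add[OF b]] by (intro L_ge[OF uv(2)]) (metis add.commute diff_le_eq)
      then show "L (u + v) - L v \<le> b" by simp
    qed
    then show ?thesis by simp
  qed
  have Lneg: "L (- v) = - L v" if v: "v \<in> V" for v
  proof (rule antisym)
    \<comment> \<open>\<open>B\<close> adds to \<open>A\<close> the ray through
      \<open>(- v, - L v)\<close>. Since \<open>L v\<close> is a lower bound of the values over
      \<open>v\<close>, nothing negative appears over \<open>0\<close>, so \<open>B\<close> competes
      with the maximal cone \<open>A\<close> and must equal it.\<close>
    define B where "B = {(u - s *\<^sub>R v, b - s * L v) | u b s. (u, b) \<in> A \<and> 0 \<le> s}"
    have "A \<subseteq> B" by (force simp: B_def intro: exI[of _ "0::real"])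
    moreover have "B \<in> \<C>"
      unfolding \<C>_def mem_Collect_eq
    proof (intro conjI)
      show "A0 \<subseteq> B" using A0A \<open>A \<subseteq> B\<close> by blast
      show "fst ` B = V"
      proof
        show "fst ` B \<subseteq> V"
          using inV v by (auto simp: B_def intro!: subspace_diff[OF V] subspace_scale[OF V])
        show "V \<subseteq> fst ` B" using domA \<open>A \<subseteq> B\<close> by blast
      qed
      show "dominated_cone B"
        unfolding dominated_cone_def
      proof (intro conjI ballI allI impI)
        fix p q assume "p \<in> B" "q \<in> B"
        then obtain u b s u' b' s' where
          "(u, b) \<in> A" "0 \<le> s" "p = (u - s *\<^sub>R v, b - s * L v)"
          "(u', b') \<in> A" "0 \<le> s'" "q = (u' - s' *\<^sub>R v, b' - s' * L v)"
          unfolding B_def by blast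
        then show "p + q \<in> B"
          unfolding B_def mem_Collect_eq
          by (intro exI[of _ "u + u'"] exI[of _ "b + b'"] exI[of _ "s + s'"])
            (auto intro: add simp: algebra_simps)
      next
        fix p and a :: real assume "p \<in> B" "0 < a"
        then obtain u b s where "(u, b) \<in> A" "0 \<le> s" "p = (u - s *\<^sub>R v, b - s * L v)"
          unfolding B_def by blast
        then show "a *\<^sub>R p \<in> B"
          unfolding B_def mem_Collect_eq using \<open>0 < a\<close>
          by (intro exI[of _ "a *\<^sub>R u"] exI[of _ "a * b"] exI[of _ "a * s"])
            (auto intro: scale simp: algebra_simps)
      next
        fix b' assume "(0, b') \<in> B"
        then obtain u b s where u: "(u, b) \<in> A" "0 \<le> s" "u = s *\<^sub>R v" "b' = b - s * L v"
          unfolding B_def by auto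
        show "0 \<le> b'"
        proof (cases "s = 0")
          case True
          then show ?thesis using u pos by simp
        next
          case False
          then have "(v, inverse s * b) \<in> A"
            using scale[OF u(1), of "inverse s"] u by simp
          then have "L v \<le> inverse s * b" by (rule L_le)
          then show ?thesis using False u by (simp add: field_simps)
        qed
      qed
    qed
    ultimately have "B = A" using max by blast
    obtain b where b: "(v, b) \<in> A" using ex v by blast
    \<comment> \<open>\<open>A\<close> is closed under positive multiples only and need not contain
      \<open>(0, 0)\<close>. Hence \<open>(- v, - L v)\<close> is reached only up to a multiple
      \<open>s\<close> of \<open>(v, b)\<close>, which is then made small.\<close>
    have le: "L (- v) + L v \<le> s * (b - L v)" if "0 < s" for s
    proof -
      have "(s *\<^sub>R v - (s + 1) *\<^sub>R v, s * b - (s + 1) * L v) \<in> B"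
        unfolding B_def using scale[OF b that] that by force
      moreover have "s *\<^sub>R v - (s + 1) *\<^sub>R v = - v" by (simp add: algebra_simps)
      ultimately have "L (- v) \<le> s * b - (s + 1) * L v"
        using L_le \<open>B = A\<close> by simp
      then show ?thesis by (simp add: algebra_simps)
    qed
    show "L (- v) \<le> - L v"
    proof (cases "b - L v = 0")
      case True
      then show ?thesis using le[of 1] by simp
    next
      case False
      then have "0 < b - L v" using L_le[OF b] by simp
      then have "L (- v) + L v \<le> e" if "0 < e" for e
        using le[of "e / (b - L v)"] that by simp
      then show ?thesis by (smt (verit) field_le_epsilon)
    qed
    show "- L v \<le> L (- v)"
    proof (rule L_ge[OF neg[OF v]])
      fix b' assume b': "(- v, b') \<in> A"
      have "- b' \<le> L v"
        using add[OF b'] pos by (intro L_ge[OF v]) fastforce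
      then show "- L v \<le> b'" by simp
    qed
  qed
  have Ladd: "L (u + v) = L u + L v" if uv: "u \<in> V" "v \<in> V" for u v
  proof (rule antisym[OF sub[OF uv]])
    have "L (u + v + - v) \<le> L (u + v) + L (- v)"
      using uv by (intro sub neg subspace_add[OF V])
    then show "L u + L v \<le> L (u + v)" using Lneg uv by simp
  qed
  have Lpos: "L (a *\<^sub>R v) \<le> a * L v" if v: "v \<in> V" and a: "0 < a" for a v
  proof -
    have "inverse a * L (a *\<^sub>R v) \<le> L v"
      using L_le[OF scale[OF _ a]] a by (intro L_ge[OF v]) (simp add: field_simps)
    then show ?thesis using a by (simp add: field_simps)
  qed
  have Lscale: "L (a *\<^sub>R v) = a * L v" if v: "v \<in> V" for a v
  proof -
    have pos': "L (a *\<^sub>R v) = a * L v" if "0 < a" for a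
    proof (rule antisym[OF Lpos[OF v that]])
      have "L (inverse a *\<^sub>R a *\<^sub>R v) \<le> inverse a * L (a *\<^sub>R v)"
        using that v by (intro Lpos subspace_scale[OF V]) auto
      then show "a * L v \<le> L (a *\<^sub>R v)" using that by (simp add: field_simps)
    qed
    consider "0 < a" | "a = 0" | "0 < - a" by linarith
    then show ?thesis
    proof cases
      case 2
      then show ?thesis using Ladd[of 0 0] subspace_0[OF V] by simp
    next
      case 3
      then show ?thesis using pos'[OF 3] Lneg[of "a *\<^sub>R v"] subspace_scale[OF V v] by simp
    qed (use pos' in auto)
  qed
  show ?thesis
    using that[of L] Ladd Lscale L_le A0A by blast
qed

text \<open>Hahn-Banach with the majorant \<open>inf {norm (v + y + a x) - a d}\<close> over
  \<open>y\<close> in \<open>Y\<close> and real \<open>a\<close>; it is non-negative at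
  \<open>0\<close> because \<open>x\<close> has distance at least \<open>d\<close> from
  \<open>Y\<close>. The choices \<open>a = 0\<close> and \<open>a = 1\<close> (at
  \<open>- x\<close>) yield the norm bound, the vanishing on \<open>Y\<close> and the value at
  \<open>x\<close>. The slack \<open>c\<close> in the cone absorbs the loss in the triangle
  inequality.\<close>

lemma norm_separation:
  fixes Y :: "'v::real_normed_vector set"
  assumes Y: "subspace Y" and d: "0 < d" "\<And>y. y \<in> Y \<Longrightarrow> d \<le> norm (x - y)"
  obtains \<phi> :: "'v \<Rightarrow>\<^sub>L real" where "norm \<phi> \<le> 1" "\<And>y. y \<in> Y \<Longrightarrow> \<phi> y = 0" "d \<le> \<phi> x"
proof -
  define A where "A = {(v, norm (v + y + a *\<^sub>R x) - a * d + c) | v y a c. y \<in> Y \<and> 0 \<le> c}"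
  have neg: "- y \<in> Y" if "y \<in> Y" for y using subspace_neg[OF Y that] .
  have "dominated_cone A"
    unfolding dominated_cone_def
  proof (intro conjI ballI allI impI)
    fix p q assume "p \<in> A" "q \<in> A"
    then obtain v y a c v' y' a' c' where *: "y \<in> Y" "0 \<le> c" "p = (v, norm (v + y + a *\<^sub>R x) - a * d + c)"
      "y' \<in> Y" "0 \<le> c'" "q = (v', norm (v' + y' + a' *\<^sub>R x) - a' * d + c')"
      unfolding A_def by blast
    have "norm ((v + v') + (y + y') + (a + a') *\<^sub>R x) \<le> norm (v + y + a *\<^sub>R x) + norm (v' + y' + a' *\<^sub>R x)"
      using norm_triangle_ineq[of "v + y + a *\<^sub>R x" "v' + y' + a' *\<^sub>R x"] by (simp add: algebra_simps)
    then show "p + q \<in> A"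
      unfolding A_def mem_Collect_eq
      by (intro exI[of _ "v + v'"] exI[of _ "y + y'"] exI[of _ "a + a'"]
          exI[of _ "norm (v + y + a *\<^sub>R x) + norm (v' + y' + a' *\<^sub>R x)
             - norm ((v + v') + (y + y') + (a + a') *\<^sub>R x) + c + c'"])
        (use * in \<open>auto intro: subspace_add[OF Y] simp: algebra_simps\<close>)
  next
    fix p and s :: real assume "p \<in> A" "0 < s"
    then obtain v y a c where *: "y \<in> Y" "0 \<le> c" "p = (v, norm (v + y + a *\<^sub>R x) - a * d + c)"
      unfolding A_def by blast
    have "s * norm (v + y + a *\<^sub>R x) = norm (s *\<^sub>R v + s *\<^sub>R y + (s * a) *\<^sub>R x)"
      using \<open>0 < s\<close> norm_scaleR[of s "v + y + a *\<^sub>R x"] by (simp add: algebra_simps)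
    then show "s *\<^sub>R p \<in> A"
      unfolding A_def mem_Collect_eq
      by (intro exI[of _ "s *\<^sub>R v"] exI[of _ "s *\<^sub>R y"] exI[of _ "s * a"] exI[of _ "s * c"])
        (use * \<open>0 < s\<close> in \<open>auto intro: subspace_scale[OF Y] simp: algebra_simps\<close>)
  next
    fix b assume "(0, b) \<in> A"
    then obtain y a c where *: "y \<in> Y" "0 \<le> c" "b = norm (y + a *\<^sub>R x) - a * d + c"
      unfolding A_def by auto
    have "a * d \<le> norm (y + a *\<^sub>R x)"
    proof (cases "a \<le> 0")
      case True
      then have "a * d \<le> 0" using d by (simp add: mult_nonpos_nonneg)
      then show ?thesis using norm_ge_zero[of "y + a *\<^sub>R x"] by linarith
    next
      case False
      then have "d \<le> norm (x - (- inverse a) *\<^sub>R y)"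
        using * by (intro d(2) subspace_scale[OF Y])
      then have "a * d \<le> norm (a *\<^sub>R (x - (- inverse a) *\<^sub>R y))"
        using False by simp
      also have "a *\<^sub>R (x - (- inverse a) *\<^sub>R y) = y + a *\<^sub>R x"
        using False by (simp add: algebra_simps)
      finally show ?thesis .
    qed
    then show "0 \<le> b" using * by simp
  qed
  moreover have "fst ` A = UNIV"
    using subspace_0[OF Y] by (fastforce simp: A_def image_iff)
  ultimately obtain L where add: "\<And>u v. L (u + v) = L u + L v" and scale: "\<And>a v. L (a *\<^sub>R v) = a * L v"
    and le: "\<And>v b. (v, b) \<in> A \<Longrightarrow> L v \<le> b"
    using dominated_cone_linear[of UNIV A] by (metis UNIV_I subspace_UNIV)
  have mem: "(v, norm (v + y + a *\<^sub>R x) - a * d) \<in> A" if "y \<in> Y" for v y a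
    using that unfolding A_def mem_Collect_eq by (intro exI[of _ v] exI[of _ y] exI[of _ a] exI[of _ 0]) auto
  have Lneg: "L (- v) = - L v" for v using scale[of "-1" v] by simp
  have le1: "L v \<le> norm v" for v using le[OF mem[OF subspace_0[OF Y], of v 0]] by simp
  have abs: "\<bar>L v\<bar> \<le> norm v" for v using le1[of v] le1[of "- v"] Lneg[of v] by simp
  have bl: "bounded_linear L"
    by (rule bounded_linear_intro[of _ 1]) (use add scale abs in auto)
  show ?thesis
  proof (rule that[of "Blinfun L"])
    show "norm (Blinfun L) \<le> 1"
      using abs by (intro norm_blinfun_bound) (auto simp: bounded_linear_Blinfun_apply[OF bl])
    show "Blinfun L y = 0" if "y \<in> Y" for y
      using le[OF mem[OF neg[OF that], of y 0]] le[OF mem[OF that, of "- y" 0]] Lneg[of y]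
      by (simp add: bounded_linear_Blinfun_apply[OF bl])
    show "d \<le> Blinfun L x"
      using le[OF mem[OF subspace_0[OF Y], of "- x" 1]] Lneg[of x]
      by (simp add: bounded_linear_Blinfun_apply[OF bl])
  qed
qed

section \<open>Countable dense rational subspaces\<close>

text \<open>With rational coefficients and countably many vectors, all linear relations can hold
  simultaneously off a single null set. Real coefficients would not allow this.\<close>

definition rational_subspace :: "'a::real_vector set \<Rightarrow> bool" where
  "rational_subspace D \<longleftrightarrow>
     0 \<in> D \<and> (\<forall>(q::rat). \<forall>y\<in>D. \<forall>z\<in>D. (of_rat q :: real) *\<^sub>R y + z \<in> D)"

lemma rational_subspaceD:
  assumes "rational_subspace D"
  shows "0 \<in> D" and "y \<in> D \<Longrightarrow> z \<in> D \<Longrightarrow> (of_rat q :: real) *\<^sub>R y + z \<in> D"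
    and "y \<in> D \<Longrightarrow> z \<in> D \<Longrightarrow> y + z \<in> D" and "y \<in> D \<Longrightarrow> (of_rat q :: real) *\<^sub>R y \<in> D"
    and "y \<in> D \<Longrightarrow> z \<in> D \<Longrightarrow> y - z \<in> D"
proof -
  show 0: "0 \<in> D" using assms by (simp add: rational_subspace_def)
  show c: "(of_rat q :: real) *\<^sub>R y + z \<in> D" if "y \<in> D" "z \<in> D" for q y z
    using assms that by (simp add: rational_subspace_def)
  show "y + z \<in> D" if "y \<in> D" "z \<in> D" using c[OF that, of 1] by simp
  show "(of_rat q :: real) *\<^sub>R y \<in> D" if "y \<in> D" using c[OF that 0] by simp
  show "y - z \<in> D" if "y \<in> D" "z \<in> D" using c[OF that(2,1), of "-1"] by (simp add: of_rat_minus)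
qed

text \<open>Finite rational combinations are indexed by lists of coefficient-index pairs, a
  countable type in which addition becomes concatenation.\<close>

lemma ex_countable_rational_subspace:
  fixes e :: "nat \<Rightarrow> 'a::real_vector"
  obtains D where "countable D" "rational_subspace D" "range e \<subseteq> D"
proof -
  define S where "S = (\<lambda>xs. \<Sum>(q, i)\<leftarrow>xs. (of_rat q :: real) *\<^sub>R e i)"
  have scale: "S (map (\<lambda>(r, i). (q * r, i)) xs) = (of_rat q :: real) *\<^sub>R S xs" for q xs
    by (induction xs) (auto simp: S_def of_rat_mult scaleR_add_right)
  have app: "S (xs @ ys) = S xs + S ys" for xs ys by (simp add: S_def)
  have "S [] = 0" "S [(1, i)] = e i" for i by (simp_all add: S_def)
  then have "rational_subspace (range S)" "range e \<subseteq> range S"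
    unfolding rational_subspace_def by (auto simp flip: scale app) (metis rangeI)+
  then show ?thesis using that[of "range S"] by simp
qed

lemma ex_rational_seq: "\<exists>q :: nat \<Rightarrow> rat. (\<lambda>n. of_rat (q n)) \<longlonglongrightarrow> (c :: real)"
proof -
  have "\<exists>q. c - 1 / Suc n < of_rat q \<and> of_rat q < c + 1 / Suc n" for n
    by (rule of_rat_dense) (rule order.strict_trans[of _ c]; simp)
  then obtain q where q: "\<And>n. c - 1 / Suc n < of_rat (q n)" "\<And>n. of_rat (q n) < c + 1 / Suc n" by metis
  have inv: "(\<lambda>n. 1 / real (Suc n)) \<longlonglongrightarrow> 0" using LIMSEQ_inverse_real_of_nat by (simp add: inverse_eq_divide)
  have "(\<lambda>n. of_rat (q n)) \<longlonglongrightarrow> c"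
  proof (rule tendsto_sandwich)
    show "(\<lambda>n. c - 1 / Suc n) \<longlonglongrightarrow> c" "(\<lambda>n. c + 1 / Suc n) \<longlonglongrightarrow> c"
      using tendsto_diff[OF tendsto_const inv, of c] tendsto_add[OF tendsto_const inv, of c] by simp_all
  qed (use q in \<open>auto intro: always_eventually less_imp_le\<close>)
  then show ?thesis by blast
qed

lemma subspace_closure_rational_subspace:
  fixes D :: "'a::real_normed_vector set"
  assumes "rational_subspace D"
  shows "subspace (closure D)"
proof (rule subspaceI)
  note D = rational_subspaceD[OF assms]
  show "0 \<in> closure D" using D(1) closure_subset by blast
  fix x y :: 'a assume "x \<in> closure D"
  then obtain xs where xs: "\<And>n. xs n \<in> D" "xs \<longlonglongrightarrow> x" by (auto simp: closure_sequential)
  show "x + y \<in> closure D" if "y \<in> closure D"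
  proof -
    obtain ys where ys: "\<And>n. ys n \<in> D" "ys \<longlonglongrightarrow> y" using \<open>y \<in> closure D\<close> by (auto simp: closure_sequential)
    have "(\<lambda>n. xs n + ys n) \<longlonglongrightarrow> x + y" by (intro tendsto_intros xs ys)
    moreover have "xs n + ys n \<in> D" for n using xs ys D(3) by simp
    ultimately show ?thesis unfolding closure_sequential by (intro exI conjI) auto
  qed
  fix c :: real
  obtain q :: "nat \<Rightarrow> rat" where "(\<lambda>n. of_rat (q n)) \<longlonglongrightarrow> c" using ex_rational_seq by blast
  then have "(\<lambda>n. (of_rat (q n) :: real) *\<^sub>R xs n) \<longlonglongrightarrow> c *\<^sub>R x" by (intro tendsto_intros xs)
  moreover have "(of_rat (q n) :: real) *\<^sub>R xs n \<in> D" for n using xs D(4) by simp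
  ultimately show "c *\<^sub>R x \<in> closure D" unfolding closure_sequential by (intro exI conjI) auto
qed

text \<open>The bound makes \<open>\<phi>\<close> Lipschitz on \<open>D\<close>, so it extends
  continuously to the closure; additivity, real homogeneity and the bound pass to limits along
  sequences in \<open>D\<close> and in the rationals. Applied for each \<open>t\<close> separately
  to obtain the density \<open>m t\<close>.\<close>

lemma rational_linear_extension:
  fixes D :: "'a::real_normed_vector set" and \<phi> :: "'a \<Rightarrow> real"
  assumes D: "rational_subspace D" "closure D = UNIV"
    and lin: "\<And>(q::rat) y z. y \<in> D \<Longrightarrow> z \<in> D \<Longrightarrow> \<phi> (of_rat q *\<^sub>R y + z) = of_rat q * \<phi> y + \<phi> z"
    and bound: "\<And>y. y \<in> D \<Longrightarrow> \<bar>\<phi> y\<bar> \<le> K * norm y" and K: "0 \<le> K"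
  obtains m :: "'a \<Rightarrow>\<^sub>L real" where "\<And>y. y \<in> D \<Longrightarrow> m y = \<phi> y" "norm m \<le> K"
proof -
  note Dc = rational_subspaceD[OF D(1)]
  have diff: "\<phi> (x - y) = \<phi> x - \<phi> y" if "x \<in> D" "y \<in> D" for x y
    using lin[OF that(2,1), of "-1"] by (simp add: of_rat_minus)
  have "uniformly_continuous_on D \<phi>"
  proof (rule lipschitz_on_uniformly_continuous[of K], rule lipschitz_onI)
    show "dist (\<phi> x) (\<phi> y) \<le> K * dist x y" if "x \<in> D" "y \<in> D" for x y
      using bound[OF Dc(5)[OF that]] diff[OF that] by (simp add: dist_norm)
  qed (rule K)
  then obtain g where "uniformly_continuous_on (closure D) g" and g: "\<And>x. x \<in> D \<Longrightarrow> \<phi> x = g x"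
    using uniformly_continuous_on_extension_on_closure by metis
  then have "continuous_on UNIV g" using D uniformly_continuous_imp_continuous by fastforce
  then have lim: "(\<lambda>n. g (xs n)) \<longlonglongrightarrow> g x" if "xs \<longlonglongrightarrow> x" for xs x
    using that by (auto simp: continuous_on_sequentially o_def)
  have seq: "\<exists>xs. (\<forall>n. xs n \<in> D) \<and> xs \<longlonglongrightarrow> x" for x
    using D(2) by (metis UNIV_I closure_sequential)
  have add: "g (x + y) = g x + g y" for x y
  proof -
    obtain xs ys where xs: "\<And>n. xs n \<in> D" "xs \<longlonglongrightarrow> x" and ys: "\<And>n. ys n \<in> D" "ys \<longlonglongrightarrow> y"
      using seq by metis
    have "g (xs n + ys n) = g (xs n) + g (ys n)" for n
      using lin[OF xs(1) ys(1), of 1] g xs ys Dc(3) by auto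
    then show ?thesis
      using LIMSEQ_unique[OF lim[OF tendsto_add[OF xs(2) ys(2)]]] tendsto_add[OF lim[OF xs(2)] lim[OF ys(2)]]
      by simp
  qed
  have scale: "g (c *\<^sub>R x) = c * g x" for c x
  proof -
    obtain xs where xs: "\<And>n. xs n \<in> D" "xs \<longlonglongrightarrow> x" using seq by metis
    obtain q :: "nat \<Rightarrow> rat" where q: "(\<lambda>n. of_rat (q n)) \<longlonglongrightarrow> c" using ex_rational_seq by blast
    have "\<phi> 0 = 0" using lin[OF Dc(1,1), of 1] by simp
    then have "g (of_rat (q n) *\<^sub>R xs n) = of_rat (q n) * g (xs n)" for n
      using lin[OF xs(1) Dc(1), of "q n" n] g xs Dc(1,4) by auto
    then show ?thesis
      using LIMSEQ_unique[OF lim[OF tendsto_scaleR[OF q xs(2)]]] tendsto_mult[OF q lim[OF xs(2)]]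
      by simp
  qed
  have abs: "\<bar>g x\<bar> \<le> K * norm x" for x
  proof -
    obtain xs where xs: "\<And>n. xs n \<in> D" "xs \<longlonglongrightarrow> x" using seq by metis
    have "(\<lambda>n. \<bar>g (xs n)\<bar>) \<longlonglongrightarrow> \<bar>g x\<bar>" "(\<lambda>n. K * norm (xs n)) \<longlonglongrightarrow> K * norm x"
      by (intro tendsto_intros lim xs)+
    then show ?thesis
      using bound[OF xs(1)] g[OF xs(1)] by (intro LIMSEQ_le) auto
  qed
  have bl: "bounded_linear g"
    by (rule bounded_linear_intro[of _ K]) (use add scale abs in \<open>auto simp: mult.commute\<close>)
  show ?thesis
  proof (rule that[of "Blinfun g"])
    show "norm (Blinfun g) \<le> K"
      using abs K by (intro norm_blinfun_bound) (auto simp: bounded_linear_Blinfun_apply[OF bl])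
  qed (simp add: bounded_linear_Blinfun_apply[OF bl] g)
qed

lemma ex_dense_seq:
  obtains e :: "nat \<Rightarrow> 'a::second_countable_topology" where "closure (range e) = UNIV"
proof -
  obtain E :: "'a set" where E: "countable E" "\<And>X. open X \<Longrightarrow> X \<noteq> {} \<Longrightarrow> \<exists>d\<in>E. d \<in> X"
    using countable_dense_exists by metis
  have "E \<noteq> {}" using E(2)[of UNIV] by auto
  then have "range (from_nat_into E) = E" using E(1) by (rule range_from_nat_into)
  moreover have "closure E = UNIV"
    unfolding closure_def islimpt_def using E(2) by blast
  ultimately show ?thesis using that[of "from_nat_into E"] by simp
qed

lemma ex_dense_countable_rational_subspace:
  obtains D :: "'a::{real_normed_vector, second_countable_topology} set"
  where "countable D" "rational_subspace D" "closure D = UNIV"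
proof -
  obtain e :: "nat \<Rightarrow> 'a" where "closure (range e) = UNIV" by (rule ex_dense_seq)
  moreover obtain D where "countable D" "rational_subspace D" "range e \<subseteq> D"
    by (rule ex_countable_rational_subspace)
  ultimately show ?thesis using that closure_mono[of "range e" D] by blast
qed

text \<open>By reflexivity a functional on the dual space which vanishes on functionals norming a dense
  sequence of \<open>X\<close> is the evaluation at \<open>0\<close>.\<close>

lemma reflexive_dual_dense_seq:
  assumes refl: "reflexive_space TYPE('a::{real_normed_vector, second_countable_topology})"
  obtains \<zeta> :: "nat \<Rightarrow> 'a::{real_normed_vector, second_countable_topology} dual" where "closure (range \<zeta>) = UNIV"
proof -
  obtain e :: "nat \<Rightarrow> 'a" where e: "closure (range e) = UNIV" by (rule ex_dense_seq)
  have "\<exists>\<phi> :: 'a dual. norm \<phi> \<le> 1 \<and> norm (e i) \<le> blinfun_apply \<phi> (e i)" for i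
  proof (cases "e i = 0")
    case False
    then show ?thesis
      using norm_separation[of "{0}" "norm (e i)" "e i"] by fastforce
  qed (auto intro: exI[of _ 0])
  then obtain \<phi> :: "nat \<Rightarrow> 'a dual" where \<phi>: "\<And>i. norm (\<phi> i) \<le> 1" "\<And>i. norm (e i) \<le> blinfun_apply (\<phi> i) (e i)"
    by metis
  obtain D where D: "countable D" "rational_subspace D" "range \<phi> \<subseteq> D"
    by (rule ex_countable_rational_subspace)
  have "closure D = UNIV"
  proof (rule ccontr)
    assume "closure D \<noteq> UNIV"
    then obtain \<xi> where \<xi>: "\<xi> \<notin> closure D" by blast
    then obtain d where d: "0 < d" "ball \<xi> d \<inter> closure D = {}"
      using open_contains_ball[of "- closure D"] by (auto simp: Compl_eq_Diff_UNIV disjoint_iff subset_iff)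
    have "d \<le> norm (\<xi> - y)" if "y \<in> closure D" for y
      using d(2) that by (force simp: dist_norm)
    then obtain \<Phi> :: "'a dual dual" where \<Phi>: "\<And>y. y \<in> closure D \<Longrightarrow> \<Phi> y = 0" "d \<le> \<Phi> \<xi>"
      using norm_separation[OF subspace_closure_rational_subspace[OF D(2)] d(1)] by metis
    obtain x where x: "\<And>\<xi>. \<Phi> \<xi> = blinfun_apply \<xi> x"
      using refl unfolding reflexive_space_def by blast
    have zero: "\<phi> i x = 0" for i
      using \<Phi>(1)[of "\<phi> i"] x D(3) closure_subset by fastforce
    have "x \<noteq> 0" using \<Phi>(2) x[of \<xi>] d(1) by auto
    \<comment> \<open>Any fraction below one half would do: \<open>norm (e i)\<close> and
      \<open>norm (e i - x)\<close> both become less than \<open>norm x / 4\<close>, yet their sum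
      is at least \<open>norm x\<close>.\<close>
    then obtain i where i: "dist (e i) x < norm x / 4"
      using e by (metis UNIV_I closure_approachable divide_pos_pos rangeE zero_less_norm_iff zero_less_numeral)
    have "norm (e i) \<le> \<phi> i (e i - x)" using \<phi>(2) zero by (simp add: blinfun.diff_right)
    also have "\<dots> \<le> norm (\<phi> i) * norm (e i - x)" using norm_blinfun[of "\<phi> i" "e i - x"] by simp
    also have "\<dots> \<le> norm (e i - x)" using \<phi>(1) by (simp add: mult_left_le_one_le)
    finally have "norm (e i) \<le> norm (e i - x)" .
    moreover have "norm x \<le> norm (e i) + norm (e i - x)"
      by (metis norm_minus_commute norm_triangle_sub)
    moreover have "0 < norm x" "norm (e i - x) < norm x / 4"
      using i \<open>x \<noteq> 0\<close> by (simp_all add: dist_norm)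
    ultimately show False by linarith
  qed
  moreover have "D \<noteq> {}" using D(3) by blast
  ultimately show ?thesis
    using that[of "from_nat_into D"] D(1) by (simp add: range_from_nat_into)
qed

section \<open>Upper integrals\<close>

lemma upper_integral_le:
  assumes "integrable M g" "AE t in M. h t \<le> ereal (g t)"
  shows "upper_integral M h \<le> ereal (\<integral>t. g t \<partial>M)"
  unfolding upper_integral_def using assms by (intro INF_lower) auto

lemma upper_integral_eq:
  assumes g: "integrable M g" "AE t in M. h t = ereal (g t)"
  shows "upper_integral M h = ereal (\<integral>t. g t \<partial>M)"
proof (rule antisym)
  show "upper_integral M h \<le> ereal (\<integral>t. g t \<partial>M)"
    using g by (intro upper_integral_le) auto
  show "ereal (\<integral>t. g t \<partial>M) \<le> upper_integral M h"
    unfolding upper_integral_def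
  proof (rule INF_greatest, clarsimp)
    fix g' assume g': "integrable M g'" "AE t in M. h t \<le> ereal (g' t)"
    have "AE t in M. g t \<le> g' t" using g(2) g'(2) by eventually_elim simp
    then show "(\<integral>t. g t \<partial>M) \<le> (\<integral>t. g' t \<partial>M)" using g g' by (intro integral_mono_AE)
  qed
qed

lemma upper_integral_mono:
  assumes "AE t in M. h t \<le> h' t"
  shows "upper_integral M h \<le> upper_integral M h'"
  unfolding upper_integral_def
proof (rule INF_greatest, clarsimp)
  fix g assume g: "integrable M g" "AE t in M. h' t \<le> ereal (g t)"
  from assms g(2) have "AE t in M. h t \<le> ereal (g t)" by eventually_elim (rule order_trans)
  with g(1) show "(INF g \<in> {g. integrable M g \<and> (AE t in M. h t \<le> ereal (g t))}. ereal (\<integral>t. g t \<partial>M))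
      \<le> ereal (\<integral>t. g t \<partial>M)"
    by (intro INF_lower) auto
qed

lemma upper_integral_less_top:
  assumes "upper_integral M h < \<infinity>"
  obtains g where "integrable M g" "AE t in M. h t \<le> ereal (g t)"
  using assms unfolding upper_integral_def INF_less_iff by blast

text \<open>A finite upper integral of a measurable function is an ordinary integral. If
  \<open>g\<close> is an integrable majorant, lowering \<open>g\<close> by an integrable part of
  \<open>g - h\<close> leaves a majorant, so that part has integral at most
  \<open>\<integral> g - u\<close>. Fatou's lemma carries this bound to all of
  \<open>g - h\<close>.\<close>

lemma (in sigma_finite_measure) upper_integral_finite:
  assumes h[measurable]: "h \<in> borel_measurable M" and fin: "\<bar>upper_integral M h\<bar> \<noteq> \<infinity>"
  obtains g where "integrable M g" "AE t in M. h t = ereal (g t)"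
    "upper_integral M h = ereal (\<integral>t. g t \<partial>M)"
proof -
  obtain u where u: "upper_integral M h = ereal u" using fin by auto
  obtain g where g: "integrable M g" "AE t in M. h t \<le> ereal (g t)"
    using upper_integral_less_top[of M h] u by auto
  have [measurable]: "g \<in> borel_measurable M" using g by auto
  obtain A :: "nat \<Rightarrow> 'a set" where A: "range A \<subseteq> sets M" "(\<Union>i. A i) = space M"
    "\<And>i. emeasure M (A i) \<noteq> \<infinity>" "incseq A"
    using sigma_finite_incseq by metis
  have [measurable]: "A i \<in> sets M" for i using A by auto
  \<comment> \<open>\<open>e2ennreal\<close> sends negative values to 0, which concerns only the
    null set where \<open>g\<close> fails to majorize \<open>h\<close>, and \<open>k\<close> is
    infinite exactly where \<open>h\<close> is \<open>-\<infinity>\<close>. Cutting \<open>k\<close>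
    at height \<open>n\<close> and to \<open>A n\<close> makes it integrable.\<close>
  define k where "k = (\<lambda>t. e2ennreal (ereal (g t) - h t))"
  have [measurable]: "k \<in> borel_measurable M" unfolding k_def by measurable
  define kn where "kn = (\<lambda>n t. min (k t) (of_nat n) * indicator (A n) t)"
  have [measurable]: "kn n \<in> borel_measurable M" for n unfolding kn_def by measurable
  have kn_le: "kn n t \<le> of_nat n * indicator (A n) t" "kn n t \<le> k t" for n t
    by (auto simp: kn_def indicator_def)
  have bound: "(\<integral>\<^sup>+t. kn n t \<partial>M) \<le> ennreal ((\<integral>t. g t \<partial>M) - u)" for n
  proof -
    have fin: "(\<integral>\<^sup>+t. kn n t \<partial>M) < \<infinity>"
    proof -
      have "(\<integral>\<^sup>+t. kn n t \<partial>M) \<le> (\<integral>\<^sup>+t. of_nat n * indicator (A n) t \<partial>M)"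
        by (intro nn_integral_mono kn_le)
      also have "\<dots> < \<infinity>"
        using A(3)[of n] by (auto simp: nn_integral_cmult ennreal_mult_less_top less_top of_nat_less_top)
      finally show ?thesis .
    qed
    define r where "r = (\<lambda>t. enn2real (kn n t))"
    have kn_fin: "kn n t < \<infinity>" for t
      by (rule le_less_trans[OF kn_le(1)]) (auto simp: indicator_def of_nat_less_top)
    have r0: "0 \<le> r t" for t by (simp add: r_def)
    have [measurable]: "r \<in> borel_measurable M" unfolding r_def by measurable
    have kn_eq: "kn n t = ennreal (r t)" for t using kn_fin by (simp add: r_def)
    have r: "integrable M r" "(\<integral>\<^sup>+t. kn n t \<partial>M) = ennreal (\<integral>t. r t \<partial>M)"
    proof -
      show "integrable M r"
        using fin r0 by (intro integrableI_bounded) (auto simp: kn_eq)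
      then show "(\<integral>\<^sup>+t. kn n t \<partial>M) = ennreal (\<integral>t. r t \<partial>M)"
        unfolding kn_eq using r0 by (intro nn_integral_eq_integral) auto
    qed
    have "upper_integral M h \<le> ereal (\<integral>t. g t - r t \<partial>M)"
    proof (rule upper_integral_le)
      show "AE t in M. h t \<le> ereal (g t - r t)"
        using g(2)
      proof eventually_elim
        case (elim t)
        then show ?case
          using kn_le(2)[of n t] kn_eq[of t] by (cases "h t") (auto simp: k_def ennreal_le_iff)
      qed
    qed (use g r in auto)
    then have "(\<integral>t. r t \<partial>M) \<le> (\<integral>t. g t \<partial>M) - u" using u g r by simp
    then show ?thesis using r by (simp add: ennreal_leI)
  qed
  have "(\<integral>\<^sup>+t. k t \<partial>M) = (\<integral>\<^sup>+t. liminf (\<lambda>n. kn n t) \<partial>M)"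
  proof (rule nn_integral_cong)
    fix t assume "t \<in> space M"
    then obtain i where i: "t \<in> A i" using A(2) by blast
    have "(\<lambda>n. min (k t) (of_nat n)) \<longlonglongrightarrow> min (k t) top"
      by (intro tendsto_min tendsto_const of_nat_tendsto_top_ennreal)
    moreover have "eventually (\<lambda>n. min (k t) (of_nat n) = kn n t) sequentially"
      using eventually_ge_at_top[of i]
    proof eventually_elim
      case (elim n)
      then have "t \<in> A n" using i A(4) by (auto simp: incseq_def)
      then show ?case by (simp add: kn_def)
    qed
    ultimately have "(\<lambda>n. kn n t) \<longlonglongrightarrow> k t"
      by (simp add: filterlim_cong tendsto_cong)
    then show "k t = liminf (\<lambda>n. kn n t)" by (simp add: lim_imp_Liminf)
  qed
  also have "\<dots> \<le> liminf (\<lambda>n. \<integral>\<^sup>+t. kn n t \<partial>M)" by (intro nn_integral_liminf) simp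
  also have "\<dots> \<le> ennreal ((\<integral>t. g t \<partial>M) - u)"
    using bound
    by (intro order_trans[OF Liminf_le_Limsup[OF trivial_limit_sequentially] Limsup_bounded]) auto
  finally have k_fin: "(\<integral>\<^sup>+t. k t \<partial>M) < \<infinity>" by (simp add: le_less_trans)
  define g' where "g' = (\<lambda>t. g t - enn2real (k t))"
  have ae: "AE t in M. k t < \<infinity>" using k_fin nn_integral_PInf_AE[of k M] by (auto simp: less_top)
  have "integrable M (\<lambda>t. enn2real (k t))"
  proof (rule integrableI_bounded)
    have "(\<integral>\<^sup>+t. ennreal (norm (enn2real (k t))) \<partial>M) = (\<integral>\<^sup>+t. k t \<partial>M)"
      using ae by (intro nn_integral_cong_AE) auto
    then show "(\<integral>\<^sup>+t. ennreal (norm (enn2real (k t))) \<partial>M) < \<infinity>" using k_fin by simp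
  qed simp
  then have int: "integrable M g'" using g by (simp add: g'_def)
  have eq: "AE t in M. h t = ereal (g' t)"
    using ae g(2)
  proof eventually_elim
    case (elim t)
    then show ?case by (cases "h t") (auto simp: k_def g'_def)
  qed
  show ?thesis using that[OF int eq upper_integral_eq[OF int eq]] .
qed

text \<open>Monotone convergence applied to \<open>r n - r 0\<close>. The last conclusion ranges
  over all bounds \<open>B\<close> because one and the same limit must later obey a separate bound
  for every direction \<open>w\<close>.\<close>

lemma monotone_bounded_limit:
  fixes r :: "nat \<Rightarrow> 't \<Rightarrow> real"
  assumes r: "\<And>n. integrable M (r n)" and mono: "AE t in M. incseq (\<lambda>n. r n t)"
    and bound: "\<And>n. (\<integral>t. r n t \<partial>M) \<le> C"
  obtains G where "integrable M G" "AE t in M. \<forall>n. r n t \<le> G t"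
    "\<And>B. (\<And>n. (\<integral>t. r n t \<partial>M) \<le> B) \<Longrightarrow> (\<integral>t. G t \<partial>M) \<le> B"
proof -
  have [measurable]: "r n \<in> borel_measurable M" for n using r by auto
  define k where "k = (\<lambda>t. SUP n. ennreal (r n t - r 0 t))"
  have [measurable]: "k \<in> borel_measurable M" unfolding k_def by measurable
  have k_le: "(\<integral>\<^sup>+t. k t \<partial>M) \<le> ennreal (B - (\<integral>t. r 0 t \<partial>M))"
    if B: "\<And>n. (\<integral>t. r n t \<partial>M) \<le> B" for B
  proof -
    have "(\<integral>\<^sup>+t. k t \<partial>M) = (SUP n. \<integral>\<^sup>+t. ennreal (r n t - r 0 t) \<partial>M)"
      unfolding k_def
    proof (rule nn_integral_monotone_convergence_SUP_AE)
      show "AE t in M. ennreal (r n t - r 0 t) \<le> ennreal (r (Suc n) t - r 0 t)" for n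
        using mono by eventually_elim (auto simp: incseq_Suc_iff intro!: ennreal_leI)
    qed simp
    also have "\<dots> \<le> ennreal (B - (\<integral>t. r 0 t \<partial>M))"
    proof (rule SUP_least)
      fix n
      have "AE t in M. 0 \<le> r n t - r 0 t" using mono by eventually_elim (auto simp: incseq_def)
      then have "(\<integral>\<^sup>+t. ennreal (r n t - r 0 t) \<partial>M) = ennreal (\<integral>t. r n t - r 0 t \<partial>M)"
        using r by (intro nn_integral_eq_integral) auto
      also have "\<dots> \<le> ennreal (B - (\<integral>t. r 0 t \<partial>M))"
        using r B by (intro ennreal_leI) auto
      finally show "(\<integral>\<^sup>+t. ennreal (r n t - r 0 t) \<partial>M) \<le> ennreal (B - (\<integral>t. r 0 t \<partial>M))" .
    qed
    finally show ?thesis .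
  qed
  have k_fin: "(\<integral>\<^sup>+t. k t \<partial>M) < \<infinity>" using k_le[OF bound] by (simp add: le_less_trans)
  have ae: "AE t in M. k t < \<infinity>" using k_fin nn_integral_PInf_AE[of k M] by (auto simp: less_top)
  have eq: "(\<integral>\<^sup>+t. ennreal (enn2real (k t)) \<partial>M) = (\<integral>\<^sup>+t. k t \<partial>M)"
    using ae by (intro nn_integral_cong_AE) auto
  have int: "integrable M (\<lambda>t. enn2real (k t))"
    using k_fin eq by (intro integrableI_bounded) auto
  have int_le: "(\<integral>t. enn2real (k t) \<partial>M) \<le> B - (\<integral>t. r 0 t \<partial>M)"
    if B: "\<And>n. (\<integral>t. r n t \<partial>M) \<le> B" for B
  proof -
    have "ennreal (\<integral>t. enn2real (k t) \<partial>M) \<le> ennreal (B - (\<integral>t. r 0 t \<partial>M))"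
      using nn_integral_eq_integral[OF int] eq k_le[OF B] by simp
    then show ?thesis using B[of 0] by (simp add: ennreal_le_iff)
  qed
  show ?thesis
  proof (rule that[of "\<lambda>t. r 0 t + enn2real (k t)"])
    show "AE t in M. \<forall>n. r n t \<le> r 0 t + enn2real (k t)"
      using ae
    proof eventually_elim
      case (elim t)
      have "r n t - r 0 t \<le> enn2real (k t)" for n
      proof -
        have "ennreal (r n t - r 0 t) \<le> k t" unfolding k_def by (intro SUP_upper) simp
        then have "enn2real (ennreal (r n t - r 0 t)) \<le> enn2real (k t)"
          using elim by (intro enn2real_mono) auto
        then show ?thesis by (cases "0 \<le> r n t - r 0 t") (auto intro: order_trans[OF _ enn2real_nonneg])
      qed
      then show ?case by (simp add: algebra_simps)
    qed
    show "(\<integral>t. r 0 t + enn2real (k t) \<partial>M) \<le> B" if "\<And>n. (\<integral>t. r n t \<partial>M) \<le> B" for B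
      using int_le[OF that] int r by simp
  qed (use int r in auto)
qed

text \<open>This takes the place of measurable selection: among the first \<open>n + 1\<close>
  competitors an index of a maximum is found by successive comparison, hence measurably and with
  finitely many values. Since \<open>s n t \<le> n\<close>, the attained values increase with
  \<open>n\<close>.\<close>

lemma simple_argmax:
  fixes \<phi> :: "nat \<Rightarrow> 't \<Rightarrow> ereal"
  assumes [measurable]: "\<And>i. \<phi> i \<in> borel_measurable M"
  obtains s :: "nat \<Rightarrow> 't \<Rightarrow> nat" where "\<And>n. simple_function M (s n)" "\<And>n t. s n t \<le> n"
    "\<And>n i t. i \<le> n \<Longrightarrow> \<phi> i t \<le> \<phi> (s n t) t"
proof -
  define s where "s = rec_nat (\<lambda>t. 0::nat) (\<lambda>n s t. if \<phi> (s t) t < \<phi> (Suc n) t then Suc n else s t)"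
  have s0: "s 0 = (\<lambda>t. 0)"
    and sS: "s (Suc n) = (\<lambda>t. if \<phi> (s n t) t < \<phi> (Suc n) t then Suc n else s n t)" for n
    unfolding s_def by simp_all
  have sf: "simple_function M (s n)" for n
  proof (induction n)
    case (Suc n)
    have [measurable]: "s n \<in> measurable M (count_space UNIV)"
      using Suc by (rule measurable_simple_function)
    have [measurable]: "(\<lambda>t. \<phi> (s n t) t) \<in> borel_measurable M"
      by (rule measurable_compose_countable) measurable
    show ?case unfolding sS by (intro simple_function_If Suc simple_function_const) measurable
  qed (simp add: s0)
  have le: "s n t \<le> n" for n t by (induction n) (auto simp: s0 sS)
  have "\<phi> i t \<le> \<phi> (s n t) t" if "i \<le> n" for n i t
    using that
  proof (induction n)
    case (Suc n)
    then show ?case by (cases "i = Suc n") (auto simp: sS le_Suc_eq)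
  qed (simp add: s0)
  with sf le show ?thesis using that by blast
qed

section \<open>Finitely additive set functions\<close>

definition charge :: "'t measure \<Rightarrow> ('t set \<Rightarrow> real) \<Rightarrow> bool" where
  "charge M P \<longleftrightarrow> (\<forall>A\<in>sets M. 0 \<le> P A) \<and>
     (\<forall>A\<in>sets M. \<forall>B\<in>sets M. A \<inter> B = {} \<longrightarrow> P (A \<union> B) = P A + P B)"

lemma charge_nonneg: "charge M P \<Longrightarrow> A \<in> sets M \<Longrightarrow> 0 \<le> P A"
  and charge_add: "charge M P \<Longrightarrow> A \<in> sets M \<Longrightarrow> B \<in> sets M \<Longrightarrow> A \<inter> B = {} \<Longrightarrow> P (A \<union> B) = P A + P B"
  by (simp_all add: charge_def)

lemma charge_empty: "charge M P \<Longrightarrow> P {} = 0"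
  using charge_add[of M P "{}" "{}"] by simp

lemma charge_mono:
  assumes P: "charge M P" and "A \<in> sets M" "B \<in> sets M" "A \<subseteq> B"
  shows "P A \<le> P B"
proof -
  have "P (A \<union> (B - A)) = P A + P (B - A)" using assms by (intro charge_add[OF P]) auto
  moreover have "A \<union> (B - A) = B" using assms by auto
  ultimately show ?thesis using charge_nonneg[OF P, of "B - A"] assms by auto
qed

text \<open>With \<open>c\<close> the limit of \<open>sup {P A. measure M A < d}\<close> as \<open>d \<rightarrow> 0\<close>, sets of summable measure
  which nearly attain \<open>c\<close> carry the whole part of \<open>P\<close> that is not absolutely continuous.\<close>

lemma (in finite_measure) charge_biting:
  assumes P: "charge M P"
  obtains F :: "nat \<Rightarrow> 'a set" where "\<And>j. F j \<in> sets M" "decseq F" "(\<lambda>j. measure M (F j)) \<longlonglongrightarrow> 0"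
    "\<And>j e. 0 < e \<Longrightarrow> \<exists>d>0. \<forall>A\<in>sets M. A \<inter> F j = {} \<longrightarrow> measure M A < d \<longrightarrow> P A < e"
proof -
  define S where "S = (\<lambda>d. P ` {A \<in> sets M. measure M A < d})"
  define c where "c = (INF d\<in>{0<..}. Sup (S d))"
  have bddS: "bdd_above (S d)" for d
    unfolding S_def by (intro bdd_aboveI2[of _ _ "P (space M)"] charge_mono[OF P]) (auto dest: sets.sets_into_space)
  have SupS_ge: "P A \<le> Sup (S d)" if "A \<in> sets M" "measure M A < d" for A d
    using that bddS by (intro cSup_upper) (auto simp: S_def)
  have SupS_nonneg: "0 \<le> Sup (S d)" if "0 < d" for d
    using SupS_ge[of "{}" d] charge_empty[OF P] that by simp
  have c_le: "c \<le> Sup (S d)" if "0 < d" for d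
    unfolding c_def using that SupS_nonneg by (intro cINF_lower bdd_belowI2[of _ 0]) auto
  have "\<exists>A\<in>sets M. measure M A < (1/2) ^ k \<and> c - 1 / Suc k < P A" for k
  proof -
    have "S ((1/2) ^ k) \<noteq> {}" by (auto simp: S_def intro!: exI[of _ "{}"])
    moreover have "c - 1 / Suc k < c" by simp
    then have "c - 1 / Suc k < Sup (S ((1/2) ^ k))" using c_le[of "(1/2) ^ k"] by (rule less_le_trans) simp
    ultimately obtain y where "y \<in> S ((1/2) ^ k)" "c - 1 / Suc k < y" by (metis less_cSupD)
    then show ?thesis by (auto simp: S_def)
  qed
  then obtain E where E: "\<And>k. E k \<in> sets M" "\<And>k. measure M (E k) < (1/2) ^ k"
    "\<And>k. c - 1 / Suc k < P (E k)" by metis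
  define F where "F = (\<lambda>j. \<Union>k. E (k + j))"
  have F_sets: "F j \<in> sets M" for j using E by (auto simp: F_def)
  have EF: "E k \<subseteq> F j" if "j \<le> k" for j k
  proof -
    have "E (k - j + j) \<subseteq> F j" unfolding F_def by blast
    then show ?thesis using that by simp
  qed
  have dec: "decseq F"
  proof (rule decseq_SucI)
    show "F (Suc j) \<subseteq> F j" for j
    proof -
      have "E (k + Suc j) \<subseteq> F j" for k by (rule EF) simp
      then show ?thesis by (auto simp: F_def)
    qed
  qed
  have F_le: "measure M (F j) \<le> 2 * (1/2) ^ j" for j
  proof -
    have s: "(\<lambda>k. (1/2) ^ (k + j)) sums (2 * (1/2) ^ j :: real)"
      using sums_mult2[OF geometric_sums[of "1/2 :: real"], of "(1/2) ^ j"] by (simp add: power_add)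
    have sm: "summable (\<lambda>k. measure M (E (k + j)))"
      using E(2) by (intro summable_comparison_test[OF _ sums_summable[OF s]]) (auto intro!: exI[of _ 0] less_imp_le)
    have "measure M (F j) \<le> (\<Sum>k. measure M (E (k + j)))"
      unfolding F_def using E sm by (intro finite_measure_subadditive_countably) auto
    also have "\<dots> \<le> (\<Sum>k. (1/2) ^ (k + j))"
      using E(2) by (intro suminf_le sm sums_summable[OF s]) (auto intro: less_imp_le)
    also have "\<dots> = 2 * (1/2) ^ j" using s by (rule sums_unique[symmetric])
    finally show ?thesis .
  qed
  have F_lim: "(\<lambda>j. measure M (F j)) \<longlonglongrightarrow> 0"
  proof (rule tendsto_sandwich[OF _ _ tendsto_const])
    show "(\<lambda>j. 2 * (1/2) ^ j) \<longlonglongrightarrow> (0::real)"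
      using tendsto_mult_right_zero[OF LIMSEQ_realpow_zero[of "1/2 :: real"], of 2] by simp
  qed (use F_le in auto)
  have PF: "c \<le> P (F j)" for j
  proof (rule LIMSEQ_le_const2)
    show "(\<lambda>k. c - 1 / Suc k) \<longlonglongrightarrow> c"
      using tendsto_diff[OF tendsto_const LIMSEQ_inverse_real_of_nat, of c] by (simp add: inverse_eq_divide)
    show "\<exists>N. \<forall>k\<ge>N. c - 1 / Suc k \<le> P (F j)"
    proof (intro exI[of _ j] allI impI)
      fix k assume "j \<le> k"
      then have "P (E k) \<le> P (F j)" using E F_sets EF by (intro charge_mono[OF P])
      then show "c - 1 / Suc k \<le> P (F j)" using E(3)[of k] by linarith
    qed
  qed
  have ac: "\<exists>d>0. \<forall>A\<in>sets M. A \<inter> F j = {} \<longrightarrow> measure M A < d \<longrightarrow> P A < e" if "0 < e" for j e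
  proof -
    have "bdd_below ((\<lambda>d. Sup (S d)) ` {0<..})"
      using SupS_nonneg by (intro bdd_belowI2[of _ 0]) auto
    then have "\<exists>d>0. Sup (S d) < c + e"
      using cINF_less_iff[of "{0<..}" "\<lambda>d. Sup (S d)" "c + e"] that
      unfolding c_def[symmetric] by auto
    then obtain d where d: "0 < d" "Sup (S d) < c + e" by blast
    obtain i0 where i0: "\<And>i. i \<ge> i0 \<Longrightarrow> measure M (F i) < d / 2"
      using order_tendstoD(2)[OF F_lim, of "d / 2"] d by (auto simp: eventually_sequentially)
    \<comment> \<open>\<open>F i\<close> contains every later \<open>E k\<close>, so its charge is
      at least \<open>c\<close>. Being small, it can be united with \<open>A\<close> at total
      measure below \<open>d\<close>, where the charge is less than \<open>c + e\<close>. Since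
      \<open>i \<ge> j\<close>, the two sets are disjoint, and less than \<open>e\<close> is left
      for \<open>A\<close>.\<close>
    define i where "i = max i0 j"
    have "P A < e" if A: "A \<in> sets M" "A \<inter> F j = {}" "measure M A < d / 2" for A
    proof -
      have "F i \<subseteq> F j" using dec by (auto simp: i_def decseq_def)
      then have disj: "A \<inter> F i = {}" using A by blast
      have "measure M (A \<union> F i) \<le> measure M A + measure M (F i)"
        using A F_sets by (intro measure_Un_le) auto
      then have "P (A \<union> F i) \<le> Sup (S d)"
        using A F_sets i0[of i] by (intro SupS_ge) (auto simp: i_def)
      then have "P A + P (F i) < c + e"
        using charge_add[OF P _ _ disj] A F_sets d by simp
      then show ?thesis using PF[of i] by linarith
    qed
    then show ?thesis using d by (intro exI[of _ "d / 2"]) auto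
  qed
  show ?thesis using that[OF F_sets dec F_lim ac] .
qed

text \<open>Only the traces of \<open>P\<close> on the sets \<open>C j\<close> are countably
  additive. Their supremum over \<open>j\<close> is an increasing limit of measures, hence a
  measure; it is absolutely continuous, so Radon-Nikodym gives one density for all \<open>j\<close>.
  Its mass is at most \<open>P (space M)\<close>, which makes the density integrable.\<close>

lemma (in sigma_finite_measure) charge_density:
  fixes P :: "'a set \<Rightarrow> real" and C :: "nat \<Rightarrow> 'a set"
  assumes P: "charge M P" and C: "\<And>j. C j \<in> sets M" "incseq C"
    and cont: "\<And>j A. range A \<subseteq> sets M \<Longrightarrow> decseq A \<Longrightarrow> (\<Inter>i. A i) = {} \<Longrightarrow> (\<lambda>i. P (A i \<inter> C j)) \<longlonglongrightarrow> 0"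
    and null: "\<And>j A. A \<in> null_sets M \<Longrightarrow> P (A \<inter> C j) = 0"
  obtains h where "integrable M h" "\<And>t. 0 \<le> h t"
    "\<And>j A. A \<in> sets M \<Longrightarrow> P (A \<inter> C j) = (\<integral>t. indicator (A \<inter> C j) t * h t \<partial>M)"
proof -
  define \<kappa> where "\<kappa> = (\<lambda>A. SUP j. ennreal (P (A \<inter> C j)))"
  have ca: "countably_additive (sets M) (\<lambda>A. ennreal (P (A \<inter> C j)))" for j
  proof (rule sets.empty_continuous_imp_countably_additive)
    show "positive (sets M) (\<lambda>A. ennreal (P (A \<inter> C j)))"
      using charge_empty[OF P] by (simp add: positive_def)
    show "additive (sets M) (\<lambda>A. ennreal (P (A \<inter> C j)))"
      unfolding additive_def
    proof (intro ballI impI)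
      fix A B assume AB: "A \<in> sets M" "B \<in> sets M" "A \<inter> B = {}"
      then have "P ((A \<inter> C j) \<union> (B \<inter> C j)) = P (A \<inter> C j) + P (B \<inter> C j)"
        using C by (intro charge_add[OF P]) auto
      then show "ennreal (P ((A \<union> B) \<inter> C j)) = ennreal (P (A \<inter> C j)) + ennreal (P (B \<inter> C j))"
        using AB C charge_nonneg[OF P] by (simp add: Int_Un_distrib2 ennreal_plus)
    qed
    show "(\<lambda>i. ennreal (P (A i \<inter> C j))) \<longlonglongrightarrow> 0"
      if "range A \<subseteq> sets M" "decseq A" "(\<Inter>i. A i) = {}" for A
      using tendsto_ennrealI[OF cont[OF that]] by simp
  qed auto
  have mono: "ennreal (P (A \<inter> C i)) \<le> ennreal (P (A \<inter> C j))" if "A \<in> sets M" "i \<le> j" for A i j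
    using that C by (intro ennreal_leI charge_mono[OF P]) (auto simp: incseq_def)
  have "countably_additive (sets M) \<kappa>"
  proof (rule countably_additiveI)
    fix A :: "nat \<Rightarrow> 'a set" assume A: "range A \<subseteq> sets M" "disjoint_family A" "(\<Union>i. A i) \<in> sets M"
    have "(\<Sum>i. \<kappa> (A i)) = (SUP j. \<Sum>i. ennreal (P (A i \<inter> C j)))"
      unfolding \<kappa>_def using A mono by (intro ennreal_suminf_SUP_eq) (auto simp: incseq_def)
    also have "\<dots> = \<kappa> (\<Union>i. A i)"
      unfolding \<kappa>_def using ca A by (intro SUP_cong) (auto simp: countably_additive_def)
    finally show "(\<Sum>i. \<kappa> (A i)) = \<kappa> (\<Union>i. A i)" .
  qed
  moreover have "positive (sets M) \<kappa>"
    using charge_empty[OF P] by (simp add: positive_def \<kappa>_def)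
  ultimately have em: "emeasure (measure_of (space M) (sets M) \<kappa>) A = \<kappa> A" if "A \<in> sets M" for A
    using that by (intro emeasure_measure_of_sigma) (auto simp: sets.sigma_algebra_axioms)
  define N where "N = measure_of (space M) (sets M) \<kappa>"
  have sets_N: "sets N = sets M" by (simp add: N_def)
  have "absolutely_continuous M N"
    unfolding absolutely_continuous_def
    using null em by (auto simp: null_sets_def sets_N N_def \<kappa>_def)
  then obtain k where k[measurable]: "k \<in> borel_measurable M" and "density M k = N"
    using Radon_Nikodym sets_N by blast
  then have k_eq: "(\<integral>\<^sup>+t. k t * indicator A t \<partial>M) = \<kappa> A" if "A \<in> sets M" for A
    using that em by (metis N_def emeasure_density)
  have "(\<integral>\<^sup>+t. k t \<partial>M) = (\<integral>\<^sup>+t. k t * indicator (space M) t \<partial>M)"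
    by (intro nn_integral_cong) auto
  also have "\<dots> \<le> ennreal (P (space M))"
    unfolding k_eq[OF sets.top] \<kappa>_def using C sets.sets_into_space[OF C(1)] by (intro SUP_least ennreal_leI charge_mono[OF P]) auto
  finally have k_fin: "(\<integral>\<^sup>+t. k t \<partial>M) < \<infinity>" by (simp add: le_less_trans)
  have ae: "AE t in M. k t < \<infinity>" using k_fin nn_integral_PInf_AE[of k M] by (auto simp: less_top)
  have "(\<integral>\<^sup>+t. ennreal (enn2real (k t)) \<partial>M) = (\<integral>\<^sup>+t. k t \<partial>M)"
    using ae by (intro nn_integral_cong_AE) auto
  then have int: "integrable M (\<lambda>t. enn2real (k t))"
    using k_fin by (intro integrableI_bounded) auto
  show ?thesis
  proof (rule that[OF int])
    fix j A assume A: "A \<in> sets M"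
    then have AC: "A \<inter> C j \<in> sets M" using C by auto
    have "\<kappa> (A \<inter> C j) = ennreal (P (A \<inter> C j))"
    proof (rule antisym)
      show "\<kappa> (A \<inter> C j) \<le> ennreal (P (A \<inter> C j))"
        unfolding \<kappa>_def using AC C by (intro SUP_least ennreal_leI charge_mono[OF P]) auto
      show "ennreal (P (A \<inter> C j)) \<le> \<kappa> (A \<inter> C j)"
        unfolding \<kappa>_def by (intro SUP_upper2[of j]) (auto simp: Int_assoc)
    qed
    moreover have "(\<integral>\<^sup>+t. k t * indicator (A \<inter> C j) t \<partial>M)
        = (\<integral>\<^sup>+t. ennreal (indicator (A \<inter> C j) t * enn2real (k t)) \<partial>M)"
      using ae by (intro nn_integral_cong_AE) (auto simp: indicator_def)
    moreover have "\<dots> = ennreal (\<integral>t. indicator (A \<inter> C j) t * enn2real (k t) \<partial>M)"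
      using int AC by (intro nn_integral_eq_integral integrable_real_mult_indicator[where f="\<lambda>t. enn2real (k t)", unfolded mult.commute[of "enn2real _"]]) auto
    ultimately have "ennreal (P (A \<inter> C j)) = ennreal (\<integral>t. indicator (A \<inter> C j) t * enn2real (k t) \<partial>M)"
      using k_eq[OF AC] by simp
    then show "P (A \<inter> C j) = (\<integral>t. indicator (A \<inter> C j) t * enn2real (k t) \<partial>M)"
      using charge_nonneg[OF P AC] by (subst (asm) ennreal_inj) (auto intro!: integral_nonneg_AE)
  qed simp
qed

section \<open>Linear functionals on simple functions\<close>

definition cut_off :: "'t set \<Rightarrow> ('t \<Rightarrow> 'b::real_vector) \<Rightarrow> 't \<Rightarrow> 'b" where
  "cut_off A u = (\<lambda>t. indicator A t *\<^sub>R u t)"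

lemma cut_off_apply: "cut_off A u t = (if t \<in> A then u t else 0)"
  by (simp add: cut_off_def indicator_def)

lemma simple_function_vector:
  "simple_function M u \<Longrightarrow> simple_function M v \<Longrightarrow> simple_function M (u + v)"
  "simple_function M u \<Longrightarrow> simple_function M (a *\<^sub>R u)"
  "simple_function M 0"
  "A \<in> sets M \<Longrightarrow> simple_function M u \<Longrightarrow> simple_function M (cut_off A u)"
proof -
  show "simple_function M (u + v)" if "simple_function M u" "simple_function M v"
    using simple_function_compose2[OF that, of "(+)"] by (simp add: plus_fun_def)
  show "simple_function M (a *\<^sub>R u)" if "simple_function M u"
    using simple_function_compose1[OF that, of "\<lambda>y. a *\<^sub>R y"] by (simp add: scaleR_fun_def)
  show "simple_function M 0" by (simp add: zero_fun_def)
  show "simple_function M (cut_off A u)" if "A \<in> sets M" "simple_function M u"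
    unfolding cut_off_def
    by (intro simple_function_compose2[of M _ _ scaleR] that) (use that in simp)
qed

lemma sum_fun_apply: "(\<Sum>i\<in>I. f i) t = (\<Sum>i\<in>I. f i t)"
  by (induction I rule: infinite_finite_induct) auto

lemma cut_off_eq_sum:
  assumes u: "simple_function M u" and A: "A \<subseteq> space M"
  shows "cut_off A u = (\<Sum>y\<in>u ` space M. cut_off ({t \<in> space M. u t = y} \<inter> A) (\<lambda>_. y))"
proof
  fix t
  have fin: "finite (u ` space M)" using u by (rule simple_functionD)
  have "(\<Sum>y\<in>u ` space M. cut_off ({t \<in> space M. u t = y} \<inter> A) (\<lambda>_. y) t)
      = (\<Sum>y\<in>u ` space M. if y = u t then (if t \<in> A then u t else 0) else 0)"
    using A by (intro sum.cong) (auto simp: cut_off_apply)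
  also have "\<dots> = cut_off A u t"
    using fin A by (auto simp: fun_eq_iff cut_off_apply)
  finally show "cut_off A u t = (\<Sum>y\<in>u ` space M. cut_off ({t \<in> space M. u t = y} \<inter> A) (\<lambda>_. y)) t"
    by (simp add: sum_fun_apply)
qed

text \<open>The test sets are those where \<open>s * \<phi>\<close> is positive, with
  \<open>s = 1\<close> and \<open>s = -1\<close> for the two signs.\<close>

lemma AE_eq_0_if_integrals_0:
  fixes \<phi> :: "'t \<Rightarrow> real"
  assumes \<phi>: "integrable M \<phi>" and C: "\<And>j::nat. C j \<in> sets M" and cov: "AE t in M. \<exists>j. t \<in> C j"
    and zero: "\<And>j A. A \<in> sets M \<Longrightarrow> (\<integral>t. indicator (A \<inter> C j) t * \<phi> t \<partial>M) = 0"
  shows "AE t in M. \<phi> t = 0"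
proof -
  have [measurable]: "\<phi> \<in> borel_measurable M" "\<And>j. C j \<in> sets M" using \<phi> C by auto
  have "AE t in M. t \<in> C j \<longrightarrow> s * \<phi> t \<le> 0" for j and s :: real
  proof -
    define A where "A = {t \<in> space M. 0 < s * \<phi> t}"
    have [measurable]: "A \<in> sets M" unfolding A_def by measurable
    have int: "integrable M (\<lambda>t. indicator (A \<inter> C j) t * (s * \<phi> t))"
      using \<phi> by (intro integrable_mult_indicator[where 'b=real, simplified]) auto
    have "(\<integral>t. indicator (A \<inter> C j) t * (s * \<phi> t) \<partial>M) = s * (\<integral>t. indicator (A \<inter> C j) t * \<phi> t \<partial>M)"
      by (simp add: mult.left_commute)
    then have "(\<integral>t. indicator (A \<inter> C j) t * (s * \<phi> t) \<partial>M) = 0" using zero[of A j] by simp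
    then have "AE t in M. indicator (A \<inter> C j) t * (s * \<phi> t) = 0"
      by (subst (asm) integral_nonneg_eq_0_iff_AE[OF int]) (auto simp: A_def indicator_def)
    then show ?thesis by (auto simp: A_def indicator_def split: if_splits elim!: AE_mp)
  qed
  then have "AE t in M. \<forall>j. t \<in> C j \<longrightarrow> s * \<phi> t \<le> 0" for s :: real
    unfolding AE_all_countable by blast
  from this[of 1] this[of "-1"] cov show ?thesis by eventually_elim force
qed

text \<open>Off the sets \<open>F j\<close>, which shrink to a null set, the functional \<open>p\<close> is countably additive;
  they carry its singular part.\<close>

lemma (in sigma_finite_measure) simple_functional_representation:
  fixes p :: "('a \<Rightarrow> 'b::{real_normed_vector, second_countable_topology}) \<Rightarrow> real"
  assumes add: "\<And>u v. simple_function M u \<Longrightarrow> simple_function M v \<Longrightarrow> p (u + v) = p u + p v"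
    and scale: "\<And>a u. simple_function M u \<Longrightarrow> p (a *\<^sub>R u) = a * p u"
    and bound: "\<And>u. simple_function M u \<Longrightarrow> (\<And>t. t \<in> space M \<Longrightarrow> norm (u t) \<le> 1) \<Longrightarrow> p u \<le> K"
    and null: "\<And>u. simple_function M u \<Longrightarrow> (AE t in M. u t = 0) \<Longrightarrow> p u = 0"
  obtains m :: "'a \<Rightarrow> 'b \<Rightarrow>\<^sub>L real" and g :: "'a \<Rightarrow> real" and F :: "nat \<Rightarrow> 'a set" where
    "integrable M g" "\<And>t. norm (m t) \<le> g t" "\<And>z. integrable M (\<lambda>t. m t z)"
    "\<And>j. F j \<in> sets M" "decseq F" "AE t in M. \<exists>j. t \<notin> F j"
    "\<And>j u. simple_function M u \<Longrightarrow>
       p (cut_off (space M - F j) u) = (\<integral>t. indicator (space M - F j) t * m t (u t) \<partial>M)"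
proof -
  note sf = simple_function_vector

  \<comment> \<open>The variation of \<open>p\<close> as a finitely additive set function\<close>
  define S where "S = {u :: 'a \<Rightarrow> 'b. simple_function M u \<and> (\<forall>t\<in>space M. norm (u t) \<le> 1)}"
  \<comment> \<open>\<open>P A\<close> is the norm of \<open>p\<close> on functions supported in
    \<open>A\<close>. Additivity rests on gluing: competitors on disjoint sets combine into one
    competitor, still bounded by 1.\<close>
  define P where "P = (\<lambda>A. SUP u\<in>S. p (cut_off A u))"
  have S0: "0 \<in> S" by (simp add: S_def sf)
  have cut_S: "cut_off A u \<in> S" if "A \<in> sets M" "u \<in> S" for A u
    using that by (auto simp: S_def sf cut_off_apply)
  have p_S: "p u \<le> K" if "u \<in> S" for u using bound that by (auto simp: S_def)
  have bdd: "bdd_above ((\<lambda>u. p (cut_off A u)) ` S)" if "A \<in> sets M" for A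
    by (intro bdd_aboveI2[of _ _ K] p_S cut_S[OF that])
  have P_ge: "p (cut_off A u) \<le> P A" if "A \<in> sets M" "u \<in> S" for A u
    unfolding P_def using that bdd by (intro cSUP_upper)
  have P_le: "P A \<le> c" if "\<And>u. u \<in> S \<Longrightarrow> p (cut_off A u) \<le> c" for A c
    unfolding P_def using that S0 by (intro cSUP_least) auto
  have p0: "p 0 = 0" using null[of 0] by (simp add: sf)
  have cut0: "cut_off A 0 = 0" for A :: "'a set" by (auto simp: fun_eq_iff cut_off_def)
  have cut_Un: "cut_off (A \<union> B) u = cut_off A u + cut_off B u" if "A \<inter> B = {}" for A B :: "'a set" and u :: "'a \<Rightarrow> 'b"
    using that by (auto simp: fun_eq_iff cut_off_apply)
  have P: "charge M P"
    unfolding charge_def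
  proof (intro conjI ballI impI)
    show "0 \<le> P A" if "A \<in> sets M" for A using P_ge[OF that S0] p0 by (simp add: cut0)
    fix A B assume A: "A \<in> sets M" and B: "B \<in> sets M" and disj: "A \<inter> B = {}"
    show "P (A \<union> B) = P A + P B"
    proof (rule antisym)
      show "P (A \<union> B) \<le> P A + P B"
      proof (rule P_le)
        fix u assume u: "u \<in> S"
        then have "p (cut_off (A \<union> B) u) = p (cut_off A u) + p (cut_off B u)"
          unfolding cut_Un[OF disj] using A B by (intro add) (auto simp: S_def sf)
        then show "p (cut_off (A \<union> B) u) \<le> P A + P B" using P_ge[OF A u] P_ge[OF B u] by simp
      qed
      have "p (cut_off A u) + p (cut_off B v) \<le> P (A \<union> B)" if "u \<in> S" "v \<in> S" for u v
      proof -
        have "cut_off A u + cut_off B v \<in> S"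
          using that A B disj by (auto simp: S_def sf cut_off_apply)
        then have "p (cut_off (A \<union> B) (cut_off A u + cut_off B v)) \<le> P (A \<union> B)"
          using A B by (intro P_ge) auto
        moreover have "cut_off (A \<union> B) (cut_off A u + cut_off B v) = cut_off A u + cut_off B v"
          by (auto simp: fun_eq_iff cut_off_apply)
        ultimately show ?thesis using add[of "cut_off A u" "cut_off B v"] that A B by (simp add: S_def sf)
      qed
      then have "P A \<le> P (A \<union> B) - p (cut_off B v)" if "v \<in> S" for v
        using that by (intro P_le) (simp add: algebra_simps)
      then have "P B \<le> P (A \<union> B) - P A" by (intro P_le) (simp add: algebra_simps)
      then show "P A + P B \<le> P (A \<union> B)" by simp
    qed
  qed
  have cut_le: "p (cut_off A (\<lambda>_. y)) \<le> norm y * P A" if A: "A \<in> sets M" for A y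
  proof (cases "y = 0")
    case True
    then have "cut_off A (\<lambda>_. y) = (0 :: 'a \<Rightarrow> 'b)" by (auto simp: fun_eq_iff cut_off_apply)
    then show ?thesis using p0 True by simp
  next
    case False
    let ?e = "\<lambda>_. inverse (norm y) *\<^sub>R y"
    have eq: "cut_off A (\<lambda>_. y) = norm y *\<^sub>R cut_off A (\<lambda>_. inverse (norm y) *\<^sub>R y)"
      using False by (auto simp: fun_eq_iff cut_off_apply)
    have "?e \<in> S" using False by (simp add: S_def)
    then have "norm y * p (cut_off A ?e) \<le> norm y * P A" by (intro mult_left_mono P_ge A) auto
    moreover have "p (cut_off A (\<lambda>_. y)) = norm y * p (cut_off A ?e)"
      unfolding eq by (intro scale sf(4) A) simp
    ultimately show ?thesis by simp
  qed
  have cut_minus: "p (cut_off A (\<lambda>_. - y)) = - p (cut_off A (\<lambda>_. y))" if A: "A \<in> sets M" for A y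
  proof -
    have "cut_off A (\<lambda>_. - y) = (-1) *\<^sub>R cut_off A (\<lambda>_. y)" by (auto simp: fun_eq_iff cut_off_apply)
    then show ?thesis using scale[OF sf(4)[OF A], of "\<lambda>_. y" "-1"] by simp
  qed
  have cut_abs: "\<bar>p (cut_off A (\<lambda>_. y))\<bar> \<le> norm y * P A" if A: "A \<in> sets M" for A y
    using cut_le[OF A, of y] cut_le[OF A, of "- y"] cut_minus[OF A, of y] by simp
  have P_null: "P A = 0" if "A \<in> null_sets M" for A
  proof (rule antisym)
    show "P A \<le> 0"
    proof (rule P_le)
      fix u assume "u \<in> S"
      moreover have "AE t in M. cut_off A u t = 0"
        using AE_not_in[OF that] by eventually_elim (simp add: cut_off_apply)
      ultimately show "p (cut_off A u) \<le> 0" using null[of "cut_off A u"] that by (auto simp: S_def sf)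
    qed
    show "0 \<le> P A" using that by (intro charge_nonneg[OF P]) auto
  qed

  \<comment> \<open>An equivalent finite measure and the exceptional sets\<close>
  obtain h :: "'a \<Rightarrow> real" where [measurable]: "h \<in> borel_measurable M" and h: "\<And>x. 0 < h x" "integrable M h"
    by (rule obtain_positive_integrable_function) blast
  \<comment> \<open>Biting takes place in a finite measure, whereas \<open>M\<close> is only
    sigma-finite. As \<open>h\<close> is strictly positive, a set that is null for \<open>N\<close>
    is null for \<open>M\<close>, so the intersection of the \<open>F j\<close> is negligible for
    \<open>M\<close>.\<close>
  define N where "N = density M (\<lambda>t. ennreal (h t))"
  have sets_N[measurable_cong]: "sets N = sets M" by (simp add: N_def)
  have space_N: "space N = space M" by (simp add: N_def)
  interpret N: finite_measure N
  proof (rule finite_measureI)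
    have "emeasure N (space N) = (\<integral>\<^sup>+t. ennreal (h t) \<partial>M)"
      unfolding space_N unfolding N_def by (subst emeasure_density) (auto intro!: nn_integral_cong)
    also have "\<dots> < \<infinity>" using h by (subst nn_integral_eq_integral) (auto intro: less_imp_le)
    finally show "emeasure N (space N) \<noteq> \<infinity>" by simp
  qed
  have "charge N P" using P by (simp add: charge_def sets_N)
  then obtain F where F: "\<And>j. F j \<in> sets M" "decseq F" "(\<lambda>j. measure N (F j)) \<longlonglongrightarrow> 0"
    and ac: "\<And>j e. 0 < e \<Longrightarrow> \<exists>d>0. \<forall>A\<in>sets M. A \<inter> F j = {} \<longrightarrow> measure N A < d \<longrightarrow> P A < e"
    using N.charge_biting[of P] unfolding sets_N by metis
  define C where "C = (\<lambda>j. space M - F j)"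
  have C: "C j \<in> sets M" for j using F by (auto simp: C_def)
  have incC: "incseq C" using F(2) by (auto simp: C_def incseq_def decseq_def)
  have AC: "A \<inter> C j \<in> sets M" if "A \<in> sets M" for A j using that C by auto
  have F_null: "AE t in M. \<exists>j. t \<notin> F j"
  proof -
    have "(\<lambda>j. measure N (F j)) \<longlonglongrightarrow> measure N (\<Inter>j. F j)"
      using F sets_N by (intro N.finite_Lim_measure_decseq) auto
    then have "measure N (\<Inter>j. F j) = 0" using F(3) LIMSEQ_unique by blast
    then have "(\<Inter>j. F j) \<in> null_sets N"
      using F sets_N by (auto simp: null_sets_def N.emeasure_eq_measure)
    then have "AE t in N. t \<notin> (\<Inter>j. F j)" by (rule AE_not_in)
    then show ?thesis unfolding N_def using h by (subst (asm) AE_density) auto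
  qed
  have cov: "AE t in M. \<exists>j. t \<in> C j"
    using F_null AE_space by eventually_elim (auto simp: C_def)
  have cont: "(\<lambda>i. P (A i \<inter> C j)) \<longlonglongrightarrow> 0"
    if A: "range A \<subseteq> sets M" "decseq A" "(\<Inter>i. A i) = {}" for A j
  proof (rule LIMSEQ_I)
    fix e :: real assume "0 < e"
    from ac[OF this, of j] obtain d where d: "0 < d"
      and "\<forall>B\<in>sets M. B \<inter> F j = {} \<longrightarrow> measure N B < d \<longrightarrow> P B < e"
      by (elim exE conjE) (rule that)
    then have dP: "P B < e" if "B \<in> sets M" "B \<inter> F j = {}" "measure N B < d" for B
      using that by simp
    have "(\<lambda>i. measure N (A i)) \<longlonglongrightarrow> measure N (\<Inter>i. A i)"
      using A sets_N by (intro N.finite_Lim_measure_decseq) auto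
    then have "(\<lambda>i. measure N (A i)) \<longlonglongrightarrow> 0" using A(3) by simp
    from order_tendstoD(2)[OF this d(1)] obtain i0 where i0: "\<And>i. i \<ge> i0 \<Longrightarrow> measure N (A i) < d"
      unfolding eventually_sequentially by blast
    have "norm (P (A i \<inter> C j) - 0) < e" if "i \<ge> i0" for i
    proof -
      have Ai: "A i \<in> sets M" using A by auto
      have "measure N (A i \<inter> C j) \<le> measure N (A i)"
        using Ai C sets_N by (intro N.finite_measure_mono) auto
      then have "P (A i \<inter> C j) < e"
        using i0[OF that] Ai C by (intro dP) (auto simp: C_def)
      then show ?thesis using charge_nonneg[OF P AC[OF Ai, of j]] by simp
    qed
    then show "\<exists>i0. \<forall>i\<ge>i0. norm (P (A i \<inter> C j) - 0) < e" by blast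
  qed
  obtain g where g: "integrable M g" "\<And>t. 0 \<le> g t"
    "\<And>j A. A \<in> sets M \<Longrightarrow> P (A \<inter> C j) = (\<integral>t. indicator (A \<inter> C j) t * g t \<partial>M)"
    by (rule charge_density[OF P C incC cont P_null[OF null_set_Int2[OF _ C]]]) (assumption | rule that)+

  \<comment> \<open>Densities for single vectors\<close>
  have "\<exists>k. integrable M k \<and> (\<forall>t. - norm y * g t \<le> k t) \<and>
      (\<forall>j A. A \<in> sets M \<longrightarrow> p (cut_off (A \<inter> C j) (\<lambda>_. y)) = (\<integral>t. indicator (A \<inter> C j) t * k t \<partial>M))" for y
  proof -
    \<comment> \<open>The values of \<open>p\<close> on \<open>y\<close> are signed. Adding
      \<open>norm y * P\<close>, which dominates them, gives a charge lying below
      \<open>2 * norm y * P\<close>, so it inherits continuity and null sets from \<open>P\<close>;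
      subtracting \<open>norm y * g\<close> from its density recovers the signed one.\<close>
    define Q where "Q = (\<lambda>A. p (cut_off A (\<lambda>_. y)) + norm y * P A)"
    have Q: "charge M Q"
      unfolding charge_def
    proof (intro conjI ballI impI)
      show "0 \<le> Q A" if "A \<in> sets M" for A using cut_abs[OF that, of y] by (simp add: Q_def)
      fix A B assume A: "A \<in> sets M" and B: "B \<in> sets M" and disj: "A \<inter> B = {}"
      have "p (cut_off (A \<union> B) (\<lambda>_. y)) = p (cut_off A (\<lambda>_. y)) + p (cut_off B (\<lambda>_. y))"
        unfolding cut_Un[OF disj] using A B by (intro add) (auto simp: sf)
      then show "Q (A \<union> B) = Q A + Q B"
        using charge_add[OF P A B disj] by (simp add: Q_def algebra_simps)
    qed
    have Q_le: "Q A \<le> 2 * norm y * P A" if "A \<in> sets M" for A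
      using cut_abs[OF that, of y] by (simp add: Q_def abs_le_iff algebra_simps)
    have Q_cont: "(\<lambda>i. Q (A i \<inter> C j)) \<longlonglongrightarrow> 0"
      if A: "range A \<subseteq> sets M" "decseq A" "(\<Inter>i. A i) = {}" for A j
    proof (rule tendsto_sandwich[OF _ _ tendsto_const])
      show "(\<lambda>i. 2 * norm y * P (A i \<inter> C j)) \<longlonglongrightarrow> 0"
        using tendsto_mult_right_zero[OF cont[OF A]] by simp
    qed (use A AC Q_le charge_nonneg[OF Q] in \<open>auto intro!: always_eventually\<close>)
    have Q_null: "Q (A \<inter> C j) = 0" if "A \<in> null_sets M" for A j
    proof -
      have "A \<inter> C j \<in> null_sets M" using that C by (rule null_set_Int2)
      then show ?thesis using P_null[of "A \<inter> C j"] Q_le[of "A \<inter> C j"] charge_nonneg[OF Q, of "A \<inter> C j"] by auto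
    qed
    obtain k where k: "integrable M k" "\<And>t. 0 \<le> k t"
      "\<And>j A. A \<in> sets M \<Longrightarrow> Q (A \<inter> C j) = (\<integral>t. indicator (A \<inter> C j) t * k t \<partial>M)"
      by (rule charge_density[OF Q C incC Q_cont Q_null]) (assumption | rule that)+
    have "p (cut_off (A \<inter> C j) (\<lambda>_. y)) = (\<integral>t. indicator (A \<inter> C j) t * (k t - norm y * g t) \<partial>M)"
      if A: "A \<in> sets M" for A j
    proof -
      have "integrable M (\<lambda>t. indicator (A \<inter> C j) t * k t)" "integrable M (\<lambda>t. indicator (A \<inter> C j) t * g t)"
        using k g AC[OF A] by (auto intro: integrable_mult_indicator[where 'b=real, simplified])
      then have "(\<integral>t. indicator (A \<inter> C j) t * (k t - norm y * g t) \<partial>M) = Q (A \<inter> C j) - norm y * P (A \<inter> C j)"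
        using k(3)[OF A, of j] g(3)[OF A, of j] by (simp add: right_diff_distrib mult.left_commute[of _ "norm y"])
      then show ?thesis by (simp add: Q_def)
    qed
    then show ?thesis
      using k g by (intro exI[of _ "\<lambda>t. k t - norm y * g t"]) auto
  qed
  then obtain k where k: "\<And>y. integrable M (k y)" "\<And>y t. - norm y * g t \<le> k y t"
    and pk: "\<And>y j A. A \<in> sets M \<Longrightarrow> p (cut_off (A \<inter> C j) (\<lambda>_. y)) = (\<integral>t. indicator (A \<inter> C j) t * k y t \<partial>M)"
    by metis
  have ind_int: "integrable M (\<lambda>t. indicator (A \<inter> C j) t * k y t)" if "A \<in> sets M" for A j y
    using k(1) AC[OF that] by (auto intro: integrable_mult_indicator[where 'b=real, simplified])
  have k_lin: "AE t in M. k (a *\<^sub>R y + z) t = a * k y t + k z t" for a y z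
  proof -
    have "AE t in M. k (a *\<^sub>R y + z) t - (a * k y t + k z t) = 0"
    proof (rule AE_eq_0_if_integrals_0[OF _ C cov])
      show "integrable M (\<lambda>t. k (a *\<^sub>R y + z) t - (a * k y t + k z t))" using k by auto
      fix j A assume A: "A \<in> sets M"
      have "cut_off (A \<inter> C j) (\<lambda>_. a *\<^sub>R y + z) = a *\<^sub>R cut_off (A \<inter> C j) (\<lambda>_. y) + cut_off (A \<inter> C j) (\<lambda>_. z)"
        by (auto simp: fun_eq_iff cut_off_apply)
      then have "p (cut_off (A \<inter> C j) (\<lambda>_. a *\<^sub>R y + z)) = a * p (cut_off (A \<inter> C j) (\<lambda>_. y)) + p (cut_off (A \<inter> C j) (\<lambda>_. z))"
        using AC[OF A, of j] by (simp add: add scale sf)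
      then show "(\<integral>t. indicator (A \<inter> C j) t * (k (a *\<^sub>R y + z) t - (a * k y t + k z t)) \<partial>M) = 0"
        unfolding pk[OF A] using ind_int[OF A]
        by (simp add: right_diff_distrib distrib_left mult.left_commute[of _ a])
    qed
    then show ?thesis by eventually_elim simp
  qed

  \<comment> \<open>Gluing the scalar densities into a functional \<open>m t\<close>\<close>
  obtain D :: "'b set" where D: "countable D" "rational_subspace D" "closure D = UNIV"
    by (rule ex_dense_countable_rational_subspace)
  note Dc = rational_subspaceD[OF D(2)]
  \<comment> \<open>The exceptional set of \<open>k_lin\<close> depends on the coefficient and the
    vectors; over \<open>D\<close> and the rationals only countably many occur.\<close>
  have "AE t in M. \<forall>q::rat. \<forall>y\<in>D. \<forall>z\<in>D. k (of_rat q *\<^sub>R y + z) t = of_rat q * k y t + k z t"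
    by (intro AE_all_countable[THEN iffD2] allI AE_ball_countable[OF D(1), THEN iffD2] ballI k_lin)
  then obtain Z where Z: "Z \<in> null_sets M" and
    Z_lin: "\<And>(q::rat) y z t. t \<in> space M - Z \<Longrightarrow> y \<in> D \<Longrightarrow> z \<in> D \<Longrightarrow>
      k (of_rat q *\<^sub>R y + z) t = of_rat q * k y t + k z t"
    by (elim AE_E3) blast
  define G where "G = space M - Z"
  have G: "G \<in> sets M" "AE t in M. t \<in> G" 
    and lin: "\<And>(q::rat) y z t. t \<in> G \<Longrightarrow> y \<in> D \<Longrightarrow> z \<in> D \<Longrightarrow> k (of_rat q *\<^sub>R y + z) t = of_rat q * k y t + k z t"
    using Z Z_lin AE_not_in[OF Z] AE_space by (auto simp: G_def)
  have k_abs: "\<bar>k y t\<bar> \<le> g t * norm y" if "t \<in> G" "y \<in> D" for t y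
  proof -
    have "k 0 t = 0" using lin[OF that(1) Dc(1,1), of 1] by simp
    then have "k (- y) t = - k y t" using lin[OF that(1,2) Dc(1), of "-1"] by (simp add: of_rat_minus)
    then show ?thesis using k(2)[of y t] k(2)[of "- y" t] by (simp add: abs_le_iff mult.commute)
  qed
  \<comment> \<open>The zero functional off \<open>G\<close> keeps
    \<open>norm (m t) \<le> g t\<close> valid at every \<open>t\<close>, not merely almost
    everywhere.\<close>
  have "\<exists>m :: 'b \<Rightarrow>\<^sub>L real. (\<forall>y\<in>D. blinfun_apply m y = (if t \<in> G then k y t else 0)) \<and> norm m \<le> g t" for t
  proof (cases "t \<in> G")
    case True
    then show ?thesis
      using rational_linear_extension[OF D(2,3), of "\<lambda>y. k y t" "g t"] lin k_abs g(2)[of t] by metis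
  next
    case False
    then show ?thesis using g(2)[of t] by (intro exI[of _ 0]) auto
  qed
  then obtain m :: "'a \<Rightarrow> 'b \<Rightarrow>\<^sub>L real" where
    mk: "\<And>t y. y \<in> D \<Longrightarrow> m t y = (if t \<in> G then k y t else 0)" and m_le: "\<And>t. norm (m t) \<le> g t"
    by metis
  have m_abs: "\<bar>m t z\<bar> \<le> norm z * g t" for t z
    using order_trans[OF norm_blinfun mult_right_mono[OF m_le norm_ge_zero]]
    by (simp add: mult.commute)
  have m_meas: "(\<lambda>t. m t z) \<in> borel_measurable M" for z
  proof -
    obtain zs where zs: "\<And>n. zs n \<in> D" "zs \<longlonglongrightarrow> z" using D(3) by (metis UNIV_I closure_sequential)
    show ?thesis
    proof (rule borel_measurable_LIMSEQ_real)
      show "(\<lambda>n. m t (zs n)) \<longlonglongrightarrow> m t z" for t by (intro tendsto_intros zs)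
      have [measurable]: "k y \<in> borel_measurable M" "G \<in> sets M" for y using k G by auto
      show "(\<lambda>t. m t (zs n)) \<in> borel_measurable M" for n unfolding mk[OF zs(1)] by measurable
    qed
  qed
  have m_int: "integrable M (\<lambda>t. m t z)" for z
    using m_abs by (intro Bochner_Integration.integrable_bound[OF integrable_mult_right[OF g(1), of "norm z"] m_meas]) 
      (auto intro!: AE_I2 order_trans[OF _ abs_ge_self])
  have m_ind: "integrable M (\<lambda>t. indicator A t * m t z)" if "A \<in> sets M" for A z
    using m_int that by (auto intro: integrable_mult_indicator[where 'b=real, simplified])

  \<comment> \<open>From vectors in \<open>D\<close> to all simple functions\<close>
  have pm: "p (cut_off (A \<inter> C j) (\<lambda>_. z)) = (\<integral>t. indicator (A \<inter> C j) t * m t z \<partial>M)"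
    if A: "A \<in> sets M" for A j z
  proof -
    note B = AC[OF A, of j]
    \<comment> \<open>Both sides of the identity are Lipschitz in \<open>z\<close>, with constants
      \<open>P (A \<inter> C j)\<close> and \<open>\<integral> g\<close>, so agreement on
      \<open>D\<close> extends to its closure.\<close>
    have "continuous_on UNIV (\<lambda>z. p (cut_off (A \<inter> C j) (\<lambda>_. z)))"
    proof (rule lipschitz_on_continuous_on, rule lipschitz_onI)
      fix x y :: 'b
      have "cut_off (A \<inter> C j) (\<lambda>_. x) = cut_off (A \<inter> C j) (\<lambda>_. x - y) + cut_off (A \<inter> C j) (\<lambda>_. y)"
        by (auto simp: fun_eq_iff cut_off_apply)
      then have "p (cut_off (A \<inter> C j) (\<lambda>_. x)) = p (cut_off (A \<inter> C j) (\<lambda>_. x - y)) + p (cut_off (A \<inter> C j) (\<lambda>_. y))"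
        using add B by (simp add: sf)
      then show "dist (p (cut_off (A \<inter> C j) (\<lambda>_. x))) (p (cut_off (A \<inter> C j) (\<lambda>_. y))) \<le> P (A \<inter> C j) * dist x y"
        using cut_abs[OF B, of "x - y"] by (simp add: dist_norm mult.commute)
    qed (rule charge_nonneg[OF P B])
    moreover have "continuous_on UNIV (\<lambda>z. \<integral>t. indicator (A \<inter> C j) t * m t z \<partial>M)"
    proof (rule lipschitz_on_continuous_on, rule lipschitz_onI)
      fix x y :: 'b
      have "(\<integral>t. indicator (A \<inter> C j) t * m t x \<partial>M) - (\<integral>t. indicator (A \<inter> C j) t * m t y \<partial>M)
          = (\<integral>t. indicator (A \<inter> C j) t * m t (x - y) \<partial>M)"
        using m_ind[OF B] by (simp add: blinfun.diff_right right_diff_distrib)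
      also have "norm \<dots> \<le> (\<integral>t. norm (x - y) * g t \<partial>M)"
        using m_abs[of _ "x - y"] g m_ind[OF B]
        by (intro order_trans[OF integral_norm_bound integral_mono]) (auto simp: indicator_def)
      finally show "dist (\<integral>t. indicator (A \<inter> C j) t * m t x \<partial>M) (\<integral>t. indicator (A \<inter> C j) t * m t y \<partial>M)
          \<le> (\<integral>t. g t \<partial>M) * dist x y"
        by (simp add: dist_norm mult.commute)
    qed (use g in \<open>auto intro: integral_nonneg_AE\<close>)
    ultimately have "closed {z. p (cut_off (A \<inter> C j) (\<lambda>_. z)) = (\<integral>t. indicator (A \<inter> C j) t * m t z \<partial>M)}"
      by (rule closed_Collect_eq)
    moreover have "p (cut_off (A \<inter> C j) (\<lambda>_. z)) = (\<integral>t. indicator (A \<inter> C j) t * m t z \<partial>M)" if "z \<in> D" for z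
    proof -
      have "(\<integral>t. indicator (A \<inter> C j) t * k z t \<partial>M) = (\<integral>t. indicator (A \<inter> C j) t * m t z \<partial>M)"
      proof (rule integral_cong_AE)
        show "AE t in M. indicator (A \<inter> C j) t * k z t = indicator (A \<inter> C j) t * m t z"
          using G(2) by eventually_elim (simp add: mk[OF that])
      qed (use ind_int[OF A] m_ind[OF B] in auto)
      then show ?thesis using pk[OF A] by simp
    qed
    ultimately have "closure D \<subseteq> {z. p (cut_off (A \<inter> C j) (\<lambda>_. z)) = (\<integral>t. indicator (A \<inter> C j) t * m t z \<partial>M)}"
      by (intro closure_minimal) auto
    then show ?thesis using D(3) by auto
  qed
  have p_sum: "p (\<Sum>i\<in>I. f i) = (\<Sum>i\<in>I. p (f i))" if "finite I" "\<And>i. i \<in> I \<Longrightarrow> simple_function M (f i)" for I and f :: "'b \<Rightarrow> 'a \<Rightarrow> 'b"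
  proof -
    have "simple_function M (\<Sum>i\<in>I. f i) \<and> p (\<Sum>i\<in>I. f i) = (\<Sum>i\<in>I. p (f i))"
      using that by (induction I rule: finite_induct) (auto simp: sf p0 add)
    then show ?thesis by simp
  qed
  show ?thesis
  proof (rule that[OF g(1) m_le m_int F(1,2) F_null])
    fix j and u :: "'a \<Rightarrow> 'b" assume u: "simple_function M u"
    have fin: "finite (u ` space M)" using u by (rule simple_functionD)
    have E: "{t \<in> space M. u t = y} \<in> sets M" for y
      using simple_functionD(2)[OF u, of "{y}"] by (simp add: vimage_def Int_def conj_commute)
    have C_sub: "C j \<subseteq> space M" by (auto simp: C_def)
    have "p (cut_off (C j) u) = (\<Sum>y\<in>u ` space M. p (cut_off ({t \<in> space M. u t = y} \<inter> C j) (\<lambda>_. y)))"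
      unfolding cut_off_eq_sum[OF u C_sub] by (intro p_sum fin sf(4) AC E) simp
    also have "\<dots> = (\<integral>t. (\<Sum>y\<in>u ` space M. indicator ({t \<in> space M. u t = y} \<inter> C j) t * m t y) \<partial>M)"
      unfolding pm[OF E] using m_ind[OF AC[OF E]] by (intro Bochner_Integration.integral_sum[symmetric])
    also have "\<dots> = (\<integral>t. indicator (C j) t * m t (u t) \<partial>M)"
    proof (rule Bochner_Integration.integral_cong)
      fix t assume t: "t \<in> space M"
      have "(\<Sum>y\<in>u ` space M. indicator ({t \<in> space M. u t = y} \<inter> C j) t * m t y)
          = (\<Sum>y\<in>u ` space M. if y = u t then indicator (C j) t * m t (u t) else 0)"
        using t by (intro sum.cong) (auto simp: indicator_def)
      then show "(\<Sum>y\<in>u ` space M. indicator ({t \<in> space M. u t = y} \<inter> C j) t * m t y) = indicator (C j) t * m t (u t)"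
        using fin t by simp
    qed simp
    finally show "p (cut_off (space M - F j) u) = (\<integral>t. indicator (space M - F j) t * m t (u t) \<partial>M)"
      by (simp add: C_def)
  qed
qed

section \<open>Convex normal integrands\<close>

lemma normal_integrand_measurable:
  assumes f: "convex_normal_integrand M f" and u: "u \<in> borel_measurable M"
  shows "(\<lambda>t. f t (u t)) \<in> borel_measurable M"
proof -
  have 1: "(\<lambda>(t, x). f t x) \<in> borel_measurable (M \<Otimes>\<^sub>M borel)"
    using f by (simp add: convex_normal_integrand_def)
  have 2: "(\<lambda>t. (t, u t)) \<in> M \<rightarrow>\<^sub>M M \<Otimes>\<^sub>M borel" using u by simp
  show ?thesis using measurable_compose[OF 2 1] by simp
qed

lemma convex_fun_le:
  assumes h: "convex_fun h" and "0 \<le> u" "0 \<le> v" "u + v = 1" "h x \<le> ereal a" "h y \<le> ereal b"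
  shows "h (u *\<^sub>R x + v *\<^sub>R y) \<le> ereal (u * a + v * b)"
proof -
  have "h (u *\<^sub>R x + v *\<^sub>R y) \<le> ereal u * h x + ereal v * h y"
    using assms by (simp add: convex_fun_def)
  also have "\<dots> \<le> ereal u * ereal a + ereal v * ereal b"
    using assms by (intro add_mono ereal_mult_left_mono) auto
  finally show ?thesis by simp
qed

text \<open>If \<open>a < h y\<close>, lower semicontinuity gives \<open>a < h\<close> on a
  punctured neighbourhood of \<open>y\<close>, hence on a full one, and within \<open>U\<close> this
  neighbourhood meets the dense set. \<open>Liminf\<close> over \<open>at y\<close> disregards
  \<open>y\<close> itself, whence the case \<open>z = y\<close>.\<close>

lemma lsc_fun_le_on_open:
  assumes h: "lsc_fun h" and E: "closure E = UNIV" and U: "open U"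
    and le: "\<And>z. z \<in> E \<inter> U \<Longrightarrow> h z \<le> a" and y: "y \<in> U"
  shows "h y \<le> a"
proof (rule ccontr)
  assume "\<not> h y \<le> a"
  then have "a < h y" by simp
  also have "h y \<le> Liminf (at y) h" using h by (simp add: lsc_fun_def)
  finally have "a < Liminf (at y) h" .
  then have "eventually (\<lambda>z. a < h z) (at y)" by (rule less_LiminfD)
  then obtain S where S: "open S" "y \<in> S" "\<And>z. z \<in> S \<Longrightarrow> z \<noteq> y \<Longrightarrow> a < h z"
    unfolding eventually_at_topological by blast
  have "open (S \<inter> U)" "y \<in> S \<inter> U" using S U y by auto
  then obtain z where "z \<in> E" "z \<in> S \<inter> U"
    using E open_Int_closure_eq_empty[of "S \<inter> U" E] by blast
  then show False
    using S(3)[of z] le[of z] \<open>\<not> h y \<le> a\<close> by (cases "z = y") auto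
qed

lemma le_if_small_multiples:
  fixes A B K :: real
  assumes "\<And>s. 0 < s \<Longrightarrow> s < 1 \<Longrightarrow> A \<le> B + s * K"
  shows "A \<le> B"
proof (rule tendsto_lowerbound)
  show "((\<lambda>s. B + s * K) \<longlongrightarrow> B) (at_right 0)"
    by (auto intro!: tendsto_eq_intros)
  show "\<forall>\<^sub>F s in at_right 0. A \<le> B + s * K"
    using assms by (auto simp: eventually_at_right_field intro!: exI[of _ 1])
qed simp

text \<open>Every segment from a point of the effective domain to \<open>x0\<close> is approached inside the
  interior of the domain, so the dense values control \<open>h\<close> on its whole effective domain.\<close>

lemma eps_subdiff_if_dense:
  fixes h :: "'a::real_normed_vector \<Rightarrow> ereal" and m :: "'a \<Rightarrow>\<^sub>L real" and d :: "nat \<Rightarrow> 'a"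
  assumes h: "convex_fun h" "\<And>y. h y \<noteq> -\<infinity>" "h x = ereal a"
    and r: "0 < r" "\<And>y. y \<in> ball x0 r \<Longrightarrow> h y \<le> ereal G"
    and d: "closure (range d) = UNIV"
    and le: "\<And>i. ereal (m (d i)) - h (x + d i) + ereal a \<le> ereal l"
  shows "m \<in> eps_subdiff l h x"
proof -
  have "ereal (m (y - x)) \<le> h y - h x + ereal l" for y
  proof (cases "h y")
    case (real b)
    have "m (y - x) \<le> b - a + l"
    proof (rule le_if_small_multiples)
      fix s :: real assume s: "0 < s" "s < 1"
      define z where "z = (1 - s) *\<^sub>R y + s *\<^sub>R x0 - x"
      have "z \<in> closure (range d)" using d by simp
      moreover have "0 < s * r" using s r(1) by simp
      ultimately obtain i where i: "dist (d i) z < s * r"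
        unfolding closure_approachable by blast
      \<comment> \<open>\<open>q\<close> makes \<open>x + d i\<close> exactly the convex combination
        of \<open>y\<close> and \<open>q\<close>. Approximating \<open>z\<close> within
        \<open>s * r\<close> is what puts \<open>q\<close> into the ball, where \<open>h\<close> is
        at most \<open>G\<close>; all errors are then of order \<open>s\<close>.\<close>
      define q where "q = x0 + inverse s *\<^sub>R (d i - z)"
      have "norm (q - x0) = norm (d i - z) / s" using s by (simp add: q_def divide_inverse mult.commute)
      also have "\<dots> < r" using i s by (simp add: dist_norm pos_divide_less_eq mult.commute)
      finally have "q \<in> ball x0 r" by (simp add: dist_norm norm_minus_commute[of x0])
      moreover have eq: "x + d i = (1 - s) *\<^sub>R y + s *\<^sub>R q"
        using s by (simp add: q_def z_def algebra_simps)
      ultimately have hle: "h (x + d i) \<le> ereal ((1 - s) * b + s * G)"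
        unfolding eq using s real r(2) by (intro convex_fun_le h) auto
      have md: "m (d i) \<le> (1 - s) * b + s * G - a + l"
        using le[of i] hle h(2)[of "x + d i"] by (cases "h (x + d i)") auto
      have "m (y - x - d i) \<le> norm m * norm (y - x - d i)"
        using norm_blinfun[of m "y - x - d i"] by simp
      also have "norm (y - x - d i) \<le> norm (y - x - z) + norm (z - d i)"
        using norm_triangle_ineq[of "y - x - z" "z - d i"] by simp
      also have "y - x - z = s *\<^sub>R (y - x0)" by (simp add: z_def algebra_simps)
      also have "norm (z - d i) \<le> s * r" using i by (simp add: dist_norm norm_minus_commute)
      finally have "m (y - x - d i) \<le> norm m * (s * norm (y - x0) + s * r)"
        using s by (simp add: mult_left_mono)
      then have "m (y - x) \<le> m (d i) + norm m * (s * norm (y - x0) + s * r)"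
        by (simp add: blinfun.diff_right)
      then show "m (y - x) \<le> b - a + l + s * (G - b + norm m * (norm (y - x0) + r))"
        using md by (simp add: algebra_simps)
    qed
    then show ?thesis using real h(3) by simp
  qed (use h in auto)
  then show ?thesis using h(3) by (simp add: eps_subdiff_def)
qed

text \<open>A bound on integrals becomes a pointwise one: simple maximisers over a dense sequence of
  the ball have integrals at most \<open>C\<close>, their monotone limit is integrable and dominates
  \<open>f t\<close> on that sequence, and lower semicontinuity extends this to the whole
  ball.\<close>

lemma (in sigma_finite_measure) ex_integrable_bound_on_ball:
  fixes f :: "'a \<Rightarrow> 'b::{real_normed_vector, second_countable_topology} \<Rightarrow> ereal"
  assumes f: "convex_normal_integrand M f" and r: "0 < r"
    and bnd: "\<And>u. simple_function M u \<Longrightarrow> (\<And>t. u t \<in> ball x0 r) \<Longrightarrow> integral_functional M f u \<le> ereal C"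
    and low: "\<And>y. integral_fun M f y \<noteq> -\<infinity>"
  obtains G where "integrable M G" "AE t in M. \<forall>y\<in>ball x0 r. f t y \<le> ereal (G t)"
proof -
  obtain e :: "nat \<Rightarrow> 'b" where e: "closure (range e) = UNIV" by (rule ex_dense_seq)
  define E where "E = range e \<inter> ball x0 r"
  have "x0 \<in> ball x0 r" using r by simp
  then have "E \<noteq> {}"
    using e open_Int_closure_eq_empty[OF open_ball, of x0 r "range e"] unfolding E_def by blast
  moreover have "countable E" by (simp add: E_def)
  ultimately obtain d :: "nat \<Rightarrow> 'b" where d: "range d = E" by (metis range_from_nat_into)
  then have d_ball: "d i \<in> ball x0 r" for i by (auto simp: E_def)
  obtain s where s: "\<And>n. simple_function M (s n)" "\<And>n t. s n t \<le> n"
    "\<And>n i t. i \<le> n \<Longrightarrow> f t (d i) \<le> f t (d (s n t))"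
    by (rule simple_argmax[of "\<lambda>i t. f t (d i)", OF normal_integrand_measurable[OF f]])
      (simp | rule that; assumption)+
  define u where "u = (\<lambda>n t. d (s n t))"
  have u_sf: "simple_function M (u n)" for n
    unfolding u_def using simple_function_compose1[OF s(1), of d] by (simp add: o_def)
  have "\<exists>r. integrable M r \<and> (AE t in M. f t (u n t) = ereal (r t)) \<and> (\<integral>t. r t \<partial>M) \<le> C" for n
  proof -
    have C: "upper_integral M (\<lambda>t. f t (u n t)) \<le> ereal C"
      using bnd[OF u_sf[of n]] d_ball by (simp add: u_def integral_functional_def)
    \<comment> \<open>The maximiser does at least as well as the constant \<open>d 0\<close>, which
      excludes the value \<open>-\<infinity>\<close> and makes the upper integral finite.\<close>
    have "integral_fun M f (d 0) \<le> upper_integral M (\<lambda>t. f t (u n t))"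
      unfolding integral_fun_def u_def by (intro upper_integral_mono AE_I2 s(3)) simp
    then have "\<bar>upper_integral M (\<lambda>t. f t (u n t))\<bar> \<noteq> \<infinity>"
      using C low[of "d 0"] by auto
    then show ?thesis
      using upper_integral_finite[OF normal_integrand_measurable[OF f borel_measurable_simple_function[OF u_sf]]] C
      by (metis ereal_less_eq(3))
  qed
  then obtain \<rho> where \<rho>: "\<And>n. integrable M (\<rho> n)" "\<And>n. AE t in M. f t (u n t) = ereal (\<rho> n t)"
    "\<And>n. (\<integral>t. \<rho> n t \<partial>M) \<le> C" by metis
  have eq: "AE t in M. \<forall>n. f t (u n t) = ereal (\<rho> n t)" using \<rho>(2) by (simp add: AE_all_countable)
  then have "AE t in M. incseq (\<lambda>n. \<rho> n t)"
  proof eventually_elim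
    case (elim t)
    have "f t (u n t) \<le> f t (u (Suc n) t)" for n
      unfolding u_def by (intro s(3) le_SucI s(2))
    then show ?case using elim by (simp add: incseq_Suc_iff)
  qed
  then obtain G where G: "integrable M G" "AE t in M. \<forall>n. \<rho> n t \<le> G t"
    using monotone_bounded_limit[of M \<rho> C] \<rho> by metis
  have lsc: "AE t in M. lsc_fun (f t)" using f by (auto simp: convex_normal_integrand_def)
  have "AE t in M. \<forall>y\<in>ball x0 r. f t y \<le> ereal (G t)"
    using lsc eq G(2)
  proof eventually_elim
    case (elim t)
    show ?case
    proof
      fix y assume y: "y \<in> ball x0 r"
      have "f t z \<le> ereal (G t)" if "z \<in> range e \<inter> ball x0 r" for z
      proof -
        have "z \<in> range d" using that d by (simp add: E_def)
        then obtain i where "z = d i" by blast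
        then have "f t z \<le> f t (u i t)" unfolding u_def using s(3)[of i i t] by simp
        then show ?thesis using elim(2,3) by (metis ereal_less_eq(3) order_trans)
      qed
      then show "f t y \<le> ereal (G t)" using lsc_fun_le_on_open[OF elim(1) e open_ball _ y] by blast
    qed
  qed
  with G(1) show ?thesis using that by blast
qed

text \<open>The cone below is the epigraph of the sublinear hull of
  \<open>v \<mapsto> \<integral> f t (x + v t) - f t x + \<epsilon>\<close> and of \<open>\<xi>\<close> on the constants; infinite integrals are
  avoided by letting \<open>g\<close> range over the integrable majorants.\<close>

lemma ex_dominated_functional:
  fixes f :: "'t \<Rightarrow> 'b::real_normed_vector \<Rightarrow> ereal" and \<xi> :: "'b \<Rightarrow>\<^sub>L real"
  assumes conv: "AE t in M. convex_fun (f t)"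
    and fx: "integrable M fx" "AE t in M. f t x = ereal (fx t)"
    and G: "0 < r" "integrable M G" "AE t in M. \<forall>y\<in>ball x0 r. f t y \<le> ereal (G t)"
    and sub: "\<And>y g. integrable M g \<Longrightarrow> AE t in M. f t y \<le> ereal (g t) \<Longrightarrow>
        \<xi> (y - x) \<le> (\<integral>t. g t \<partial>M) - (\<integral>t. fx t \<partial>M) + \<epsilon>"
  obtains p :: "('t \<Rightarrow> 'b) \<Rightarrow> real" where
    "\<And>u v. simple_function M u \<Longrightarrow> simple_function M v \<Longrightarrow> p (u + v) = p u + p v"
    "\<And>a u. simple_function M u \<Longrightarrow> p (a *\<^sub>R u) = a * p u"
    "\<And>w. p (\<lambda>_. w) = \<xi> w"
    "\<And>v g. simple_function M v \<Longrightarrow> integrable M g \<Longrightarrow> AE t in M. f t (x + v t) \<le> ereal (g t) \<Longrightarrow>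
        p v \<le> (\<integral>t. g t \<partial>M) - (\<integral>t. fx t \<partial>M) + \<epsilon>"
proof -
  note sf = simple_function_vector
  define V where "V = {v :: 't \<Rightarrow> 'b. simple_function M v}"
  \<comment> \<open>Here \<open>v\<close> is written as \<open>s\<close> times the displacement
    \<open>(v + w) / s\<close>, minus the constant \<open>w\<close>. The displacement is priced by a
    majorant \<open>g\<close>, the constant exactly by \<open>\<xi>\<close>.\<close>
  define maj where "maj = (\<lambda>v s w g. simple_function M v \<and> 0 < s \<and> integrable M g \<and>
      (AE t in M. f t (x + (1 / s) *\<^sub>R (v t + w)) \<le> ereal (g t)))"
  define val where "val = (\<lambda>s w g. s * ((\<integral>t. g t \<partial>M) - (\<integral>t. fx t \<partial>M) + \<epsilon>) - \<xi> w)"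
  define A where "A = {(v, val s w g) | v s w g. maj v s w g}"
  have memA: "(v, val s w g) \<in> A" if "maj v s w g" for v s w g using that unfolding A_def by blast
  have V: "subspace V" by (rule subspaceI) (auto simp: V_def sf)
  have "dominated_cone A"
    unfolding dominated_cone_def
  proof (intro conjI ballI allI impI)
    fix p q assume "p \<in> A" "q \<in> A"
    then obtain v s w g v' s' w' g' where p: "p = (v, val s w g)" "maj v s w g"
      and q: "q = (v', val s' w' g')" "maj v' s' w' g'" unfolding A_def by blast
    have s: "0 < s" "0 < s'" "0 < s + s'" and g: "integrable M g" "integrable M g'"
      using p q by (auto simp: maj_def)
    \<comment> \<open>These weights turn the displacement belonging to the sum into a convex
      combination of the two given displacements, as for the perspective of a convex
      function.\<close>
    define a where "a = s / (s + s')"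
    define b where "b = s' / (s + s')"
    have ab: "0 \<le> a" "0 \<le> b" "a + b = 1" "(s + s') * a = s" "(s + s') * b = s'"
      using s by (auto simp: a_def b_def add_divide_distrib[symmetric])
    have "maj (v + v') (s + s') (w + w') (\<lambda>t. a * g t + b * g' t)"
      unfolding maj_def
    proof (intro conjI)
      have "AE t in M. f t (x + (1 / s) *\<^sub>R (v t + w)) \<le> ereal (g t)"
        "AE t in M. f t (x + (1 / s') *\<^sub>R (v' t + w')) \<le> ereal (g' t)"
        using p q by (auto simp: maj_def)
      with conv show "AE t in M. f t (x + (1 / (s + s')) *\<^sub>R ((v + v') t + (w + w')))
          \<le> ereal (a * g t + b * g' t)"
      proof eventually_elim
        case (elim t)
        have "x + (1 / (s + s')) *\<^sub>R ((v + v') t + (w + w'))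
            = (a + b) *\<^sub>R x + (a * (1 / s)) *\<^sub>R (v t + w) + (b * (1 / s')) *\<^sub>R (v' t + w')"
          using s ab(3) by (simp add: a_def b_def algebra_simps)
        also have "\<dots> = a *\<^sub>R (x + (1 / s) *\<^sub>R (v t + w)) + b *\<^sub>R (x + (1 / s') *\<^sub>R (v' t + w'))"
          by (simp add: algebra_simps)
        finally show ?case using convex_fun_le[OF elim(1) ab(1-3) elim(2,3)] by simp
      qed
    qed (use p q g s in \<open>auto simp: maj_def sf\<close>)
    moreover have "val (s + s') (w + w') (\<lambda>t. a * g t + b * g' t) = val s w g + val s' w' g'"
    proof -
      have "(s + s') * (\<integral>t. a * g t + b * g' t \<partial>M) = (s + s') * a * (\<integral>t. g t \<partial>M) + (s + s') * b * (\<integral>t. g' t \<partial>M)"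
        using g by (simp add: distrib_left)
      then show ?thesis unfolding ab by (simp add: val_def blinfun.add_right algebra_simps)
    qed
    ultimately show "p + q \<in> A" using memA[of "v + v'" "s + s'" "w + w'"] p q by (metis add_Pair)
  next
    fix p and a :: real assume "p \<in> A" "0 < a"
    then obtain v s w g where p: "p = (v, val s w g)" "maj v s w g" unfolding A_def by blast
    have "(1 / (a * s)) *\<^sub>R (a *\<^sub>R y + a *\<^sub>R w) = (1 / s) *\<^sub>R (y + w)" for y
      using \<open>0 < a\<close> by (simp add: scaleR_add_right)
    then have "maj (a *\<^sub>R v) (a * s) (a *\<^sub>R w) g"
      using p \<open>0 < a\<close> by (simp add: maj_def sf)
    moreover have "val (a * s) (a *\<^sub>R w) g = a * val s w g"
      by (simp add: val_def blinfun.scaleR_right algebra_simps)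
    ultimately show "a *\<^sub>R p \<in> A" using memA p by (metis real_scaleR_def scaleR_Pair)
  next
    fix b assume "(0, b) \<in> A"
    then obtain s w g where b: "b = val s w g" "maj 0 s w g" unfolding A_def by auto
    then have s: "0 < s" by (simp add: maj_def)
    \<comment> \<open>Over \<open>v = 0\<close> the displacement is the constant
      \<open>w / s\<close>, so the subgradient inequality for \<open>\<xi>\<close> applies.\<close>
    have "\<xi> ((x + (1 / s) *\<^sub>R w) - x) \<le> (\<integral>t. g t \<partial>M) - (\<integral>t. fx t \<partial>M) + \<epsilon>"
      using b by (intro sub) (auto simp: maj_def)
    then have "\<xi> w / s \<le> (\<integral>t. g t \<partial>M) - (\<integral>t. fx t \<partial>M) + \<epsilon>" by (simp add: blinfun.scaleR_right)
    then show "0 \<le> b" using s by (simp add: b val_def divide_le_eq mult.commute)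
  qed
  moreover have "fst ` A = V"
  proof
    show "fst ` A \<subseteq> V" by (auto simp: A_def V_def maj_def)
    show "V \<subseteq> fst ` A"
    proof
      fix v assume "v \<in> V"
      then have v: "simple_function M v" by (simp add: V_def)
      define b where "b = (\<Sum>y\<in>v ` space M. norm y)"
      have b: "norm (v t) \<le> b" if "t \<in> space M" for t
        unfolding b_def using simple_functionD(1)[OF v] that by (intro member_le_sum) auto
      have b0: "0 \<le> b" by (auto simp: b_def intro: sum_nonneg)
      \<comment> \<open>This scale brings \<open>v / s\<close> below norm \<open>r\<close>, also
        when \<open>b = 0\<close>. Shifting by \<open>s\<close> times \<open>x0 - x\<close> moves
        the test point to \<open>x0 + v / s\<close>, where \<open>G\<close> is an integrable
        majorant.\<close>
      define s where "s = (b + 1) / r"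
      have s: "0 < s" using b0 G(1) by (simp add: s_def)
      have "maj v s (s *\<^sub>R (x0 - x)) G"
        unfolding maj_def
      proof (intro conjI)
        show "AE t in M. f t (x + (1 / s) *\<^sub>R (v t + s *\<^sub>R (x0 - x))) \<le> ereal (G t)"
          using G(3) AE_space
        proof eventually_elim
          case (elim t)
          have "norm ((1 / s) *\<^sub>R v t) < r"
            using b[OF elim(2)] b0 G(1) s by (simp add: s_def divide_less_eq mult.commute mult_strict_left_mono)
          then have "x0 + (1 / s) *\<^sub>R v t \<in> ball x0 r" by (simp add: dist_norm)
          moreover have "x + (1 / s) *\<^sub>R (v t + s *\<^sub>R (x0 - x)) = x0 + (1 / s) *\<^sub>R v t"
            using s by (simp add: scaleR_add_right)
          ultimately show ?case using elim(1) by metis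
        qed
      qed (use v s G in auto)
      then show "v \<in> fst ` A" using memA by force
    qed
  qed
  ultimately obtain p where p_add: "\<And>u v. u \<in> V \<Longrightarrow> v \<in> V \<Longrightarrow> p (u + v) = p u + p v"
    and p_scale: "\<And>a v. v \<in> V \<Longrightarrow> p (a *\<^sub>R v) = a * p v" and p_le: "\<And>v b. (v, b) \<in> A \<Longrightarrow> p v \<le> b"
    using dominated_cone_linear[OF V] by metis
  have const_le: "p (\<lambda>_. w) \<le> \<xi> w" for w
  proof (rule le_if_small_multiples)
    fix s :: real assume "0 < s"
    \<comment> \<open>The shift \<open>- w\<close> cancels the constant, so the test point is
      \<open>x\<close> itself with majorant \<open>fx\<close>. The price is
      \<open>\<xi> w + s * \<epsilon>\<close>, and small \<open>s\<close> removes
      \<open>\<epsilon>\<close>.\<close>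
    then have "maj (\<lambda>_. w) s (- w) fx"
      using fx by (auto simp: maj_def elim!: AE_mp)
    then have "p (\<lambda>_. w) \<le> val s (- w) fx" by (intro p_le memA)
    then show "p (\<lambda>_. w) \<le> \<xi> w + s * \<epsilon>" by (simp add: val_def blinfun.minus_right)
  qed
  show ?thesis
  proof (rule that[of p])
    show "p (\<lambda>_. w) = \<xi> w" for w
    proof (rule antisym[OF const_le])
      have "p (\<lambda>_. - w) = - p (\<lambda>_. w)"
        using p_scale[of "\<lambda>_. w" "-1"] by (simp add: V_def scaleR_fun_def)
      then show "\<xi> w \<le> p (\<lambda>_. w)" using const_le[of "- w"] by (simp add: blinfun.minus_right)
    qed
    show "p v \<le> (\<integral>t. g t \<partial>M) - (\<integral>t. fx t \<partial>M) + \<epsilon>"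
      if "simple_function M v" "integrable M g" "AE t in M. f t (x + v t) \<le> ereal (g t)" for v g
    proof -
      have "maj v 1 0 g" using that by (simp add: maj_def)
      then have "p v \<le> val 1 0 g" by (intro p_le memA)
      then show ?thesis by (simp add: val_def)
    qed
  qed (use p_add p_scale in \<open>auto simp: V_def\<close>)
qed

text \<open>Since the sets decrease, a point outside one \<open>F j\<close> stays outside all later
  ones, so dominated convergence with bound \<open>|\<phi>|\<close> applies.\<close>

lemma integral_cut_tendsto:
  fixes \<phi> :: "'t \<Rightarrow> real"
  assumes \<phi>: "integrable M \<phi>" and F: "\<And>j. F j \<in> sets M" "decseq F" "AE t in M. \<exists>j. t \<notin> F j"
  shows "(\<lambda>j. \<integral>t. indicator (F j) t * \<phi> t \<partial>M) \<longlonglongrightarrow> 0"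
    and "(\<lambda>j. \<integral>t. indicator (space M - F j) t * \<phi> t \<partial>M) \<longlonglongrightarrow> (\<integral>t. \<phi> t \<partial>M)"
proof -
  have [measurable]: "\<phi> \<in> borel_measurable M" "F j \<in> sets M" for j using \<phi> F by auto
  have ev: "AE t in M. eventually (\<lambda>j. t \<notin> F j) sequentially"
    using F(3)
  proof eventually_elim
    case (elim t)
    then obtain j where "t \<notin> F j" by blast
    then have "t \<notin> F i" if "j \<le> i" for i using that F(2) by (auto simp: decseq_def)
    then show ?case by (auto simp: eventually_sequentially)
  qed
  have "(\<lambda>j. \<integral>t. indicator (F j) t * \<phi> t \<partial>M) \<longlonglongrightarrow> (\<integral>t. 0 \<partial>M)"
  proof (rule integral_dominated_convergence[where w = "\<lambda>t. \<bar>\<phi> t\<bar>"])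
    show "AE t in M. (\<lambda>j. indicator (F j) t * \<phi> t) \<longlonglongrightarrow> 0"
      using ev
    proof eventually_elim
      case (elim t)
      then have "\<forall>\<^sub>F j in sequentially. indicator (F j) t * \<phi> t = 0" by eventually_elim simp
      then show ?case by (rule tendsto_eventually)
    qed
  qed (use \<phi> in \<open>auto simp: indicator_def\<close>)
  then show "(\<lambda>j. \<integral>t. indicator (F j) t * \<phi> t \<partial>M) \<longlonglongrightarrow> 0" by simp
  show "(\<lambda>j. \<integral>t. indicator (space M - F j) t * \<phi> t \<partial>M) \<longlonglongrightarrow> (\<integral>t. \<phi> t \<partial>M)"
  proof (rule integral_dominated_convergence[where w = "\<lambda>t. \<bar>\<phi> t\<bar>"])
    show "AE t in M. (\<lambda>j. indicator (space M - F j) t * \<phi> t) \<longlonglongrightarrow> \<phi> t"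
      using ev AE_space
    proof eventually_elim
      case (elim t)
      from elim(1) have "\<forall>\<^sub>F j in sequentially. indicator (space M - F j) t * \<phi> t = \<phi> t"
        by (rule eventually_mono) (use elim(2) in simp)
      then show ?case by (rule tendsto_eventually)
    qed
  qed (use \<phi> in \<open>auto simp: indicator_def\<close>)
qed

text \<open>The analytic core of the harder inclusion. The norm bound \<open>g\<close> is part of
  the result because membership in \<open>L1_wstar\<close> and Bochner integrability are both
  derived from it.\<close>

lemma (in sigma_finite_measure) eps_subdiff_integral_decomposition:
  fixes f :: "'a \<Rightarrow> 'b::{real_normed_vector, second_countable_topology} \<Rightarrow> ereal"
  assumes f: "convex_normal_integrand M f" and r: "0 < r"
    and bnd: "\<And>u. simple_function M u \<Longrightarrow> (\<And>t. u t \<in> ball x0 r) \<Longrightarrow> integral_functional M f u \<le> ereal C"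
    and \<xi>: "\<xi> \<in> eps_subdiff \<epsilon> (integral_fun M f) x"
  obtains m :: "'a \<Rightarrow> 'b dual" and g l e where
    "integrable M g" "\<And>t. norm (m t) \<le> g t" "\<And>z. integrable M (\<lambda>t. m t z)"
    "l \<in> L1_budget M e" "0 \<le> e" "e \<le> \<epsilon>" "AE t in M. m t \<in> eps_subdiff (l t) (f t) x"
    "\<And>w. integral_fun M f (x + w) < \<infinity> \<Longrightarrow> \<xi> w - (\<integral>t. m t w \<partial>M) \<le> \<epsilon> - e"
proof -
  note sf = simple_function_vector
  have fin: "\<bar>integral_fun M f x\<bar> \<noteq> \<infinity>"
    and sub: "\<And>y. ereal (\<xi> (y - x)) \<le> integral_fun M f y - integral_fun M f x + ereal \<epsilon>"
    using \<xi> by (auto simp: eps_subdiff_def split: if_splits)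
  have f_meas: "(\<lambda>t. f t y) \<in> borel_measurable M" for y
    using normal_integrand_measurable[OF f, of "\<lambda>_. y"] by simp
  have f_AE: "AE t in M. convex_fun (f t) \<and> proper_fun (f t)"
    using f by (auto simp: convex_normal_integrand_def elim!: AE_mp)
  obtain fx where fx: "integrable M fx" "AE t in M. f t x = ereal (fx t)"
    and Ix: "integral_fun M f x = ereal (\<integral>t. fx t \<partial>M)"
    using upper_integral_finite[OF f_meas[of x]] fin unfolding integral_fun_def by metis
  have low: "integral_fun M f y \<noteq> -\<infinity>" for y
    using sub[of y] Ix by (cases "integral_fun M f y") auto
  obtain G where G: "integrable M G" "AE t in M. \<forall>y\<in>ball x0 r. f t y \<le> ereal (G t)"
    using ex_integrable_bound_on_ball[OF f r bnd low] by blast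
  have sub': "\<xi> (y - x) \<le> (\<integral>t. h t \<partial>M) - (\<integral>t. fx t \<partial>M) + \<epsilon>"
    if "integrable M h" "AE t in M. f t y \<le> ereal (h t)" for y h
  proof -
    have "integral_fun M f y \<le> ereal (\<integral>t. h t \<partial>M)"
      unfolding integral_fun_def using that by (rule upper_integral_le)
    then show ?thesis using sub[of y] Ix low[of y] by (cases "integral_fun M f y") auto
  qed

  \<comment> \<open>The extension \<open>p\<close> of \<open>\<xi>\<close> and its density
    \<open>m\<close>\<close>
  have conv: "AE t in M. convex_fun (f t)" using f_AE by eventually_elim simp
  obtain p :: "('a \<Rightarrow> 'b) \<Rightarrow> real" where
    p_add: "\<And>u v. simple_function M u \<Longrightarrow> simple_function M v \<Longrightarrow> p (u + v) = p u + p v"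
    and p_scale: "\<And>a u. simple_function M u \<Longrightarrow> p (a *\<^sub>R u) = a * p u"
    and p_const: "\<And>w. p (\<lambda>_. w) = \<xi> w"
    and p_le: "\<And>v h. simple_function M v \<Longrightarrow> integrable M h \<Longrightarrow> AE t in M. f t (x + v t) \<le> ereal (h t) \<Longrightarrow>
        p v \<le> (\<integral>t. h t \<partial>M) - (\<integral>t. fx t \<partial>M) + \<epsilon>"
    by (rule ex_dominated_functional[OF conv fx r G sub']) (assumption | rule that)+
  have p_null: "p u = 0" if u: "simple_function M u" "AE t in M. u t = 0" for u
  proof (rule ccontr)
    assume "p u \<noteq> 0"
    \<comment> \<open>Moving along a null function leaves the integrand unchanged almost everywhere,
      so \<open>p\<close> is bounded above on a whole line and must vanish there.\<close>
    have "p (a *\<^sub>R u) \<le> \<epsilon>" for a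
    proof -
      have "AE t in M. f t (x + (a *\<^sub>R u) t) \<le> ereal (fx t)"
        using fx(2) u(2) by eventually_elim simp
      then show ?thesis using p_le[of "a *\<^sub>R u" fx] u fx by (simp add: sf)
    qed
    from this[of "(\<epsilon> + 1) / p u"] show False using p_scale[OF u(1)] \<open>p u \<noteq> 0\<close> by simp
  qed
  have p_cong: "p u = p v" if "simple_function M u" "simple_function M v" "AE t in M. u t = v t" for u v
  proof -
    have "AE t in M. (u + (-1) *\<^sub>R v) t = 0" using that(3) by eventually_elim simp
    then have "p (u + (-1) *\<^sub>R v) = 0" by (intro p_null sf that)
    then show ?thesis
      using p_add[OF that(1) sf(2)[OF that(2)], of "-1"] p_scale[OF that(2), of "-1"] by simp
  qed
  \<comment> \<open>The estimate for \<open>v\<close>, half the radius times \<open>u\<close> plus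
    \<open>x0 - x\<close>, solved for \<open>p u\<close>. The factor one half keeps
    \<open>x + v t\<close> in the open ball where \<open>G\<close> majorizes.\<close>
  define K where "K = (2 / r) * ((\<integral>t. G t \<partial>M) - (\<integral>t. fx t \<partial>M) + \<epsilon> - \<xi> (x0 - x))"
  have p_bound: "p u \<le> K" if u: "simple_function M u" "\<And>t. t \<in> space M \<Longrightarrow> norm (u t) \<le> 1" for u
  proof -
    define v where "v = (r / 2) *\<^sub>R u + (\<lambda>_. x0 - x)"
    have "AE t in M. f t (x + v t) \<le> ereal (G t)"
      using G(2) AE_space
    proof eventually_elim
      case (elim t)
      have "(r / 2) * norm (u t) \<le> (r / 2) * 1"
        using u(2)[OF elim(2)] r by (intro mult_left_mono) auto
      then have "x + v t \<in> ball x0 r" using r by (simp add: v_def dist_norm)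
      then show ?case using elim by blast
    qed
    then have "p v \<le> (\<integral>t. G t \<partial>M) - (\<integral>t. fx t \<partial>M) + \<epsilon>"
      using u G by (intro p_le) (auto simp: v_def sf)
    moreover have "p v = (r / 2) * p u + \<xi> (x0 - x)"
      unfolding v_def using u p_add[of "(r / 2) *\<^sub>R u" "\<lambda>_. x0 - x"] p_scale[OF u(1), of "r / 2"] p_const
      by (simp add: sf)
    ultimately show ?thesis using r by (simp add: K_def field_simps)
  qed
  obtain m :: "'a \<Rightarrow> 'b \<Rightarrow>\<^sub>L real" and g F where g: "integrable M g" and m_le: "\<And>t. norm (m t) \<le> g t"
    and m_int: "\<And>z. integrable M (\<lambda>t. m t z)"
    and F: "\<And>j. F j \<in> sets M" "decseq F" "AE t in M. \<exists>j. t \<notin> F j"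
    and rep: "\<And>j u. simple_function M u \<Longrightarrow>
       p (cut_off (space M - F j) u) = (\<integral>t. indicator (space M - F j) t * m t (u t) \<partial>M)"
    by (rule simple_functional_representation[OF p_add p_scale p_bound p_null]) (assumption | rule that)+
  have [measurable]: "F j \<in> sets M" "(\<lambda>t. m t z) \<in> borel_measurable M" "fx \<in> borel_measurable M" for j z
    using F m_int fx by auto
  note cut_lim = integral_cut_tendsto[OF _ F]

  \<comment> \<open>Near-optimal simple displacements\<close>
  obtain e :: "nat \<Rightarrow> 'b" where e: "closure (range e) = UNIV" by (rule ex_dense_seq)
  \<comment> \<open>With \<open>0\<close> in front, \<open>\<phi> 0\<close> vanishes almost
    everywhere, so all maxima are non-negative; this also excludes points where \<open>f\<close> is
    infinite.\<close>
  define d where "d = case_nat 0 e"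
  have d0: "d 0 = 0" by (simp add: d_def)
  have "range e \<subseteq> range d"
  proof
    fix y assume "y \<in> range e"
    then obtain i where "y = d (Suc i)" by (auto simp: d_def)
    then show "y \<in> range d" by blast
  qed
  then have d: "closure (range d) = UNIV" using e closure_mono by blast
  define \<phi> where "\<phi> = (\<lambda>i t. ereal (m t (d i)) - f t (x + d i) + ereal (fx t))"
  have \<phi>_meas: "\<phi> i \<in> borel_measurable M" for i
    unfolding \<phi>_def using f_meas[of "x + d i"] by measurable
  obtain s where s_sf: "\<And>n. simple_function M (s n)" and s_le: "\<And>n t. s n t \<le> n"
    and s_max: "\<And>n i t. i \<le> n \<Longrightarrow> \<phi> i t \<le> \<phi> (s n t) t"
    by (rule simple_argmax[of \<phi>, OF \<phi>_meas]) (assumption | rule that)+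
  have s_meas[measurable]: "s n \<in> measurable M (count_space UNIV)" for n
    using s_sf by (rule measurable_simple_function)
  define u where "u = (\<lambda>n t. d (s n t))"
  have u_sf: "simple_function M (u n)" for n
    unfolding u_def using simple_function_compose1[OF s_sf, of d] by (simp add: o_def)
  define gap where "gap = (\<lambda>n t. real_of_ereal (\<phi> (s n t) t))"
  have [measurable]: "gap n \<in> borel_measurable M" for n
  proof -
    have "(\<lambda>t. \<phi> (s n t) t) \<in> borel_measurable M"
      by (rule measurable_compose_countable[where f = \<phi>, OF \<phi>_meas s_meas])
    then show ?thesis unfolding gap_def by measurable
  qed
  have pointwise: "AE t in M. \<forall>n. f t (x + u n t) = ereal (m t (u n t) + fx t - gap n t) \<and>
      0 \<le> gap n t \<and> \<phi> (s n t) t = ereal (gap n t)"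
    using fx(2) f_AE
  proof eventually_elim
    case (elim t)
    show ?case
    proof
      fix n
      have "\<phi> 0 t = 0" using elim(1) by (simp add: \<phi>_def d0 zero_ereal_def)
      then have "0 \<le> \<phi> (s n t) t" using s_max[of 0 n t] by simp
      moreover have "f t (x + u n t) \<noteq> -\<infinity>" using elim(2) by (simp add: proper_fun_def)
      ultimately show "f t (x + u n t) = ereal (m t (u n t) + fx t - gap n t) \<and>
          0 \<le> gap n t \<and> \<phi> (s n t) t = ereal (gap n t)"
        by (cases "f t (x + u n t)") (auto simp: \<phi>_def gap_def u_def)
    qed
  qed
  obtain A :: "nat \<Rightarrow> 'a set" where A: "range A \<subseteq> sets M" "(\<Union>i. A i) = space M"
    "\<And>i. emeasure M (A i) \<noteq> \<infinity>" "incseq A"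
    using sigma_finite_incseq by metis
  have [measurable]: "A i \<in> sets M" for i using A by auto
  \<comment> \<open>The gap itself may fail to be integrable. Its truncation is integrable and
    smaller, so it can be subtracted from \<open>m t (u n t) + fx t\<close> without losing the
    majorant of \<open>f t (x + u n t)\<close>.\<close>
  define \<rho> where "\<rho> = (\<lambda>n t. indicator (A n) t * min (gap n t) (real n))"
  have \<rho>: "AE t in M. 0 \<le> \<rho> n t \<and> \<rho> n t \<le> gap n t \<and> \<rho> n t \<le> real n * indicator (A n) t" for n
    using pointwise
  proof eventually_elim
    case (elim t)
    then have "0 \<le> gap n t" by blast
    then show ?case by (auto simp: \<rho>_def indicator_def)
  qed
  have \<rho>_int: "integrable M (\<rho> n)" for n
  proof (rule Bochner_Integration.integrable_bound)
    show "integrable M (\<lambda>t. real n * indicator (A n) t)"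
      using A(3)[of n] by (auto simp: less_top)
    show "\<rho> n \<in> borel_measurable M" unfolding \<rho>_def by measurable
    show "AE t in M. norm (\<rho> n t) \<le> norm (real n * indicator (A n) t)"
      using \<rho>[of n] by eventually_elim auto
  qed
  have \<rho>_mono: "AE t in M. incseq (\<lambda>n. \<rho> n t)"
    using pointwise
  proof eventually_elim
    case (elim t)
    have "\<rho> n t \<le> \<rho> (Suc n) t" for n
    proof -
      have "\<phi> (s n t) t \<le> \<phi> (s (Suc n) t) t" by (intro s_max le_SucI s_le)
      then have "gap n t \<le> gap (Suc n) t" using elim by simp
      moreover have "0 \<le> gap n t" using elim by blast
      moreover have "A n \<subseteq> A (Suc n)" using A(4) by (auto simp: incseq_Suc_iff)
      ultimately show ?thesis by (auto simp: \<rho>_def indicator_def min_def)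
    qed
    then show ?case by (simp add: incseq_Suc_iff)
  qed
  have mu_int: "integrable M (\<lambda>t. m t (u n t))" for n
  proof (rule Bochner_Integration.integrable_bound)
    define B where "B = (\<Sum>i\<le>n. norm (d i))"
    show "integrable M (\<lambda>t. B * g t)" using g by simp
    show "(\<lambda>t. m t (u n t)) \<in> borel_measurable M"
      unfolding u_def by (rule measurable_compose_countable[where f = "\<lambda>i t. m t (d i)", OF _ s_meas]) simp
    show "AE t in M. norm (m t (u n t)) \<le> norm (B * g t)"
    proof (rule AE_I2)
      fix t
      have "norm (d (s n t)) \<le> B" unfolding B_def using s_le by (intro member_le_sum) auto
      then have "norm (m t) * norm (u n t) \<le> g t * B"
        unfolding u_def using m_le[of t] order_trans[OF norm_ge_zero m_le] by (intro mult_mono) auto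
      then show "norm (m t (u n t)) \<le> norm (B * g t)"
        using norm_blinfun[of "m t" "u n t"] by (simp add: mult.commute)
    qed
  qed
  have ind_int: "integrable M (\<lambda>t. indicator S t * h t)" if "integrable M h" "S \<in> sets M" for S and h :: "'a \<Rightarrow> real"
    using that by (auto intro: integrable_mult_indicator[where 'b=real, simplified])

  \<comment> \<open>Testing \<open>p\<close> off and on the exceptional sets\<close>
  have key: "(\<integral>t. \<rho> n t \<partial>M) \<le> \<epsilon> - (\<xi> w - (\<integral>t. m t w \<partial>M))" if w: "integral_fun M f (x + w) < \<infinity>" for n w
  proof -
    have "\<bar>upper_integral M (\<lambda>t. f t (x + w))\<bar> \<noteq> \<infinity>"
      using w low[of "x + w"] by (auto simp: integral_fun_def)
    then obtain fw where fw: "integrable M fw" "AE t in M. f t (x + w) = ereal (fw t)"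
      using upper_integral_finite[OF f_meas] by metis
    have step: "(\<integral>t. indicator (space M - F j) t * \<rho> n t \<partial>M) + (\<xi> w - (\<integral>t. indicator (space M - F j) t * m t w \<partial>M))
        \<le> (\<integral>t. indicator (space M - F j) t * fx t \<partial>M) + (\<integral>t. indicator (F j) t * fw t \<partial>M) - (\<integral>t. fx t \<partial>M) + \<epsilon>"
      for j
    proof -
      define S where "S = space M - F j"
      have S[measurable]: "S \<in> sets M" by (simp add: S_def)
      \<comment> \<open>Off \<open>F j\<close>, where \<open>p\<close> is given by \<open>m\<close>,
        the near-optimal displacement is used; on \<open>F j\<close> the constant \<open>w\<close>
        isolates the singular part.\<close>
      define v where "v = cut_off S (u n) + cut_off (F j) (\<lambda>_. w)"
      define h where "h = (\<lambda>t. indicator S t * m t (u n t) + indicator S t * fx t - indicator S t * \<rho> n t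
        + indicator (F j) t * fw t)"
      have h_int: "integrable M h"
        unfolding h_def using mu_int fx(1) \<rho>_int fw(1) F S by (intro Bochner_Integration.integrable_add Bochner_Integration.integrable_diff ind_int)
      have "AE t in M. f t (x + v t) \<le> ereal (h t)"
        using pointwise \<rho>[of n] fw(2) AE_space
      proof eventually_elim
        case (elim t)
        show ?case
        proof (cases "t \<in> F j")
          case True
          then show ?thesis using elim by (simp add: v_def h_def S_def cut_off_apply)
        next
          case False
          then have "x + v t = x + u n t" using elim by (simp add: v_def S_def cut_off_apply)
          then have "f t (x + v t) = ereal (m t (u n t) + fx t - gap n t)" using elim by simp
          then show ?thesis using elim False by (simp add: h_def S_def)
        qed
      qed
      then have "p v \<le> (\<integral>t. h t \<partial>M) - (\<integral>t. fx t \<partial>M) + \<epsilon>"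
        using h_int F S by (intro p_le) (auto simp: v_def sf u_sf)
      moreover have "(\<integral>t. h t \<partial>M) = (\<integral>t. indicator S t * m t (u n t) \<partial>M) + (\<integral>t. indicator S t * fx t \<partial>M)
          - (\<integral>t. indicator S t * \<rho> n t \<partial>M) + (\<integral>t. indicator (F j) t * fw t \<partial>M)"
        unfolding h_def using ind_int[OF mu_int S, of n] ind_int[OF fx(1) S] ind_int[OF \<rho>_int S, of n] ind_int[OF fw(1) F(1), of j]
        by simp
      moreover have "p v = (\<integral>t. indicator S t * m t (u n t) \<partial>M) + p (cut_off (F j) (\<lambda>_. w))"
        unfolding v_def using rep[OF u_sf, of j n] F S by (simp add: S_def p_add sf u_sf)
      \<comment> \<open>Since \<open>p\<close> is \<open>\<xi>\<close> on constants, splitting the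
        constant \<open>w\<close> eliminates the unknown value on \<open>F j\<close> and leaves
        \<open>\<xi> w\<close> minus an integral of \<open>m\<close>.\<close>
      moreover have "\<xi> w = (\<integral>t. indicator S t * m t w \<partial>M) + p (cut_off (F j) (\<lambda>_. w))"
      proof -
        have "p (\<lambda>_. w) = p (cut_off S (\<lambda>_. w) + cut_off (F j) (\<lambda>_. w))"
          using F S by (intro p_cong) (auto simp: sf cut_off_apply S_def)
        then show ?thesis using rep[of "\<lambda>_. w" j] F S by (simp add: S_def p_add sf p_const)
      qed
      ultimately show ?thesis unfolding S_def by simp
    qed
    have "(\<lambda>j. (\<integral>t. indicator (space M - F j) t * \<rho> n t \<partial>M) + (\<xi> w - (\<integral>t. indicator (space M - F j) t * m t w \<partial>M)))
        \<longlonglongrightarrow> (\<integral>t. \<rho> n t \<partial>M) + (\<xi> w - (\<integral>t. m t w \<partial>M))"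
      using \<rho>_int m_int by (intro tendsto_intros cut_lim)
    moreover have "(\<lambda>j. (\<integral>t. indicator (space M - F j) t * fx t \<partial>M) + (\<integral>t. indicator (F j) t * fw t \<partial>M) - (\<integral>t. fx t \<partial>M) + \<epsilon>)
        \<longlonglongrightarrow> (\<integral>t. fx t \<partial>M) + 0 - (\<integral>t. fx t \<partial>M) + \<epsilon>"
      using fx(1) fw(1) by (intro tendsto_intros cut_lim)
    ultimately have "(\<integral>t. \<rho> n t \<partial>M) + (\<xi> w - (\<integral>t. m t w \<partial>M)) \<le> (\<integral>t. fx t \<partial>M) + 0 - (\<integral>t. fx t \<partial>M) + \<epsilon>"
      using step by (intro LIMSEQ_le) auto
    then show ?thesis by simp
  qed

  \<comment> \<open>Passage to the limit \<open>l\<close> and the pointwise subgradients\<close>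
  have key0: "(\<integral>t. \<rho> n t \<partial>M) \<le> \<epsilon>" for n
    using key[of 0 n] Ix by (simp add: blinfun.zero_right)
  obtain H where H: "integrable M H" "AE t in M. \<forall>n. \<rho> n t \<le> H t"
    "\<And>B. (\<And>n. (\<integral>t. \<rho> n t \<partial>M) \<le> B) \<Longrightarrow> (\<integral>t. H t \<partial>M) \<le> B"
    by (rule monotone_bounded_limit[OF \<rho>_int \<rho>_mono key0]) (rule that, assumption, assumption, meson)
  \<comment> \<open>\<open>L1_budget\<close> demands non-negativity at every point, whereas
    \<open>H\<close> has it only almost everywhere.\<close>
  define l where "l = (\<lambda>t. max 0 (H t))"
  have l_H: "AE t in M. l t = H t"
    using H(2) \<rho>[of 0]
  proof eventually_elim
    case (elim t)
    then have "0 \<le> \<rho> 0 t" "\<rho> 0 t \<le> H t" by blast+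
    then show ?case by (simp add: l_def)
  qed
  have l_int: "integrable M l" using H(1) by (simp add: l_def)
  have l_eq: "(\<integral>t. l t \<partial>M) = (\<integral>t. H t \<partial>M)"
    using l_int H(1) l_H by (intro integral_cong_AE) auto
  have "AE t in M. m t \<in> eps_subdiff (l t) (f t) x"
    using f_AE fx(2) G(2) pointwise H(2) AE_space
  proof eventually_elim
    case (elim t)
    obtain i0 where i0: "t \<in> A i0" using elim A(2) by blast
    show ?case
    proof (rule eps_subdiff_if_dense)
      show "f t x = ereal (fx t)" "0 < r" "closure (range d) = UNIV" by (fact elim r d)+
      show "convex_fun (f t)" "f t y \<noteq> -\<infinity>" for y using elim by (auto simp: proper_fun_def)
      show "f t y \<le> ereal (G t)" if "y \<in> ball x0 r" for y using elim that by blast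
      show "ereal (m t (d i)) - f t (x + d i) + ereal (fx t) \<le> ereal (l t)" for i
      proof -
        obtain k where k: "l t < real k" using reals_Archimedean2 by blast
        \<comment> \<open>Large enough for three purposes: \<open>d i\<close> is among the
          competitors, \<open>t\<close> lies in \<open>A n\<close>, and the cut at height
          \<open>n\<close> exceeds \<open>l t\<close>. As \<open>\<rho> n t \<le> l t\<close>, the
          truncation is then inactive and the full gap is bounded.\<close>
        define n where "n = max k (max i i0)"
        have "A i0 \<subseteq> A n" using incseqD[OF A(4), of i0 n] by (simp add: n_def)
        then have n: "l t < real n" "i \<le> n" "t \<in> A n"
          using k i0 by (auto simp: n_def)
        have "\<rho> n t \<le> l t" using elim by (auto simp: l_def intro: max.coboundedI2)
        then have "gap n t \<le> l t" using n by (simp add: \<rho>_def min_def split: if_splits)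
        moreover have "\<phi> i t \<le> ereal (gap n t)" using s_max[OF n(2), of t] elim by simp
        ultimately show ?thesis by (simp add: \<phi>_def order_trans)
      qed
    qed
  qed
  moreover have "l \<in> L1_budget M (\<integral>t. l t \<partial>M)" using l_int by (simp add: L1_budget_def l_def)
  moreover have "0 \<le> (\<integral>t. l t \<partial>M)" by (intro integral_nonneg_AE) (simp add: l_def)
  moreover have "(\<integral>t. l t \<partial>M) \<le> \<epsilon>" unfolding l_eq using key0 by (rule H(3))
  moreover have "\<xi> w - (\<integral>t. m t w \<partial>M) \<le> \<epsilon> - (\<integral>t. l t \<partial>M)" if "integral_fun M f (x + w) < \<infinity>" for w
    using H(3)[OF key[OF that]] l_eq by simp
  ultimately show ?thesis using that[OF g m_le m_int] by blast
qed

text \<open>The pointwise inequalities are integrated, and \<open>\<eta>\<close> contributes at most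
  \<open>e2\<close> on the domain. The integral of \<open>m\<close> enters only through its scalar
  values, so the lemma covers Gelfand and Bochner integrals alike.\<close>

lemma (in sigma_finite_measure) eps_subdiff_integral_fun_superset:
  fixes f :: "'a \<Rightarrow> 'b::{real_normed_vector, second_countable_topology} \<Rightarrow> ereal"
    and m :: "'a \<Rightarrow> 'b dual" and \<zeta> \<eta> :: "'b dual"
  assumes f: "convex_normal_integrand M f" and x: "integral_fun M f x \<noteq> -\<infinity>"
    and m: "\<And>z. integrable M (\<lambda>t. m t z)" "\<And>z. \<zeta> z = (\<integral>t. m t z \<partial>M)"
    and l: "l \<in> L1_budget M e1" and sub: "AE t in M. m t \<in> eps_subdiff (l t) (f t) x"
    and \<eta>: "\<eta> \<in> eps_normal e2 (eff_dom (integral_fun M f)) x"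
  shows "\<zeta> + \<eta> \<in> eps_subdiff (e1 + e2) (integral_fun M f) x"
proof -
  let ?D = "eff_dom (integral_fun M f)"
  have xD: "x \<in> ?D" and \<eta>_le: "ereal (\<eta> (y - x)) \<le> indicator_fun ?D y - indicator_fun ?D x + ereal e2" for y
    using \<eta> by (auto simp: eps_normal_def eps_subdiff_def indicator_fun_def split: if_splits)
  have "\<bar>upper_integral M (\<lambda>t. f t x)\<bar> \<noteq> \<infinity>"
    using x xD by (auto simp: eff_dom_def integral_fun_def)
  then obtain fx where fx: "integrable M fx" "AE t in M. f t x = ereal (fx t)"
    and Ix: "integral_fun M f x = ereal (\<integral>t. fx t \<partial>M)"
    using upper_integral_finite[OF normal_integrand_measurable[OF f borel_measurable_const]]
    unfolding integral_fun_def by metis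
  have l': "integrable M l" "(\<integral>t. l t \<partial>M) \<le> e1" using l by (auto simp: L1_budget_def)
  have "ereal ((\<zeta> + \<eta>) (y - x)) \<le> integral_fun M f y - integral_fun M f x + ereal (e1 + e2)" for y
  proof (cases "y \<in> ?D")
    case True
    \<comment> \<open>An upper integral is an infimum, so the lower bound is checked against every
      integrable majorant of \<open>f\<close> at \<open>y\<close>.\<close>
    have "ereal (\<zeta> (y - x) + (\<integral>t. fx t \<partial>M) - e1) \<le> integral_fun M f y"
      unfolding integral_fun_def upper_integral_def
    proof (rule INF_greatest, clarsimp)
      fix h assume h: "integrable M h" "AE t in M. f t y \<le> ereal (h t)"
      have "AE t in M. m t (y - x) + fx t - l t \<le> h t"
        using sub fx(2) h(2)
      proof eventually_elim
        case (elim t)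
        have "ereal (m t (y - x)) \<le> f t y - f t x + ereal (l t)"
          using elim(1,2) by (simp add: eps_subdiff_def)
        also have "\<dots> \<le> ereal (h t) - ereal (fx t) + ereal (l t)"
          unfolding elim(2) by (intro add_mono ereal_minus_mono elim(3)) auto
        finally show ?case by simp
      qed
      then have "(\<integral>t. m t (y - x) + fx t - l t \<partial>M) \<le> (\<integral>t. h t \<partial>M)"
        using m fx l' h by (intro integral_mono_AE) auto
      then show "\<zeta> (y - x) + (\<integral>t. fx t \<partial>M) - e1 \<le> (\<integral>t. h t \<partial>M)"
        using m(1)[of "y - x"] fx(1) l' by (simp add: m(2))
    qed
    moreover have "\<eta> (y - x) \<le> e2" using \<eta>_le[of y] True xD by (simp add: indicator_fun_def)
    ultimately show ?thesis
      using True Ix by (cases "integral_fun M f y") (auto simp: eff_dom_def blinfun.add_left)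
  next
    case False
    then show ?thesis using Ix by (simp add: eff_dom_def)
  qed
  then show ?thesis using Ix by (simp add: eps_subdiff_def)
qed

section \<open>Gelfand and Bochner integrals\<close>

lemma norm_bounded_L1_wstar:
  fixes m :: "'t \<Rightarrow> 'b::real_normed_vector dual"
  assumes g: "integrable M g" "\<And>t. norm (m t) \<le> g t" and m: "\<And>z. integrable M (\<lambda>t. m t z)"
  shows "m \<in> L1_wstar M"
proof -
  have "upper_integral M (\<lambda>t. SUP b\<in>B. ereal (m t b)) < \<infinity>" if "bounded B" for B
  proof -
    obtain R where R: "\<And>b. b \<in> B \<Longrightarrow> norm b \<le> R" using \<open>bounded B\<close> by (auto simp: bounded_iff)
    have "(SUP b\<in>B. ereal (m t b)) \<le> ereal (g t * R)" for t
    proof (rule SUP_least)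
      fix b assume "b \<in> B"
      have "m t b \<le> norm (m t) * norm b" using norm_blinfun[of "m t" b] by simp
      also have "\<dots> \<le> g t * R"
        using g(2)[of t] R[OF \<open>b \<in> B\<close>] order_trans[OF norm_ge_zero g(2)] by (intro mult_mono) auto
      finally show "ereal (m t b) \<le> ereal (g t * R)" by simp
    qed
    then have "upper_integral M (\<lambda>t. SUP b\<in>B. ereal (m t b)) \<le> ereal (\<integral>t. g t * R \<partial>M)"
      using g by (intro upper_integral_le) auto
    then show ?thesis by (rule le_less_trans) simp
  qed
  then show ?thesis using m by (simp add: L1_wstar_def)
qed

text \<open>Evaluation at \<open>z\<close> is bounded and linear, so it maps approximating simple
  functions to approximating scalar ones. Completeness of the measure turns limits almost everywhere
  into measurable functions.\<close>

lemma has_strong_bochner_integral_apply: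
  fixes m :: "'t \<Rightarrow> 'b::real_normed_vector dual" and \<zeta> :: "'b dual"
  assumes M: "complete_measure M" and m: "has_strong_bochner_integral M m \<zeta>"
  shows "integrable M (\<lambda>t. m t z)" and "\<zeta> z = (\<integral>t. m t z \<partial>M)"
proof -
  obtain \<sigma> where \<sigma>: "\<And>k. simple_function M (\<sigma> k)" "AE t in M. (\<lambda>k. \<sigma> k t) \<longlonglongrightarrow> m t"
    using m by (auto simp: has_strong_bochner_integral_def strongly_measurable_def)
  obtain s where s: "\<And>i. Bochner_Integration.simple_bochner_integrable M (s i)"
    and s_lim: "(\<lambda>i. \<integral>\<^sup>+ t. ennreal (norm (m t - s i t)) \<partial>M) \<longlonglongrightarrow> 0"
      "(\<lambda>i. Bochner_Integration.simple_bochner_integral M (s i)) \<longlonglongrightarrow> \<zeta>"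
    using m by (auto simp: has_strong_bochner_integral_def)
  have s_sf: "simple_function M (s i)" for i
    using s[of i] by (auto elim: simple_bochner_integrable.cases)
  have m_meas: "(\<lambda>t. m t z) \<in> borel_measurable M"
    unfolding strongly_measurable_iff_borel[OF M, symmetric] strongly_measurable_def
  proof (intro exI conjI allI)
    show "simple_function M (\<lambda>t. \<sigma> k t z)" for k
      using simple_function_compose1[OF \<sigma>(1), of "\<lambda>\<phi>. blinfun_apply \<phi> z"] by simp
    show "AE t in M. (\<lambda>k. \<sigma> k t z) \<longlonglongrightarrow> m t z"
      using \<sigma>(2) by eventually_elim (intro tendsto_intros)
  qed
  have n_meas: "(\<lambda>t. norm (m t - s i t)) \<in> borel_measurable M" for i
    unfolding strongly_measurable_iff_borel[OF M, symmetric] strongly_measurable_def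
  proof (intro exI conjI allI)
    show "simple_function M (\<lambda>t. norm (\<sigma> k t - s i t))" for k
      using simple_function_compose2[OF \<sigma>(1) s_sf, of "\<lambda>a b. norm (a - b)"] by simp
    show "AE t in M. (\<lambda>k. norm (\<sigma> k t - s i t)) \<longlonglongrightarrow> norm (m t - s i t)"
      using \<sigma>(2) by eventually_elim (intro tendsto_intros)
  qed
  have "has_bochner_integral M (\<lambda>t. m t z) (\<zeta> z)"
  proof (rule has_bochner_integral.intros[OF m_meas])
    show "Bochner_Integration.simple_bochner_integrable M (\<lambda>t. s i t z)" for i
      using simple_bochner_integrable_compose2[of "\<lambda>\<phi> _. blinfun_apply \<phi> z", OF _ s s] by simp
    show "(\<lambda>i. \<integral>\<^sup>+ t. ennreal (norm (m t z - s i t z)) \<partial>M) \<longlonglongrightarrow> 0"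
    proof (rule tendsto_sandwich[OF _ _ tendsto_const])
      have "(\<integral>\<^sup>+ t. ennreal (norm (m t z - s i t z)) \<partial>M)
          \<le> ennreal (norm z) * (\<integral>\<^sup>+ t. ennreal (norm (m t - s i t)) \<partial>M)" for i
      proof -
        have "norm (m t z - s i t z) \<le> norm z * norm (m t - s i t)" for t
          using norm_blinfun[of "m t - s i t" z] by (simp add: blinfun.diff_left mult.commute)
        then have "(\<integral>\<^sup>+ t. ennreal (norm (m t z - s i t z)) \<partial>M)
            \<le> (\<integral>\<^sup>+ t. ennreal (norm z) * ennreal (norm (m t - s i t)) \<partial>M)"
          by (intro nn_integral_mono) (simp add: ennreal_mult[symmetric] ennreal_leI)
        then show ?thesis using n_meas[of i] by (simp add: nn_integral_cmult)
      qed
      then show "\<forall>\<^sub>F i in sequentially. (\<integral>\<^sup>+ t. ennreal (norm (m t z - s i t z)) \<partial>M)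
          \<le> ennreal (norm z) * (\<integral>\<^sup>+ t. ennreal (norm (m t - s i t)) \<partial>M)"
        by simp
      show "(\<lambda>i. ennreal (norm z) * (\<integral>\<^sup>+ t. ennreal (norm (m t - s i t)) \<partial>M)) \<longlonglongrightarrow> 0"
        using ennreal_tendsto_cmult[OF _ s_lim(1), of "ennreal (norm z)"] by simp
    qed simp
    have "Bochner_Integration.simple_bochner_integral M (\<lambda>t. s i t z)
        = Bochner_Integration.simple_bochner_integral M (s i) z" for i
      by (rule simple_bochner_integral_linear[of "\<lambda>\<phi>. blinfun_apply \<phi> z", OF _ s])
        (auto intro!: linearI simp: blinfun.add_left blinfun.scaleR_left)
    then show "(\<lambda>i. Bochner_Integration.simple_bochner_integral M (\<lambda>t. s i t z)) \<longlonglongrightarrow> \<zeta> z"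
      by (simp add: tendsto_intros s_lim(2))
  qed
  then show "integrable M (\<lambda>t. m t z)" "\<zeta> z = (\<integral>t. m t z \<partial>M)"
    by (auto simp: has_bochner_integral_iff)
qed

text \<open>Reduces a norm bound to countably many scalar conditions, which makes
  \<open>norm (m t - \<phi>)\<close> measurable although \<open>m\<close> is only known to be
  measurable pointwise on \<open>X\<close>.\<close>

lemma norm_blinfun_le_iff_dense:
  fixes \<phi> :: "'b::real_normed_vector dual" and e :: "nat \<Rightarrow> 'b"
  assumes e: "closure (range e) = UNIV" and c: "0 \<le> c"
  shows "norm \<phi> \<le> c \<longleftrightarrow> (\<forall>i. \<bar>\<phi> (e i)\<bar> \<le> c * norm (e i))"
proof
  show "\<forall>i. \<bar>\<phi> (e i)\<bar> \<le> c * norm (e i)" if "norm \<phi> \<le> c"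
    using order_trans[OF norm_blinfun mult_right_mono[OF that norm_ge_zero]] by auto
  assume le: "\<forall>i. \<bar>\<phi> (e i)\<bar> \<le> c * norm (e i)"
  have "closed {z. \<bar>\<phi> z\<bar> \<le> c * norm z}"
    by (intro closed_Collect_le continuous_intros)
  then have "closure (range e) \<subseteq> {z. \<bar>\<phi> z\<bar> \<le> c * norm z}"
    using le by (intro closure_minimal) auto
  then show "norm \<phi> \<le> c" using c e by (intro norm_blinfun_bound) auto
qed

text \<open>A form of Pettis' theorem: a separable dual is the closure of a sequence \<open>\<zeta>\<close>, and \<open>m t\<close> is the
  limit of the best approximations of \<open>m t\<close> by \<open>0\<close> and the first terms of \<open>\<zeta>\<close>.\<close>

lemma weak_star_measurable_bochner:
  fixes m :: "'t \<Rightarrow> 'b::{real_normed_vector, second_countable_topology} dual"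
    and \<zeta> :: "nat \<Rightarrow> 'b dual" and I :: "'b dual"
  assumes \<zeta>: "closure (range \<zeta>) = UNIV" and g: "integrable M g" "\<And>t. norm (m t) \<le> g t"
    and m: "\<And>z. integrable M (\<lambda>t. m t z)" and I: "\<And>z. I z = (\<integral>t. m t z \<partial>M)"
  shows "has_strong_bochner_integral M m I"
proof -
  obtain e :: "nat \<Rightarrow> 'b" where e: "closure (range e) = UNIV" by (rule ex_dense_seq)
  have [measurable]: "(\<lambda>t. m t z) \<in> borel_measurable M" for z using m by auto
  have n_meas: "(\<lambda>t. norm (m t - \<phi>)) \<in> borel_measurable M" for \<phi>
    unfolding borel_measurable_iff_le
  proof
    fix c
    show "{t \<in> space M. norm (m t - \<phi>) \<le> c} \<in> sets M"
    proof (cases "0 \<le> c")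
      case True
      have "{t \<in> space M. norm (m t - \<phi>) \<le> c} = {t \<in> space M. \<forall>i. \<bar>m t (e i) - \<phi> (e i)\<bar> \<le> c * norm (e i)}"
        using norm_blinfun_le_iff_dense[OF e True] by (simp add: blinfun.diff_left)
      also have "\<dots> \<in> sets M" by measurable
      finally show ?thesis .
    next
      case False
      then have "{t \<in> space M. norm (m t - \<phi>) \<le> c} = {}"
        using norm_ge_zero order_trans by blast
      then show ?thesis by (metis sets.empty_sets)
    qed
  qed
  \<comment> \<open>Having \<open>0\<close> among the competitors bounds the approximation error by
    \<open>norm (m t)\<close>, hence by \<open>g t\<close>, as dominated convergence
    requires.\<close>
  define d where "d = case_nat 0 \<zeta>"
  have meas: "(\<lambda>t. ereal (- norm (m t - d i))) \<in> borel_measurable M" for i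
    using n_meas[of "d i"] by measurable
  obtain s where s_sf: "\<And>n. simple_function M (s n)" and "\<And>n t. s n t \<le> n"
    and s_max: "\<And>n i t. i \<le> n \<Longrightarrow> ereal (- norm (m t - d i)) \<le> ereal (- norm (m t - d (s n t)))"
    by (rule simple_argmax[of "\<lambda>i t. ereal (- norm (m t - d i))", OF meas]) (assumption | rule that)+
  define S where "S = (\<lambda>n t. d (s n t))"
  have S_sf: "simple_function M (S n)" for n
    unfolding S_def using simple_function_compose1[OF s_sf, of d] by (simp add: o_def)
  have S_le: "norm (m t - S n t) \<le> norm (m t - d i)" if "i \<le> n" for i n t
    using s_max[OF that, of t] by (simp add: S_def)
  have S_le_g: "norm (m t - S n t) \<le> g t" for n t
    using S_le[of 0 n t] g(2)[of t] by (simp add: d_def)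
  have S_lim: "(\<lambda>n. S n t) \<longlonglongrightarrow> m t" for t
  proof (rule metric_LIMSEQ_I)
    fix r :: real assume "0 < r"
    moreover have "m t \<in> closure (range \<zeta>)" using \<zeta> by simp
    ultimately obtain i where i: "dist (\<zeta> i) (m t) < r" unfolding closure_approachable by blast
    have "dist (S n t) (m t) < r" if "Suc i \<le> n" for n
      using S_le[OF that, of t] i by (simp add: d_def dist_norm norm_minus_commute)
    then show "\<exists>n0. \<forall>n\<ge>n0. dist (S n t) (m t) < r" by blast
  qed
  have d_meas: "(\<lambda>t. norm (m t - S n t)) \<in> borel_measurable M" for n
    unfolding S_def
    by (rule measurable_compose_countable[where f = "\<lambda>i t. norm (m t - d i)", OF n_meas measurable_simple_function[OF s_sf]])
  have d_int: "integrable M (\<lambda>t. norm (m t - S n t))" for n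
    using S_le_g by (intro Bochner_Integration.integrable_bound[OF g(1) d_meas] AE_I2)
      (auto intro: order_trans[OF _ abs_ge_self])
  have d_lim: "(\<lambda>n. \<integral>t. norm (m t - S n t) \<partial>M) \<longlonglongrightarrow> 0"
  proof -
    have "(\<lambda>n. \<integral>t. norm (m t - S n t) \<partial>M) \<longlonglongrightarrow> (\<integral>t. 0 \<partial>M)"
    proof (rule integral_dominated_convergence[OF _ d_meas g(1)])
      show "AE t in M. (\<lambda>n. norm (m t - S n t)) \<longlonglongrightarrow> 0"
      proof (rule AE_I2)
        show "(\<lambda>n. norm (m t - S n t)) \<longlonglongrightarrow> 0" for t
          using tendsto_norm[OF tendsto_diff[OF tendsto_const[of "m t"] S_lim[of t]]] by simp
      qed
    qed (use S_le_g in auto)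
    then show ?thesis by simp
  qed
  have S_int: "Bochner_Integration.simple_bochner_integrable M (S n)" for n
  proof (rule simple_bochner_integrableI_bounded[OF S_sf])
    have "norm (S n t) \<le> 2 * g t" for t
      using norm_triangle_ineq2[of "S n t" "m t"] S_le_g[of t n] g(2)[of t]
      by (simp add: norm_minus_commute)
    then have "(\<integral>\<^sup>+ t. ennreal (norm (S n t)) \<partial>M) \<le> (\<integral>\<^sup>+ t. ennreal (2 * g t) \<partial>M)"
      by (intro nn_integral_mono ennreal_leI)
    also have "\<dots> < \<infinity>"
      using g order_trans[OF norm_ge_zero g(2)] by (subst nn_integral_eq_integral) auto
    finally show "(\<integral>\<^sup>+ t. ennreal (norm (S n t)) \<partial>M) < \<infinity>" .
  qed
  show ?thesis
    unfolding has_strong_bochner_integral_def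
  proof (intro conjI exI allI)
    show "strongly_measurable M m" unfolding strongly_measurable_def using S_sf S_lim by blast
    show "Bochner_Integration.simple_bochner_integrable M (S n)" for n by (rule S_int)
    have "(\<integral>\<^sup>+ t. ennreal (norm (m t - S n t)) \<partial>M) = ennreal (\<integral>t. norm (m t - S n t) \<partial>M)" for n
      using d_int by (intro nn_integral_eq_integral) auto
    then show "(\<lambda>n. \<integral>\<^sup>+ t. ennreal (norm (m t - S n t)) \<partial>M) \<longlonglongrightarrow> 0"
      using tendsto_ennrealI[OF d_lim] by simp
    show "(\<lambda>n. Bochner_Integration.simple_bochner_integral M (S n)) \<longlonglongrightarrow> I"
    proof (rule LIM_zero_cancel, rule Lim_null_comparison[OF _ d_lim], rule always_eventually, rule allI)
      fix n
      have "norm ((Bochner_Integration.simple_bochner_integral M (S n) - I) z)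
          \<le> (\<integral>t. norm (m t - S n t) \<partial>M) * norm z" for z
      proof -
        have Sz: "Bochner_Integration.simple_bochner_integrable M (\<lambda>t. S n t z)"
          using simple_bochner_integrable_compose2[of "\<lambda>\<phi> _. blinfun_apply \<phi> z", OF _ S_int S_int] by simp
        have "Bochner_Integration.simple_bochner_integral M (S n) z
            = Bochner_Integration.simple_bochner_integral M (\<lambda>t. S n t z)"
          by (rule simple_bochner_integral_linear[of "\<lambda>\<phi>. blinfun_apply \<phi> z", OF _ S_int, symmetric])
            (auto intro!: linearI simp: blinfun.add_left blinfun.scaleR_left)
        then have int: "has_bochner_integral M (\<lambda>t. S n t z) (Bochner_Integration.simple_bochner_integral M (S n) z)"
          using has_bochner_integral_simple_bochner_integrable[OF Sz] by simp
        then have "(Bochner_Integration.simple_bochner_integral M (S n) - I) z = (\<integral>t. S n t z - m t z \<partial>M)"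
          using m[of z] I[of z] by (simp add: has_bochner_integral_iff blinfun.diff_left)
        also have "norm \<dots> \<le> (\<integral>t. norm (m t - S n t) * norm z \<partial>M)"
        proof (rule order_trans[OF integral_norm_bound integral_mono])
          show "norm (S n t z - m t z) \<le> norm (m t - S n t) * norm z" for t
            using norm_blinfun[of "m t - S n t" z] by (simp add: blinfun.diff_left abs_minus_commute)
        qed (use int m d_int in \<open>auto simp: has_bochner_integral_iff\<close>)
        finally show ?thesis by simp
      qed
      then show "norm (Bochner_Integration.simple_bochner_integral M (S n) - I) \<le> (\<integral>t. norm (m t - S n t) \<partial>M)"
        by (intro norm_blinfun_bound integral_nonneg_AE) auto
    qed
  qed
qed

section \<open>Assembling the two formulas\<close>

lemma Linf_norm_le:
  assumes u: "simple_function M u" and c: "0 \<le> c" and le: "\<And>t. t \<in> space M \<Longrightarrow> norm (u t) \<le> c"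
  shows "Linf_norm M u \<le> ereal c"
proof -
  have "(\<lambda>t. ereal (norm (u t))) \<in> borel_measurable M"
    using borel_measurable_simple_function[OF simple_function_compose1[OF u, of "\<lambda>y. ereal (norm y)"]]
    by simp
  then have "esssup M (\<lambda>t. ereal (norm (u t))) \<le> ereal c"
    using le by (intro esssup_I) auto
  then show ?thesis using c by (simp add: Linf_norm_def)
qed

lemma simple_function_Linf:
  fixes u :: "'t \<Rightarrow> 'b::real_normed_vector"
  assumes u: "simple_function M u"
  shows "u \<in> Linf M"
proof -
  define b where "b = (\<Sum>y\<in>u ` space M. norm y)"
  have "norm (u t) \<le> b" if "t \<in> space M" for t
    unfolding b_def using simple_functionD(1)[OF u] that by (intro member_le_sum) auto
  moreover have "0 \<le> b" by (simp add: b_def sum_nonneg)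
  ultimately have "Linf_norm M u \<le> ereal b" by (intro Linf_norm_le u)
  then have "Linf_norm M u < \<infinity>" by (rule le_less_trans) simp
  moreover have "strongly_measurable M u"
    unfolding strongly_measurable_def using u by (intro exI[of _ "\<lambda>_. u"]) auto
  ultimately show ?thesis by (simp add: Linf_def)
qed

text \<open>\<open>R\<close> stands for either kind of integral of the subdifferentials, so both
  formulas reduce to the same pair of inclusions. The second tolerance is
  \<open>\<epsilon> - e\<close>.\<close>

lemma eps_subdiff_eq_Union_if:
  assumes sub: "\<And>\<xi>. \<xi> \<in> E \<Longrightarrow> \<exists>e l. \<exists>\<zeta>\<in>R l. 0 \<le> e \<and> e \<le> \<epsilon> \<and> l \<in> L1_budget M e \<and> \<xi> - \<zeta> \<in> eps_normal (\<epsilon> - e) D x"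
    and super: "\<And>e1 e2 l \<zeta> \<eta>. \<epsilon> = e1 + e2 \<Longrightarrow> l \<in> L1_budget M e1 \<Longrightarrow> \<zeta> \<in> R l \<Longrightarrow>
      \<eta> \<in> eps_normal e2 D x \<Longrightarrow> \<zeta> + \<eta> \<in> E"
  shows "E = (\<Union>(\<epsilon>1, \<epsilon>2, l) \<in> {(\<epsilon>1, \<epsilon>2, l). \<epsilon> = \<epsilon>1 + \<epsilon>2 \<and> \<epsilon>1 \<ge> 0 \<and> \<epsilon>2 \<ge> 0 \<and> l \<in> L1_budget M \<epsilon>1}.
      R l + eps_normal \<epsilon>2 D x)"
proof (intro equalityI subsetI)
  fix \<xi> assume "\<xi> \<in> E"
  then obtain e l \<zeta> where *: "\<zeta> \<in> R l" "0 \<le> e" "e \<le> \<epsilon>" "l \<in> L1_budget M e" "\<xi> - \<zeta> \<in> eps_normal (\<epsilon> - e) D x"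
    using sub by blast
  then have "\<zeta> + (\<xi> - \<zeta>) \<in> R l + eps_normal (\<epsilon> - e) D x" by (intro set_plus_intro)
  then show "\<xi> \<in> (\<Union>(\<epsilon>1, \<epsilon>2, l) \<in> {(\<epsilon>1, \<epsilon>2, l). \<epsilon> = \<epsilon>1 + \<epsilon>2 \<and> \<epsilon>1 \<ge> 0 \<and> \<epsilon>2 \<ge> 0 \<and> l \<in> L1_budget M \<epsilon>1}.
      R l + eps_normal \<epsilon>2 D x)"
    using * by (intro UN_I[of "(e, \<epsilon> - e, l)"]) auto
next
  fix \<xi> assume "\<xi> \<in> (\<Union>(\<epsilon>1, \<epsilon>2, l) \<in> {(\<epsilon>1, \<epsilon>2, l). \<epsilon> = \<epsilon>1 + \<epsilon>2 \<and> \<epsilon>1 \<ge> 0 \<and> \<epsilon>2 \<ge> 0 \<and> l \<in> L1_budget M \<epsilon>1}.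
      R l + eps_normal \<epsilon>2 D x)"
  then show "\<xi> \<in> E" using super by (auto elim!: set_plus_elim)
qed

text \<open>Both formulas rest on the same \<open>m\<close>; reflexivity serves to make the dual
  separable and thereby \<open>m\<close> strongly measurable. Points where the integral function is
  \<open>-\<infinity>\<close> are set aside because the left side is empty there by convention,
  while the right side need not be.\<close>

theorem theorem3:
  fixes M :: "'t measure"
    and f :: "'t \<Rightarrow> 'a::{banach, second_countable_topology} \<Rightarrow> ereal"
    and x0 :: 'a
  assumes "complete_measure M"
    and "sigma_finite_measure M"
    and "convex_normal_integrand M f"
    and "\<exists>r>0. \<exists>C::real. \<forall>u\<in>Linf M.
           Linf_norm M (\<lambda>t. u t - x0) < ereal r \<longrightarrow> integral_functional M f u \<le> ereal C"
  shows
    "(\<forall>x. integral_fun M f x \<noteq> -\<infinity> \<longrightarrow> (\<forall>\<epsilon>\<ge>0.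
        eps_subdiff \<epsilon> (integral_fun M f) x =
        (\<Union>(\<epsilon>1, \<epsilon>2, l) \<in> {(\<epsilon>1, \<epsilon>2, l). \<epsilon> = \<epsilon>1 + \<epsilon>2 \<and> \<epsilon>1 \<ge> 0 \<and> \<epsilon>2 \<ge> 0 \<and> l \<in> L1_budget M \<epsilon>1}.
           {gelfand_integral M m | m. m \<in> L1_wstar M \<and> (AE t in M. m t \<in> eps_subdiff (l t) (f t) x)}
           + eps_normal \<epsilon>2 (eff_dom (integral_fun M f)) x)))
     \<and>
     (reflexive_space TYPE('a) \<longrightarrow>
      (\<forall>x. integral_fun M f x \<noteq> -\<infinity> \<longrightarrow> (\<forall>\<epsilon>\<ge>0.
        eps_subdiff \<epsilon> (integral_fun M f) x =
        (\<Union>(\<epsilon>1, \<epsilon>2, l) \<in> {(\<epsilon>1, \<epsilon>2, l). \<epsilon> = \<epsilon>1 + \<epsilon>2 \<and> \<epsilon>1 \<ge> 0 \<and> \<epsilon>2 \<ge> 0 \<and> l \<in> L1_budget M \<epsilon>1}.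
           set_bochner_integral M (\<lambda>t. eps_subdiff (l t) (f t) x)
           + eps_normal \<epsilon>2 (eff_dom (integral_fun M f)) x))))"
proof -
  interpret sigma_finite_measure M by fact
  note f = assms(3)
  obtain r C where r: "0 < r" and C: "\<And>u. u \<in> Linf M \<Longrightarrow> Linf_norm M (\<lambda>t. u t - x0) < ereal r \<Longrightarrow>
      integral_functional M f u \<le> ereal C"
    using assms(4) by blast
  \<comment> \<open>The radius is halved because values strictly inside a ball bound the essential
    supremum only weakly, whereas the hypothesis asks for a strict inequality.\<close>
  have bnd: "integral_functional M f u \<le> ereal C"
    if u: "simple_function M u" "\<And>t. u t \<in> ball x0 (r / 2)" for u
  proof (rule C[OF simple_function_Linf[OF u(1)]])
    have "norm (u t - x0) \<le> r / 2" for t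
      using u(2)[of t] by (simp add: dist_norm norm_minus_commute)
    moreover have "simple_function M (\<lambda>t. u t - x0)"
      using simple_function_compose1[OF u(1), of "\<lambda>y. y - x0"] by simp
    ultimately have "Linf_norm M (\<lambda>t. u t - x0) \<le> ereal (r / 2)" using r by (intro Linf_norm_le) auto
    also have "\<dots> < ereal r" using r by simp
    finally show "Linf_norm M (\<lambda>t. u t - x0) < ereal r" .
  qed
  \<comment> \<open>The majorant \<open>g\<close> is kept next to membership in
    \<open>L1_wstar\<close>, since the reflexive case needs it for Bochner integrability.\<close>
  have decomp: "\<exists>(m :: 't \<Rightarrow> 'a dual) g l e. integrable M g \<and> (\<forall>t. norm (m t) \<le> g t) \<and>
      (\<forall>z. integrable M (\<lambda>t. blinfun_apply (m t) z)) \<and> m \<in> L1_wstar M \<and>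
      l \<in> L1_budget M e \<and> 0 \<le> e \<and> e \<le> \<epsilon> \<and> (AE t in M. m t \<in> eps_subdiff (l t) (f t) x) \<and>
      \<xi> - gelfand_integral M m \<in> eps_normal (\<epsilon> - e) (eff_dom (integral_fun M f)) x"
    if \<xi>: "\<xi> \<in> eps_subdiff \<epsilon> (integral_fun M f) x" for \<xi> \<epsilon> x
  proof -
    obtain m :: "'t \<Rightarrow> 'a dual" and g l e where
      g: "integrable M g" "\<And>t. norm (m t) \<le> g t" and m: "\<And>z. integrable M (\<lambda>t. m t z)"
      and l: "l \<in> L1_budget M e" "0 \<le> e" "e \<le> \<epsilon>" "AE t in M. m t \<in> eps_subdiff (l t) (f t) x"
      and le: "\<And>w. integral_fun M f (x + w) < \<infinity> \<Longrightarrow> \<xi> w - (\<integral>t. m t w \<partial>M) \<le> \<epsilon> - e"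
      by (rule eps_subdiff_integral_decomposition[OF f half_gt_zero[OF r] bnd \<xi>]) (assumption | rule that)+
    have mL: "m \<in> L1_wstar M" using g m by (rule norm_bounded_L1_wstar)
    have "x \<in> eff_dom (integral_fun M f)"
      using \<xi> by (auto simp: eps_subdiff_def eff_dom_def split: if_splits)
    moreover have "blinfun_apply (\<xi> - gelfand_integral M m) (y - x) \<le> \<epsilon> - e" if "y \<in> eff_dom (integral_fun M f)" for y
      using le[of "y - x"] that by (simp add: eff_dom_def blinfun.diff_left gelfand_integral_apply[OF mL])
    ultimately have "\<xi> - gelfand_integral M m \<in> eps_normal (\<epsilon> - e) (eff_dom (integral_fun M f)) x"
      by (auto simp: eps_normal_def eps_subdiff_def indicator_fun_def)
    then show ?thesis using g m mL l by blast
  qed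
  show ?thesis
  proof (intro conjI allI impI)
    fix x and \<epsilon> :: real
    assume x: "integral_fun M f x \<noteq> -\<infinity>" and "\<epsilon> \<ge> 0"
    show "eps_subdiff \<epsilon> (integral_fun M f) x =
        (\<Union>(\<epsilon>1, \<epsilon>2, l) \<in> {(\<epsilon>1, \<epsilon>2, l). \<epsilon> = \<epsilon>1 + \<epsilon>2 \<and> \<epsilon>1 \<ge> 0 \<and> \<epsilon>2 \<ge> 0 \<and> l \<in> L1_budget M \<epsilon>1}.
           {gelfand_integral M m | m. m \<in> L1_wstar M \<and> (AE t in M. m t \<in> eps_subdiff (l t) (f t) x)}
           + eps_normal \<epsilon>2 (eff_dom (integral_fun M f)) x)"
    proof (rule eps_subdiff_eq_Union_if)
      fix \<xi> assume "\<xi> \<in> eps_subdiff \<epsilon> (integral_fun M f) x"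
      from decomp[OF this]
      show "\<exists>e l. \<exists>\<zeta>\<in>{gelfand_integral M m | m. m \<in> L1_wstar M \<and> (AE t in M. m t \<in> eps_subdiff (l t) (f t) x)}.
          0 \<le> e \<and> e \<le> \<epsilon> \<and> l \<in> L1_budget M e \<and> \<xi> - \<zeta> \<in> eps_normal (\<epsilon> - e) (eff_dom (integral_fun M f)) x"
        by blast
    next
      fix e1 e2 l \<zeta> \<eta>
      assume *: "\<epsilon> = e1 + e2" "l \<in> L1_budget M e1" "\<eta> \<in> eps_normal e2 (eff_dom (integral_fun M f)) x"
        "\<zeta> \<in> {gelfand_integral M m | m. m \<in> L1_wstar M \<and> (AE t in M. m t \<in> eps_subdiff (l t) (f t) x)}"
      then obtain m where m: "\<zeta> = gelfand_integral M m" "m \<in> L1_wstar M" "AE t in M. m t \<in> eps_subdiff (l t) (f t) x"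
        by blast
      then have "integrable M (\<lambda>t. blinfun_apply (m t) z)" for z by (simp add: L1_wstar_def)
      then show "\<zeta> + \<eta> \<in> eps_subdiff \<epsilon> (integral_fun M f) x"
        unfolding *(1) using m * by (intro eps_subdiff_integral_fun_superset[OF f x, of m])
          (auto simp: gelfand_integral_apply)
    qed
  next
    fix x and \<epsilon> :: real
    assume refl: "reflexive_space TYPE('a)" and x: "integral_fun M f x \<noteq> -\<infinity>" and "\<epsilon> \<ge> 0"
    obtain \<zeta>s :: "nat \<Rightarrow> 'a dual" where \<zeta>s: "closure (range \<zeta>s) = UNIV"
      by (rule reflexive_dual_dense_seq[OF refl])
    show "eps_subdiff \<epsilon> (integral_fun M f) x =
        (\<Union>(\<epsilon>1, \<epsilon>2, l) \<in> {(\<epsilon>1, \<epsilon>2, l). \<epsilon> = \<epsilon>1 + \<epsilon>2 \<and> \<epsilon>1 \<ge> 0 \<and> \<epsilon>2 \<ge> 0 \<and> l \<in> L1_budget M \<epsilon>1}.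
           set_bochner_integral M (\<lambda>t. eps_subdiff (l t) (f t) x)
           + eps_normal \<epsilon>2 (eff_dom (integral_fun M f)) x)"
    proof (rule eps_subdiff_eq_Union_if)
      fix \<xi> assume "\<xi> \<in> eps_subdiff \<epsilon> (integral_fun M f) x"
      from decomp[OF this] obtain m :: "'t \<Rightarrow> 'a dual" and g l e where
        g: "integrable M g" "\<And>t. norm (m t) \<le> g t" and m: "\<And>z. integrable M (\<lambda>t. m t z)" "m \<in> L1_wstar M"
        and l: "l \<in> L1_budget M e" "0 \<le> e" "e \<le> \<epsilon>" "AE t in M. m t \<in> eps_subdiff (l t) (f t) x"
          "\<xi> - gelfand_integral M m \<in> eps_normal (\<epsilon> - e) (eff_dom (integral_fun M f)) x"
        by blast
      have "has_strong_bochner_integral M m (gelfand_integral M m)"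
        using weak_star_measurable_bochner[OF \<zeta>s g m(1) gelfand_integral_apply[OF m(2)]] .
      then show "\<exists>e l. \<exists>\<zeta>\<in>set_bochner_integral M (\<lambda>t. eps_subdiff (l t) (f t) x).
          0 \<le> e \<and> e \<le> \<epsilon> \<and> l \<in> L1_budget M e \<and> \<xi> - \<zeta> \<in> eps_normal (\<epsilon> - e) (eff_dom (integral_fun M f)) x"
        using l unfolding set_bochner_integral_def by blast
    next
      fix e1 e2 l \<zeta> \<eta>
      assume *: "\<epsilon> = e1 + e2" "l \<in> L1_budget M e1" "\<eta> \<in> eps_normal e2 (eff_dom (integral_fun M f)) x"
        "\<zeta> \<in> set_bochner_integral M (\<lambda>t. eps_subdiff (l t) (f t) x)"
      then obtain m where m: "has_strong_bochner_integral M m \<zeta>" "AE t in M. m t \<in> eps_subdiff (l t) (f t) x"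
        by (auto simp: set_bochner_integral_def)
      show "\<zeta> + \<eta> \<in> eps_subdiff \<epsilon> (integral_fun M f) x"
        unfolding *(1)
        by (rule eps_subdiff_integral_fun_superset[OF f x has_strong_bochner_integral_apply[OF assms(1) m(1)] *(2) m(2) *(3)])
    qed
  qed
qed

end
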